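(* Let $G$ be a Lie group with Lie algebra $\mathfrak{g}$, $[X_1\rightrightarrows X_0]$ a Lie groupoid equipped with an integrable connection $\mathcal{H}\subseteq TX_1$, and $(E_G\xrightarrow{\pi}X_0,[X_1\rightrightarrows X_0])$ a principal $G$-bundle over it. Let $\mathcal{D}$ be a connection on $(E_G\to X_0,[X_1\rightrightarrows X_0])$, and $\mathcal{K}_{\mathcal{D}}$ the curvature $2$-form of the connection $\mathcal{D}$ on the underlying principal $G$-bundle $E_G\to X_0$. Then $\mathcal{K}_{\mathcal{D}}$ is a differential $2$-form on the Lie groupoid $[X_1\rightrightarrows X_0]$ (with respect to $\mathcal{H}$).
   Context: Connections on Lie groupoids. A Lie groupoid $[X_1\rightrightarrows X_0]$ has smooth structure maps and submersive source and target $s,t$; $e(a)=1_a$ is the unit map. A connection on it is a sub-bundle $\mathcal{H}\subseteq TX_1$ with $T_\gamma X_1=\mathcal{H}_\gamma X_1\oplus\ker(s_{*,\gamma})$ for all $\gamma$ such that, with $\theta_\gamma=t_{*,\gamma}\circ(s_{*,\gamma}|_{\mathcal{H}_\gamma X_1})^{-1}$, (1) $\theta_{\gamma\circ\gamma'}=\theta_\gamma\circ\theta_{\gamma'}$ for composable $\gamma,\gamma'$, and (2) $e_{*,a}(T_aX_0)=\mathcal{H}_{1_a}$. It is integrable if brackets of vector fields in $\mathcal{H}$ lie in $\mathcal{H}$. $\mathcal{H}_\gamma(v)$ is the component of $v\in T_\gamma X_1$ in $\mathcal{H}_\gamma X_1$. For a $k$-form $\eta$ on $X_1$, $\mathcal{H}(\eta)(\gamma)(v_1,\dots,v_k)=\eta(\gamma)(\mathcal{H}_\gamma(v_1),\dots,\mathcal{H}_\gamma(v_k))$.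 A differential $k$-form on the Lie groupoid with respect to $\mathcal{H}$ is a $k$-form $\omega$ on $X_0$ with $\mathcal{H}(s^*\omega)=\mathcal{H}(t^*\omega)$. Principal bundles. A principal $G$-bundle $(E_G\to X_0,[X_1\rightrightarrows X_0])$ is a (right) principal $G$-bundle $\pi\colon E_G\to X_0$ with a smooth left action $\mu\colon X_1\times_{s,X_0,\pi}E_G\to E_G$, $(\gamma,a)\mapsto\gamma a$, of $[X_1\rightrightarrows X_0]$ ($\pi(\gamma a)=t(\gamma)$, $1_{\pi(a)}a=a$, $\gamma(\gamma'a)=(\gamma\circ\gamma')a$) with $(\gamma a)g=\gamma(ag)$. Let $\widetilde\theta_{(\gamma,a)}\colon T_aE_G\to T_{\gamma a}E_G$, $\widetilde\theta_{(\gamma,a)}(w)=\mu_{*,(\gamma,a)}(\mathcal{H}_\gamma(v),w)$ for any $v\in T_\gamma X_1$ with $s_{*,\gamma}(v)=\pi_{*,a}(w)$. Connections on principal bundles. $G$ acts on $TE_G$ by differentials of right translations and on $E_G\times\mathfrak{g}$ by $(a,A)g=(ag,\mathrm{ad}(g^{-1})A)$ (adjoint representation). The Atiyah sequence is $0\to(E_G\times\mathfrak{g})/G\xrightarrow{j^{/G}}(TE_G)/G\xrightarrow{\pi_*^{/G}}TX_0\to0$, $j^{/G}[(a,A)]=[A^*(a)]$ with $A^*$ the fundamental vector field of $A$. The groupoid acts fibrewise-linearly by $\gamma\cdot[(a,A)]=[(\gamma a,A)]$, $\gamma\cdot[w]=[\widetilde\theta_{(\gamma,a)}(w)]$ for $w\in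 T_aE_G$, and $\gamma\cdot v=\theta_\gamma(v)$. A connection on $(E_G\to X_0,[X_1\rightrightarrows X_0])$ is a splitting of this sequence as vector bundles over $[X_1\rightrightarrows X_0]$, i.e. a groupoid-equivariant vector bundle morphism $\mathcal{D}\colon(TE_G)/G\to(E_G\times\mathfrak{g})/G$ over $X_0$ with $\mathcal{D}\circ j^{/G}=\mathrm{id}$; equivalently the section $\mathcal{S}\colon TX_0\to(TE_G)/G$ with $\pi_*^{/G}\circ\mathcal{S}=\mathrm{id}$, $\mathcal{D}\circ\mathcal{S}=0$. Curvature. Sections of $(TE_G)/G$ are identified with $G$-invariant vector fields on $E_G$ and so have a Lie bracket. For vector fields $X,Y$ on $X_0$, $\mathcal{K}_{\mathcal{D}}(X,Y)$ is the section of $(E_G\times\mathfrak{g})/G$ with $j^{/G}\circ\mathcal{K}_{\mathcal{D}}(X,Y)=\mathcal{S}\circ[X,Y]-[\mathcal{S}\circ X,\mathcal{S}\circ Y]$; this defines the curvature $2$-form $\mathcal{K}_{\mathcal{D}}$ on $X_0$. Its values are regarded as elements of $\mathfrak{g}$ via the isomorphisms $\mathfrak{g}\to((E_G\times\mathfrak{g})/G)_{\pi(a)}$, $A\mapsto[(a,A)]$, $a\in E_G$. In the condition $\mathcal{H}(s^*\mathcal{K}_{\mathcal{D}})=\mathcal{H}(t^*\mathcal{K}_{\mathcal{D}})$ at $\gamma\in X_1$, the values in the fibres over $s(\gamma)$ and $t(\gamma)$ are compared through the points $a\in\pi^{-1}(s(\gamma))$ and $\gamma a\in\pi^{-1}(t(\gamma))$,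 i.e. through the action $\gamma\cdot[(a,A)]=[(\gamma a,A)]$. *)

theory Defs
  imports "HOL-Analysis.Analysis" "HOL-Algebra.Group"
begin

section \<open>Smooth functions between finite-dimensional vector spaces\<close>

text \<open>Intended for open sets and finite-dimensional domains, where the mixed directional
  derivatives of all orders being continuous is the usual notion.\<close>

primrec Ck_on :: "nat \<Rightarrow> 'a::real_normed_vector set \<Rightarrow> ('a \<Rightarrow> 'b::real_normed_vector) \<Rightarrow> bool" where
  "Ck_on 0 S f \<longleftrightarrow> continuous_on S f"
| "Ck_on (Suc k) S f \<longleftrightarrow>
     (\<forall>x\<in>S. f differentiable (at x)) \<and> (\<forall>v. Ck_on k S (\<lambda>x. frechet_derivative f (at x) v))"

definition Cinf_on :: "'a::real_normed_vector set \<Rightarrow> ('a \<Rightarrow> 'b::real_normed_vector) \<Rightarrow> bool" where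
  "Cinf_on S f \<longleftrightarrow> (\<forall>k. Ck_on k S f)"


section \<open>Smooth manifolds\<close>

text \<open>A chart is a domain together with a coordinate map, whose values off the domain are
  irrelevant. A manifold occupies a whole type. The model space \<open>'e\<close> is a finite-dimensional
  normed space rather than a type of class \<open>euclidean_space\<close>, because the latter excludes
  dimension zero.

  The tangent space at \<open>x\<close> is the model space \<open>'e\<close>: a vector stands for the tangent vector at
  \<open>x\<close> having these coordinates in the chart \<open>chart_at M x\<close>, and coordinates in other charts are
  obtained by differentiating the change of charts.\<close>

type_synonym ('a, 'e) chart = "'a set \<times> ('a \<Rightarrow> 'e)"

abbreviation chart_dom :: "('a, 'e) chart \<Rightarrow> 'a set" where
  "chart_dom \<equiv> fst"

abbreviation chart_map :: "('a, 'e) chart \<Rightarrow> 'a \<Rightarrow> 'e" where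
  "chart_map \<equiv> snd"

definition chart_inv :: "('a, 'e) chart \<Rightarrow> 'e \<Rightarrow> 'a" where
  "chart_inv c = inv_into (chart_dom c) (chart_map c)"

record ('a, 'e) charted =
  atlas :: "('a, 'e) chart set"
  chart_at :: "'a \<Rightarrow> ('a, 'e) chart"

definition is_chart :: "('a::topological_space, 'e::real_normed_vector) chart \<Rightarrow> bool" where
  "is_chart c \<longleftrightarrow> open (chart_dom c) \<and> open (chart_map c ` chart_dom c) \<and>
     homeomorphism (chart_dom c) (chart_map c ` chart_dom c) (chart_map c) (chart_inv c)"

definition smooth_manifold ::
  "('a::{t2_space, second_countable_topology}, 'e::real_normed_vector) charted \<Rightarrow> bool" where
  "smooth_manifold M \<longleftrightarrow>
     (\<exists>B::'e set. finite B \<and> span B = UNIV) \<and>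
     (\<forall>c\<in>atlas M. is_chart c) \<and>
     (\<forall>x. chart_at M x \<in> atlas M \<and> x \<in> chart_dom (chart_at M x)) \<and>
     (\<forall>c\<in>atlas M. \<forall>d\<in>atlas M.
        Cinf_on (chart_map c ` (chart_dom c \<inter> chart_dom d)) (chart_map d \<circ> chart_inv c))"

definition prod_chart :: "('a, 'e) chart \<Rightarrow> ('b, 'f) chart \<Rightarrow> ('a \<times> 'b, 'e \<times> 'f) chart" where
  "prod_chart c d = (chart_dom c \<times> chart_dom d, map_prod (chart_map c) (chart_map d))"

definition prod_mfd ::
  "('a, 'e) charted \<Rightarrow> ('b, 'f) charted \<Rightarrow> ('a \<times> 'b, 'e \<times> 'f) charted" where
  "prod_mfd M N =
     \<lparr>atlas = {prod_chart c d | c d. c \<in> atlas M \<and> d \<in> atlas N},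
      chart_at = (\<lambda>(x, y). prod_chart (chart_at M x) (chart_at N y))\<rparr>"

definition smooth_fun_on ::
  "('a::topological_space, 'e::real_normed_vector) charted \<Rightarrow> 'a set
     \<Rightarrow> ('a \<Rightarrow> 'b::real_normed_vector) \<Rightarrow> bool" where
  "smooth_fun_on M U f \<longleftrightarrow>
     (\<forall>c\<in>atlas M. Cinf_on (chart_map c ` (U \<inter> chart_dom c)) (f \<circ> chart_inv c))"

definition smooth_open ::
  "('a::topological_space, 'e::real_normed_vector) charted
     \<Rightarrow> ('b::topological_space, 'f::real_normed_vector) charted \<Rightarrow> 'a set \<Rightarrow> ('a \<Rightarrow> 'b) \<Rightarrow> bool" where
  "smooth_open M N U f \<longleftrightarrow> open U \<and> continuous_on U f \<and>
     (\<forall>c\<in>atlas M. \<forall>d\<in>atlas N.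
        Cinf_on (chart_map c ` (U \<inter> chart_dom c \<inter> f -` chart_dom d))
          (chart_map d \<circ> f \<circ> chart_inv c))"

text \<open>On an arbitrary subset, smoothness is local extendability to a smooth map. On an embedded
  submanifold, such as the fibre product along a submersion, this is smoothness for the
  submanifold structure.\<close>

definition smooth_map_on ::
  "('a::topological_space, 'e::real_normed_vector) charted
     \<Rightarrow> ('b::topological_space, 'f::real_normed_vector) charted \<Rightarrow> 'a set \<Rightarrow> ('a \<Rightarrow> 'b) \<Rightarrow> bool" where
  "smooth_map_on M N S f \<longleftrightarrow>
     (\<forall>x\<in>S. \<exists>U F. x \<in> U \<and> smooth_open M N U F \<and> (\<forall>y\<in>S \<inter> U. F y = f y))"

abbreviation smooth_map ::
  "('a::topological_space, 'e::real_normed_vector) charted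
     \<Rightarrow> ('b::topological_space, 'f::real_normed_vector) charted \<Rightarrow> ('a \<Rightarrow> 'b) \<Rightarrow> bool" where
  "smooth_map M N f \<equiv> smooth_map_on M N UNIV f"

text \<open>The differential \<open>f\<^sub>*\<close> at \<open>x\<close> of a map defined on \<open>S\<close>. When \<open>S\<close> is not open,
  the derivative within \<open>S\<close> is not unique, but its values on vectors tangent to \<open>S\<close> are.\<close>

definition tmap_within ::
  "('a::topological_space, 'e::real_normed_vector) charted
     \<Rightarrow> ('b::topological_space, 'f::real_normed_vector) charted
     \<Rightarrow> 'a set \<Rightarrow> ('a \<Rightarrow> 'b) \<Rightarrow> 'a \<Rightarrow> 'e \<Rightarrow> 'f" where
  "tmap_within M N S f x =
     (let c = chart_at M x; d = chart_at N (f x) in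
      frechet_derivative (chart_map d \<circ> f \<circ> chart_inv c)
        (at (chart_map c x) within chart_map c ` (S \<inter> chart_dom c)))"

abbreviation tmap ::
  "('a::topological_space, 'e::real_normed_vector) charted
     \<Rightarrow> ('b::topological_space, 'f::real_normed_vector) charted
     \<Rightarrow> ('a \<Rightarrow> 'b) \<Rightarrow> 'a \<Rightarrow> 'e \<Rightarrow> 'f" where
  "tmap M N f \<equiv> tmap_within M N UNIV f"

definition submersion ::
  "('a::topological_space, 'e::real_normed_vector) charted
     \<Rightarrow> ('b::topological_space, 'f::real_normed_vector) charted \<Rightarrow> ('a \<Rightarrow> 'b) \<Rightarrow> bool" where
  "submersion M N f \<longleftrightarrow> smooth_map M N f \<and> (\<forall>x. surj (tmap M N f x))"


subsection \<open>Vector fields\<close>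

definition tcoord ::
  "('a, 'e::real_normed_vector) charted \<Rightarrow> ('a, 'e) chart \<Rightarrow> 'a \<Rightarrow> 'e \<Rightarrow> 'e" where
  "tcoord M c x =
     frechet_derivative (chart_map c \<circ> chart_inv (chart_at M x)) (at (chart_map (chart_at M x) x))"

definition vf_rep ::
  "('a, 'e::real_normed_vector) charted \<Rightarrow> ('a, 'e) chart \<Rightarrow> ('a \<Rightarrow> 'e) \<Rightarrow> 'e \<Rightarrow> 'e" where
  "vf_rep M c V y = tcoord M c (chart_inv c y) (V (chart_inv c y))"

definition vector_field_on ::
  "('a::topological_space, 'e::real_normed_vector) charted \<Rightarrow> 'a set \<Rightarrow> ('a \<Rightarrow> 'e) \<Rightarrow> bool" where
  "vector_field_on M U V \<longleftrightarrow>
     (\<forall>c\<in>atlas M. Cinf_on (chart_map c ` (U \<inter> chart_dom c)) (vf_rep M c V))"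

abbreviation vector_field ::
  "('a::topological_space, 'e::real_normed_vector) charted \<Rightarrow> ('a \<Rightarrow> 'e) \<Rightarrow> bool" where
  "vector_field M \<equiv> vector_field_on M UNIV"

text \<open>In local coordinates \<open>[V, W] = DW(V) - DV(W)\<close>.\<close>

definition lie_bracket ::
  "('a, 'e::real_normed_vector) charted \<Rightarrow> ('a \<Rightarrow> 'e) \<Rightarrow> ('a \<Rightarrow> 'e) \<Rightarrow> 'a \<Rightarrow> 'e" where
  "lie_bracket M V W x =
     (let c = chart_at M x; y = chart_map c x in
      frechet_derivative (vf_rep M c W) (at y) (vf_rep M c V y)
      - frechet_derivative (vf_rep M c V) (at y) (vf_rep M c W y))"


section \<open>Lie groups and Lie groupoids\<close>

definition lie_group ::
  "('g::{t2_space, second_countable_topology}, 'w::real_normed_vector) charted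
     \<Rightarrow> 'g monoid \<Rightarrow> bool" where
  "lie_group MG G \<longleftrightarrow> smooth_manifold MG \<and> group G \<and> carrier G = UNIV \<and>
     smooth_map (prod_mfd MG MG) MG (\<lambda>(g, h). g \<otimes>\<^bsub>G\<^esub> h) \<and>
     smooth_map MG MG (\<lambda>g. inv\<^bsub>G\<^esub> g)"

text \<open>The Lie algebra is the tangent space \<open>'w\<close> at the unit element; only its adjoint
  representation is needed.\<close>

definition Ad ::
  "('g::topological_space, 'w::real_normed_vector) charted \<Rightarrow> 'g monoid \<Rightarrow> 'g \<Rightarrow> 'w \<Rightarrow> 'w" where
  "Ad MG G g = tmap MG MG (\<lambda>h. g \<otimes>\<^bsub>G\<^esub> h \<otimes>\<^bsub>G\<^esub> inv\<^bsub>G\<^esub> g) \<one>\<^bsub>G\<^esub>"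

record ('x, 'u, 'y, 'v) groupoid =
  Obj :: "('x, 'u) charted"
  Arr :: "('y, 'v) charted"
  src :: "'y \<Rightarrow> 'x"
  tgt :: "'y \<Rightarrow> 'x"
  gunit :: "'x \<Rightarrow> 'y"
  gcomp :: "'y \<Rightarrow> 'y \<Rightarrow> 'y"
  ginv :: "'y \<Rightarrow> 'y"

text \<open>\<open>gcomp X \<gamma> \<gamma>'\<close> is \<open>\<gamma> \<circ> \<gamma>'\<close> (first \<open>\<gamma>'\<close>, then \<open>\<gamma>\<close>); its values on non-composable
  pairs are irrelevant.\<close>

definition composable :: "('x, 'u, 'y, 'v) groupoid \<Rightarrow> ('y \<times> 'y) set" where
  "composable X = {(\<gamma>, \<gamma>'). src X \<gamma> = tgt X \<gamma>'}"

definition lie_groupoid ::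
  "('x::{t2_space, second_countable_topology}, 'u::real_normed_vector,
    'y::{t2_space, second_countable_topology}, 'v::real_normed_vector) groupoid \<Rightarrow> bool" where
  "lie_groupoid X \<longleftrightarrow>
     smooth_manifold (Obj X) \<and> smooth_manifold (Arr X) \<and>
     submersion (Arr X) (Obj X) (src X) \<and> submersion (Arr X) (Obj X) (tgt X) \<and>
     smooth_map (Obj X) (Arr X) (gunit X) \<and>
     smooth_map (Arr X) (Arr X) (ginv X) \<and>
     smooth_map_on (prod_mfd (Arr X) (Arr X)) (Arr X) (composable X) (\<lambda>(\<gamma>, \<gamma>'). gcomp X \<gamma> \<gamma>') \<and>
     (\<forall>x. src X (gunit X x) = x \<and> tgt X (gunit X x) = x) \<and>
     (\<forall>\<gamma> \<gamma>'. (\<gamma>, \<gamma>') \<in> composable X \<longrightarrow>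
        src X (gcomp X \<gamma> \<gamma>') = src X \<gamma>' \<and> tgt X (gcomp X \<gamma> \<gamma>') = tgt X \<gamma>) \<and>
     (\<forall>\<gamma> \<gamma>' \<gamma>''. (\<gamma>, \<gamma>') \<in> composable X \<and> (\<gamma>', \<gamma>'') \<in> composable X \<longrightarrow>
        gcomp X (gcomp X \<gamma> \<gamma>') \<gamma>'' = gcomp X \<gamma> (gcomp X \<gamma>' \<gamma>'')) \<and>
     (\<forall>\<gamma>. gcomp X \<gamma> (gunit X (src X \<gamma>)) = \<gamma> \<and> gcomp X (gunit X (tgt X \<gamma>)) \<gamma> = \<gamma>) \<and>
     (\<forall>\<gamma>. src X (ginv X \<gamma>) = tgt X \<gamma> \<and> tgt X (ginv X \<gamma>) = src X \<gamma> \<and>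
        gcomp X (ginv X \<gamma>) \<gamma> = gunit X (src X \<gamma>) \<and> gcomp X \<gamma> (ginv X \<gamma>) = gunit X (tgt X \<gamma>))"


subsection \<open>Connections on Lie groupoids\<close>

abbreviation d_src ::
  "('x::topological_space, 'u::real_normed_vector, 'y::topological_space, 'v::real_normed_vector)
     groupoid \<Rightarrow> 'y \<Rightarrow> 'v \<Rightarrow> 'u" where
  "d_src X \<equiv> tmap (Arr X) (Obj X) (src X)"

abbreviation d_tgt ::
  "('x::topological_space, 'u::real_normed_vector, 'y::topological_space, 'v::real_normed_vector)
     groupoid \<Rightarrow> 'y \<Rightarrow> 'v \<Rightarrow> 'u" where
  "d_tgt X \<equiv> tmap (Arr X) (Obj X) (tgt X)"

definition subbundle ::
  "('a::topological_space, 'e::real_normed_vector) charted \<Rightarrow> ('a \<Rightarrow> 'e set) \<Rightarrow> bool" where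
  "subbundle M H \<longleftrightarrow> (\<forall>x. subspace (H x)) \<and>
     (\<forall>x0. \<exists>U k V. open U \<and> x0 \<in> U \<and> (\<forall>i<k::nat. vector_field_on M U (V i)) \<and>
        (\<forall>x\<in>U. inj_on (\<lambda>i. V i x) {..<k} \<and> independent ((\<lambda>i. V i x) ` {..<k}) \<and>
               span ((\<lambda>i. V i x) ` {..<k}) = H x))"

definition transport ::
  "('x::topological_space, 'u::real_normed_vector, 'y::topological_space, 'v::real_normed_vector)
     groupoid \<Rightarrow> ('y \<Rightarrow> 'v set) \<Rightarrow> 'y \<Rightarrow> 'u \<Rightarrow> 'u" where
  "transport X H \<gamma> = d_tgt X \<gamma> \<circ> inv_into (H \<gamma>) (d_src X \<gamma>)"

definition groupoid_connection ::
  "('x::topological_space, 'u::real_normed_vector, 'y::topological_space, 'v::real_normed_vector)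
     groupoid \<Rightarrow> ('y \<Rightarrow> 'v set) \<Rightarrow> bool" where
  "groupoid_connection X H \<longleftrightarrow>
     subbundle (Arr X) H \<and>
     (\<forall>\<gamma> v. \<exists>!h. h \<in> H \<gamma> \<and> d_src X \<gamma> (v - h) = 0) \<and>
     (\<forall>\<gamma> \<gamma>'. (\<gamma>, \<gamma>') \<in> composable X \<longrightarrow>
        transport X H (gcomp X \<gamma> \<gamma>') = transport X H \<gamma> \<circ> transport X H \<gamma>') \<and>
     (\<forall>x. range (tmap (Obj X) (Arr X) (gunit X) x) = H (gunit X x))"

definition integrable_connection ::
  "('x::topological_space, 'u::real_normed_vector, 'y::topological_space, 'v::real_normed_vector)
     groupoid \<Rightarrow> ('y \<Rightarrow> 'v set) \<Rightarrow> bool" where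
  "integrable_connection X H \<longleftrightarrow> groupoid_connection X H \<and>
     (\<forall>V W. vector_field (Arr X) V \<and> vector_field (Arr X) W \<and> (\<forall>\<gamma>. V \<gamma> \<in> H \<gamma> \<and> W \<gamma> \<in> H \<gamma>)
        \<longrightarrow> (\<forall>\<gamma>. lie_bracket (Arr X) V W \<gamma> \<in> H \<gamma>))"

definition hor_comp ::
  "('x::topological_space, 'u::real_normed_vector, 'y::topological_space, 'v::real_normed_vector)
     groupoid \<Rightarrow> ('y \<Rightarrow> 'v set) \<Rightarrow> 'y \<Rightarrow> 'v \<Rightarrow> 'v" where
  "hor_comp X H \<gamma> v = (THE h. h \<in> H \<gamma> \<and> d_src X \<gamma> (v - h) = 0)"


section \<open>Principal bundles over Lie groupoids\<close>

record ('p, 'r, 'g, 'x, 'y) gbundle =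
  Tot :: "('p, 'r) charted"
  proj :: "'p \<Rightarrow> 'x"
  ract :: "'p \<Rightarrow> 'g \<Rightarrow> 'p"
  lact :: "'y \<Rightarrow> 'p \<Rightarrow> 'p"

definition principal_bundle ::
  "('g::topological_space, 'w::real_normed_vector) charted \<Rightarrow> 'g monoid
     \<Rightarrow> ('x::topological_space, 'u::real_normed_vector) charted
     \<Rightarrow> ('p::{t2_space, second_countable_topology}, 'r::real_normed_vector, 'g, 'x, 'y) gbundle
     \<Rightarrow> bool" where
  "principal_bundle MG G B P \<longleftrightarrow>
     smooth_manifold (Tot P) \<and>
     smooth_map (Tot P) B (proj P) \<and>
     smooth_map (prod_mfd (Tot P) MG) (Tot P) (\<lambda>(a, g). ract P a g) \<and>
     (\<forall>a. ract P a \<one>\<^bsub>G\<^esub> = a) \<and>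
     (\<forall>a g h. ract P (ract P a g) h = ract P a (g \<otimes>\<^bsub>G\<^esub> h)) \<and>
     (\<forall>a g. proj P (ract P a g) = proj P a) \<and>
     (\<forall>x. \<exists>U \<tau>. open U \<and> x \<in> U \<and>
        bij_betw \<tau> (proj P -` U) (U \<times> UNIV) \<and>
        smooth_map_on (Tot P) (prod_mfd B MG) (proj P -` U) \<tau> \<and>
        smooth_map_on (prod_mfd B MG) (Tot P) (U \<times> UNIV) (inv_into (proj P -` U) \<tau>) \<and>
        (\<forall>a\<in>proj P -` U. fst (\<tau> a) = proj P a \<and>
           (\<forall>g. \<tau> (ract P a g) = (proj P a, snd (\<tau> a) \<otimes>\<^bsub>G\<^esub> g))))"

definition act_dom ::
  "('x, 'u, 'y, 'v) groupoid \<Rightarrow> ('p, 'r, 'g, 'x, 'y) gbundle \<Rightarrow> ('y \<times> 'p) set" where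
  "act_dom X P = {(\<gamma>, a). src X \<gamma> = proj P a}"

definition principal_gpd_bundle ::
  "('g::topological_space, 'w::real_normed_vector) charted \<Rightarrow> 'g monoid
     \<Rightarrow> ('x::topological_space, 'u::real_normed_vector,
         'y::topological_space, 'v::real_normed_vector) groupoid
     \<Rightarrow> ('p::{t2_space, second_countable_topology}, 'r::real_normed_vector, 'g, 'x, 'y) gbundle
     \<Rightarrow> bool" where
  "principal_gpd_bundle MG G X P \<longleftrightarrow>
     principal_bundle MG G (Obj X) P \<and>
     smooth_map_on (prod_mfd (Arr X) (Tot P)) (Tot P) (act_dom X P) (\<lambda>(\<gamma>, a). lact P \<gamma> a) \<and>
     (\<forall>\<gamma> a. (\<gamma>, a) \<in> act_dom X P \<longrightarrow> proj P (lact P \<gamma> a) = tgt X \<gamma>) \<and>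
     (\<forall>a. lact P (gunit X (proj P a)) a = a) \<and>
     (\<forall>\<gamma> \<gamma>' a. (\<gamma>, \<gamma>') \<in> composable X \<and> (\<gamma>', a) \<in> act_dom X P \<longrightarrow>
        lact P \<gamma> (lact P \<gamma>' a) = lact P (gcomp X \<gamma> \<gamma>') a) \<and>
     (\<forall>\<gamma> a g. (\<gamma>, a) \<in> act_dom X P \<longrightarrow> ract P (lact P \<gamma> a) g = lact P \<gamma> (ract P a g))"

text \<open>The lift of \<open>transport\<close> to the total space, using an arbitrary \<open>v\<close> with
  \<open>s\<^sub>* v = \<pi>\<^sub>* w\<close>. The pair \<open>(hor_comp X H \<gamma> v, w)\<close> is tangent to \<open>act_dom X P\<close>.\<close>

definition lift_transport ::
  "('x::topological_space, 'u::real_normed_vector, 'y::topological_space, 'v::real_normed_vector)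
     groupoid \<Rightarrow> ('y \<Rightarrow> 'v set)
     \<Rightarrow> ('p::topological_space, 'r::real_normed_vector, 'g, 'x, 'y) gbundle
     \<Rightarrow> 'y \<Rightarrow> 'p \<Rightarrow> 'r \<Rightarrow> 'r" where
  "lift_transport X H P \<gamma> a w =
     (let v = (SOME v. d_src X \<gamma> v = tmap (Tot P) (Obj X) (proj P) a w) in
      tmap_within (prod_mfd (Arr X) (Tot P)) (Tot P) (act_dom X P) (\<lambda>(\<gamma>, a). lact P \<gamma> a) (\<gamma>, a)
        (hor_comp X H \<gamma> v, w))"


section \<open>The Atiyah sequence\<close>

text \<open>Elements of \<open>(TE\<^sub>G)/G\<close> and \<open>(E\<^sub>G \<times> \<g>)/G\<close> are orbits, i.e. sets of pairs: a point of the total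
  space with a tangent vector there, respectively with an element of the Lie algebra. As the
  action on the total space is free, an orbit over \<open>x\<close> contains exactly one pair over each point of
  the fibre of \<open>x\<close>; the linear structure on the fibres of the two bundles is defined by
  operating on representatives over a common point.\<close>

definition T_class ::
  "('p::topological_space, 'r::real_normed_vector, 'g, 'x, 'y) gbundle \<Rightarrow> 'p \<Rightarrow> 'r
     \<Rightarrow> ('p \<times> 'r) set" where
  "T_class P a w = {(ract P a g, tmap (Tot P) (Tot P) (\<lambda>b. ract P b g) a w) | g. True}"

definition ad_class ::
  "('g::topological_space, 'w::real_normed_vector) charted \<Rightarrow> 'g monoid
     \<Rightarrow> ('p, 'r, 'g, 'x, 'y) gbundle \<Rightarrow> 'p \<Rightarrow> 'w \<Rightarrow> ('p \<times> 'w) set" where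
  "ad_class MG G P a A = {(ract P a g, Ad MG G (inv\<^bsub>G\<^esub> g) A) | g. True}"

definition T_fibre ::
  "('p::topological_space, 'r::real_normed_vector, 'g, 'x, 'y) gbundle \<Rightarrow> 'x
     \<Rightarrow> ('p \<times> 'r) set set" where
  "T_fibre P x = {T_class P a w | a w. proj P a = x}"

definition ad_fibre ::
  "('g::topological_space, 'w::real_normed_vector) charted \<Rightarrow> 'g monoid
     \<Rightarrow> ('p, 'r, 'g, 'x, 'y) gbundle \<Rightarrow> 'x \<Rightarrow> ('p \<times> 'w) set set" where
  "ad_fibre MG G P x = {ad_class MG G P a A | a A. proj P a = x}"

definition cl_add :: "('p \<times> 'b::real_vector) set \<Rightarrow> ('p \<times> 'b) set \<Rightarrow> ('p \<times> 'b) set" where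
  "cl_add Q R = {(a, v + w) | a v w. (a, v) \<in> Q \<and> (a, w) \<in> R}"

definition cl_diff :: "('p \<times> 'b::real_vector) set \<Rightarrow> ('p \<times> 'b) set \<Rightarrow> ('p \<times> 'b) set" where
  "cl_diff Q R = {(a, v - w) | a v w. (a, v) \<in> Q \<and> (a, w) \<in> R}"

definition cl_scale :: "real \<Rightarrow> ('p \<times> 'b::real_vector) set \<Rightarrow> ('p \<times> 'b) set" where
  "cl_scale r Q = {(a, r *\<^sub>R v) | a v. (a, v) \<in> Q}"

definition cl_zero :: "('p, 'r, 'g, 'x, 'y) gbundle \<Rightarrow> 'x \<Rightarrow> ('p \<times> 'b::real_vector) set" where
  "cl_zero P x = {(a, 0) | a. proj P a = x}"

text \<open>The representative over \<open>a\<close>; on \<open>(E\<^sub>G \<times> \<g>)/G\<close> this is the inverse of \<open>A \<mapsto> [(a, A)]\<close>.\<close>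

definition cl_at :: "'p \<Rightarrow> ('p \<times> 'b) set \<Rightarrow> 'b" where
  "cl_at a Q = (THE v. (a, v) \<in> Q)"

definition fundamental ::
  "('g::topological_space, 'w::real_normed_vector) charted \<Rightarrow> 'g monoid
     \<Rightarrow> ('p::topological_space, 'r::real_normed_vector, 'g, 'x, 'y) gbundle
     \<Rightarrow> 'p \<Rightarrow> 'w \<Rightarrow> 'r" where
  "fundamental MG G P a = tmap MG (Tot P) (\<lambda>g. ract P a g) \<one>\<^bsub>G\<^esub>"

text \<open>The next maps are given on representatives; the image of an orbit is again an orbit
  (for \<open>T_proj\<close>, a single tangent vector of the base).\<close>

definition jG ::
  "('g::topological_space, 'w::real_normed_vector) charted \<Rightarrow> 'g monoid
     \<Rightarrow> ('p::topological_space, 'r::real_normed_vector, 'g, 'x, 'y) gbundle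
     \<Rightarrow> ('p \<times> 'w) set \<Rightarrow> ('p \<times> 'r) set" where
  "jG MG G P Q = (\<lambda>(a, A). (a, fundamental MG G P a A)) ` Q"

definition T_proj ::
  "('x::topological_space, 'u::real_normed_vector) charted
     \<Rightarrow> ('p::topological_space, 'r::real_normed_vector, 'g, 'x, 'y) gbundle
     \<Rightarrow> ('p \<times> 'r) set \<Rightarrow> 'u" where
  "T_proj B P Q = (THE v. \<forall>(a, w)\<in>Q. tmap (Tot P) B (proj P) a w = v)"

definition T_act ::
  "('x::topological_space, 'u::real_normed_vector, 'y::topological_space, 'v::real_normed_vector)
     groupoid \<Rightarrow> ('y \<Rightarrow> 'v set)
     \<Rightarrow> ('p::topological_space, 'r::real_normed_vector, 'g, 'x, 'y) gbundle
     \<Rightarrow> 'y \<Rightarrow> ('p \<times> 'r) set \<Rightarrow> ('p \<times> 'r) set" where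
  "T_act X H P \<gamma> Q = (\<lambda>(a, w). (lact P \<gamma> a, lift_transport X H P \<gamma> a w)) ` Q"

definition ad_act ::
  "('p, 'r, 'g, 'x, 'y) gbundle \<Rightarrow> 'y \<Rightarrow> ('p \<times> 'w) set \<Rightarrow> ('p \<times> 'w) set" where
  "ad_act P \<gamma> Q = (\<lambda>(a, A). (lact P \<gamma> a, A)) ` Q"


section \<open>Connections on principal bundles over Lie groupoids\<close>

text \<open>Smoothness of \<open>\<D>\<close> is smoothness of the \<open>\<g>\<close>-valued one-form \<open>\<omega>\<close> on the total space with
  \<open>\<D> [w] = [(a, \<omega> w)]\<close> for \<open>w\<close> tangent at \<open>a\<close>: the projections from \<open>TE\<^sub>G\<close> and \<open>E\<^sub>G \<times> \<g>\<close>
  to their quotients by \<open>G\<close> are surjective submersions.\<close>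

definition vb_morphism ::
  "('g::topological_space, 'w::real_normed_vector) charted \<Rightarrow> 'g monoid
     \<Rightarrow> ('p::topological_space, 'r::real_normed_vector, 'g, 'x, 'y) gbundle
     \<Rightarrow> (('p \<times> 'r) set \<Rightarrow> ('p \<times> 'w) set) \<Rightarrow> bool" where
  "vb_morphism MG G P \<D> \<longleftrightarrow>
     (\<forall>x. \<forall>Q\<in>T_fibre P x. \<D> Q \<in> ad_fibre MG G P x) \<and>
     (\<forall>x. \<forall>Q\<in>T_fibre P x. \<forall>R\<in>T_fibre P x. \<D> (cl_add Q R) = cl_add (\<D> Q) (\<D> R)) \<and>
     (\<forall>x. \<forall>Q\<in>T_fibre P x. \<forall>r. \<D> (cl_scale r Q) = cl_scale r (\<D> Q)) \<and>
     (\<forall>U W. open U \<and> vector_field_on (Tot P) U W \<longrightarrow>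
        smooth_fun_on (Tot P) U (\<lambda>a. cl_at a (\<D> (T_class P a (W a)))))"

definition bundle_connection ::
  "('g::topological_space, 'w::real_normed_vector) charted \<Rightarrow> 'g monoid
     \<Rightarrow> ('x::topological_space, 'u::real_normed_vector,
         'y::topological_space, 'v::real_normed_vector) groupoid \<Rightarrow> ('y \<Rightarrow> 'v set)
     \<Rightarrow> ('p::topological_space, 'r::real_normed_vector, 'g, 'x, 'y) gbundle
     \<Rightarrow> (('p \<times> 'r) set \<Rightarrow> ('p \<times> 'w) set) \<Rightarrow> bool" where
  "bundle_connection MG G X H P \<D> \<longleftrightarrow>
     vb_morphism MG G P \<D> \<and>
     (\<forall>x. \<forall>Q\<in>ad_fibre MG G P x. \<D> (jG MG G P Q) = Q) \<and>
     (\<forall>\<gamma>. \<forall>Q\<in>T_fibre P (src X \<gamma>). \<D> (T_act X H P \<gamma> Q) = ad_act P \<gamma> (\<D> Q))"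

text \<open>The section \<open>\<S>\<close> complementary to \<open>\<D>\<close>, applied to a vector \<open>v\<close> tangent at \<open>x\<close>.\<close>

definition conn_section ::
  "('x::topological_space, 'u::real_normed_vector) charted
     \<Rightarrow> ('p::topological_space, 'r::real_normed_vector, 'g, 'x, 'y) gbundle
     \<Rightarrow> (('p \<times> 'r) set \<Rightarrow> ('p \<times> 'w::real_normed_vector) set) \<Rightarrow> 'x \<Rightarrow> 'u \<Rightarrow> ('p \<times> 'r) set" where
  "conn_section B P \<D> x v =
     (THE Q. Q \<in> T_fibre P x \<and> T_proj B P Q = v \<and> \<D> Q = cl_zero P x)"

text \<open>The bracket of sections of \<open>(TE\<^sub>G)/G\<close> is that of the corresponding invariant vector
  fields on the total space.\<close>

definition inv_field ::
  "('p, 'r, 'g, 'x, 'y) gbundle \<Rightarrow> ('x \<Rightarrow> ('p \<times> 'r) set) \<Rightarrow> 'p \<Rightarrow> 'r" where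
  "inv_field P \<sigma> a = cl_at a (\<sigma> (proj P a))"

definition section_bracket ::
  "('p, 'r::real_normed_vector, 'g, 'x, 'y) gbundle \<Rightarrow> ('x \<Rightarrow> ('p \<times> 'r) set)
     \<Rightarrow> ('x \<Rightarrow> ('p \<times> 'r) set) \<Rightarrow> 'x \<Rightarrow> ('p \<times> 'r) set" where
  "section_bracket P \<sigma> \<rho> x =
     {(a, lie_bracket (Tot P) (inv_field P \<sigma>) (inv_field P \<rho>) a) | a. proj P a = x}"

definition curvature_fields ::
  "('g::topological_space, 'w::real_normed_vector) charted \<Rightarrow> 'g monoid
     \<Rightarrow> ('x::topological_space, 'u::real_normed_vector) charted
     \<Rightarrow> ('p::topological_space, 'r::real_normed_vector, 'g, 'x, 'y) gbundle
     \<Rightarrow> (('p \<times> 'r) set \<Rightarrow> ('p \<times> 'w) set)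
     \<Rightarrow> ('x \<Rightarrow> 'u) \<Rightarrow> ('x \<Rightarrow> 'u) \<Rightarrow> 'x \<Rightarrow> ('p \<times> 'w) set" where
  "curvature_fields MG G B P \<D> V W x =
     (THE Q. Q \<in> ad_fibre MG G P x \<and>
        jG MG G P Q =
          cl_diff (conn_section B P \<D> x (lie_bracket B V W x))
            (section_bracket P (\<lambda>x. conn_section B P \<D> x (V x))
                               (\<lambda>x. conn_section B P \<D> x (W x)) x))"

text \<open>The curvature as a form: its value on tangent vectors at \<open>x\<close> is the common value at \<open>x\<close> of
  \<open>curvature_fields\<close> on all pairs of vector fields extending them.\<close>

definition curvature ::
  "('g::topological_space, 'w::real_normed_vector) charted \<Rightarrow> 'g monoid
     \<Rightarrow> ('x::topological_space, 'u::real_normed_vector) charted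
     \<Rightarrow> ('p::topological_space, 'r::real_normed_vector, 'g, 'x, 'y) gbundle
     \<Rightarrow> (('p \<times> 'r) set \<Rightarrow> ('p \<times> 'w) set)
     \<Rightarrow> 'x \<Rightarrow> 'u \<Rightarrow> 'u \<Rightarrow> ('p \<times> 'w) set" where
  "curvature MG G B P \<D> x v w =
     (THE Q. \<forall>V W. vector_field B V \<and> vector_field B W \<and> V x = v \<and> W x = w \<longrightarrow>
        curvature_fields MG G B P \<D> V W x = Q)"


section \<open>Differential 2-forms on Lie groupoids\<close>

text \<open>Two-forms on the base with values in \<open>(E\<^sub>G \<times> \<g>)/G\<close>. Smoothness of a section of that bundle
  is smoothness of the corresponding \<open>\<g>\<close>-valued function on the total space.\<close>

definition ad_two_form ::
  "('g::topological_space, 'w::real_normed_vector) charted \<Rightarrow> 'g monoid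
     \<Rightarrow> ('x::topological_space, 'u::real_normed_vector) charted
     \<Rightarrow> ('p::topological_space, 'r::real_normed_vector, 'g, 'x, 'y) gbundle
     \<Rightarrow> ('x \<Rightarrow> 'u \<Rightarrow> 'u \<Rightarrow> ('p \<times> 'w) set) \<Rightarrow> bool" where
  "ad_two_form MG G B P K \<longleftrightarrow>
     (\<forall>x v w. K x v w \<in> ad_fibre MG G P x) \<and>
     (\<forall>x v v' w. K x (v + v') w = cl_add (K x v w) (K x v' w)) \<and>
     (\<forall>x r v w. K x (r *\<^sub>R v) w = cl_scale r (K x v w)) \<and>
     (\<forall>x v w w'. K x v (w + w') = cl_add (K x v w) (K x v w')) \<and>
     (\<forall>x r v w. K x v (r *\<^sub>R w) = cl_scale r (K x v w)) \<and>
     (\<forall>x v. K x v v = cl_zero P x) \<and>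
     (\<forall>U V W. open U \<and> vector_field_on B U V \<and> vector_field_on B U W \<longrightarrow>
        smooth_fun_on (Tot P) (proj P -` U)
          (\<lambda>a. cl_at a (K (proj P a) (V (proj P a)) (W (proj P a)))))"

definition pullback2 ::
  "('y::topological_space, 'v::real_normed_vector) charted
     \<Rightarrow> ('x::topological_space, 'u::real_normed_vector) charted \<Rightarrow> ('y \<Rightarrow> 'x)
     \<Rightarrow> ('x \<Rightarrow> 'u \<Rightarrow> 'u \<Rightarrow> 'b) \<Rightarrow> 'y \<Rightarrow> 'v \<Rightarrow> 'v \<Rightarrow> 'b" where
  "pullback2 M B f K \<gamma> v w = K (f \<gamma>) (tmap M B f \<gamma> v) (tmap M B f \<gamma> w)"

definition hor_form2 ::
  "('x::topological_space, 'u::real_normed_vector, 'y::topological_space, 'v::real_normed_vector)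
     groupoid \<Rightarrow> ('y \<Rightarrow> 'v set) \<Rightarrow> ('y \<Rightarrow> 'v \<Rightarrow> 'v \<Rightarrow> 'b) \<Rightarrow> 'y \<Rightarrow> 'v \<Rightarrow> 'v \<Rightarrow> 'b" where
  "hor_form2 X H \<eta> \<gamma> v w = \<eta> \<gamma> (hor_comp X H \<gamma> v) (hor_comp X H \<gamma> w)"

text \<open>The values of the two sides of \<open>\<H>(s\<^sup>*K) = \<H>(t\<^sup>*K)\<close> at \<open>\<gamma>\<close> lie in the fibres over
  \<open>s(\<gamma>)\<close> and \<open>t(\<gamma>)\<close>, which are identified by the action of \<open>\<gamma>\<close>.\<close>

definition groupoid_two_form ::
  "('g::topological_space, 'w::real_normed_vector) charted \<Rightarrow> 'g monoid
     \<Rightarrow> ('x::topological_space, 'u::real_normed_vector,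
         'y::topological_space, 'v::real_normed_vector) groupoid \<Rightarrow> ('y \<Rightarrow> 'v set)
     \<Rightarrow> ('p::topological_space, 'r::real_normed_vector, 'g, 'x, 'y) gbundle
     \<Rightarrow> ('x \<Rightarrow> 'u \<Rightarrow> 'u \<Rightarrow> ('p \<times> 'w) set) \<Rightarrow> bool" where
  "groupoid_two_form MG G X H P K \<longleftrightarrow>
     ad_two_form MG G (Obj X) P K \<and>
     (\<forall>\<gamma> v w.
        ad_act P \<gamma> (hor_form2 X H (pullback2 (Arr X) (Obj X) (src X) K) \<gamma> v w)
        = hor_form2 X H (pullback2 (Arr X) (Obj X) (tgt X) K) \<gamma> v w)"

end

theory Submission
  imports Defs
begin

text \<open>Write \<open>\<omega>\<close> for the \<open>\<g>\<close>-valued connection one-form of \<open>\<D>\<close> on the total space (\<open>om\<close> below) and \<open>hl\<close> for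
  horizontal lifts. In the fibre over \<open>a\<close>, the curvature on vector fields \<open>V\<close>, \<open>W\<close> is
  \<open>-\<omega>[hl V, hl W] = d\<omega>(hl V, hl W)\<close>, which depends only on the values of \<open>V\<close> and \<open>W\<close> at the base
  point. Since \<open>\<D>\<close> is equivariant, the pullbacks of \<open>\<omega>\<close> to the fibre product of arrows and total
  space, along the action and along the projection, agree on the distribution induced by \<open>\<H>\<close>. This
  distribution is involutive because \<open>\<H>\<close> is, so the pullbacks of \<open>d\<omega>\<close> agree on it as well, and this
  is the invariance of the curvature. No bisections tangent to \<open>\<H>\<close>, hence no Frobenius theorem,
  are needed.\<close>

section \<open>Finite-dimensional normed spaces\<close>

text \<open>The fibre product is never made a manifold: it stays the solution set of
  \<open>src X \<gamma> = proj P a\<close> in \<open>prod_mfd (Arr X) (Tot P)\<close>. The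
  differential of the action is then a derivative within this set, an arbitrary choice among several
  linear maps. Its values on tangent vectors are pinned down by differentiating along curves in the
  set, and these arise by correcting straight lines with the contraction principle, the source map
  being a submersion. Brackets, on the other hand, need fields on open sets, so the fields on the
  fibre product are extended to the ambient product by matching coordinates in a chart of the base.
  Tangency survives off the fibre product, but the vanishing of \<omega> on images under the action
  does not; it may be differentiated in tangent directions only. Two features of the definitions add
  work: tangent vectors are named by a preferred chart at each point, so brackets and differentials
  have to be compared across charts, and \<open>curvature\<close> quantifies over global fields,
  which calls for bump functions.\<close>

definition findim :: "'a::real_vector itself \<Rightarrow> bool" where
  "findim _ \<longleftrightarrow> (\<exists>B::'a set. finite B \<and> span B = UNIV)"

text \<open>Tychonoff's theorem, with all of \<open>'a\<close> as index set. When coordinates with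
  respect to a finite basis are meant, the entries off the basis are set to 0.\<close>

lemma compact_cube: "compact {c::'a \<Rightarrow> real. \<forall>i. c i \<in> {-1..1}}"
proof -
  have "compactin (product_topology (\<lambda>_. euclidean) UNIV) (PiE UNIV (\<lambda>_::'a. {-1..1::real}))"
    by (subst compactin_PiE) auto
  moreover have "PiE UNIV (\<lambda>_::'a. {-1..1::real}) = {c. \<forall>i. c i \<in> {-1..1}}"
    by (auto simp: PiE_def)
  ultimately show ?thesis
    by (simp add: euclidean_product_topology)
qed

text \<open>The norm attains its minimum on the compact set of coefficient functions with entry 1 at
  \<open>b0\<close> and all entries in [-1, 1]; independence makes this minimum positive, and
  homogeneity carries the bound to every combination dominated by its coefficient at
  \<open>b0\<close>.\<close>

lemma basis_norm_lower_bound: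
  fixes B :: "'a::real_normed_vector set"
  assumes fin: "finite B" and ind: "independent B" and b0: "b0 \<in> B"
  obtains m where "m > 0" "\<And>c. (\<forall>b\<in>B. \<bar>c b\<bar> \<le> \<bar>c b0\<bar>) \<Longrightarrow> m * \<bar>c b0\<bar> \<le> norm (\<Sum>b\<in>B. c b *\<^sub>R b)"
proof -
  let ?K = "{c::'a \<Rightarrow> real. \<forall>i. c i \<in> {-1..1}} \<inter> {c. c b0 = 1}"
  let ?f = "\<lambda>c::'a \<Rightarrow> real. norm (\<Sum>b\<in>B. c b *\<^sub>R b)"
  have cl: "closed {c::'a \<Rightarrow> real. c b0 = 1}"
    by (intro closed_Collect_eq continuous_on_const continuous_on_product_coordinates)
  have K: "compact ?K"
    by (rule compact_Int_closed[OF compact_cube cl])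
  have ne: "?K \<noteq> {}"
  proof -
    have "(\<lambda>_. 1) \<in> ?K" by auto
    then show ?thesis unfolding ex_in_conv[symmetric] by (rule exI[of _ "\<lambda>_. 1"])
  qed
  have coords: "continuous_on ?K (\<lambda>c. c b)" for b
    by (rule continuous_on_subset[OF continuous_on_product_coordinates]) auto
  have "continuous_on ?K ?f"
    by (intro continuous_on_norm continuous_on_sum continuous_on_scaleR[OF coords continuous_on_const])
  from continuous_attains_inf[OF K ne this] obtain k where k: "k \<in> ?K" and min: "\<forall>c\<in>?K. ?f k \<le> ?f c"
    by (elim bexE)
  have "?f k \<noteq> 0"
  proof
    assume "?f k = 0"
    then have "\<forall>b\<in>B. k b = 0"
      using independentD[OF ind fin subset_refl, of k] by simp
    with k b0 show False by auto
  qed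
  then have pos: "?f k > 0" by simp
  show ?thesis
  proof (rule that[OF pos])
    fix c :: "'a \<Rightarrow> real" assume c: "\<forall>b\<in>B. \<bar>c b\<bar> \<le> \<bar>c b0\<bar>"
    show "?f k * \<bar>c b0\<bar> \<le> ?f c"
    proof (cases "c b0 = 0")
      case False
      define d where "d b = (if b \<in> B then c b / c b0 else 0)" for b
      have dK: "d \<in> ?K"
        using c False b0 by (auto simp: d_def divide_simps abs_le_iff split: if_splits)

      have "?f d = norm ((1 / c b0) *\<^sub>R (\<Sum>b\<in>B. c b *\<^sub>R b))"
        by (simp add: d_def scaleR_sum_right)
      also have "\<dots> = ?f c / \<bar>c b0\<bar>"
        by simp
      finally have "?f k \<le> ?f c / \<bar>c b0\<bar>"
        using bspec[OF min dK] by simp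
      then show ?thesis
        using False by (simp add: field_simps)
    qed auto
  qed
qed

text \<open>The source of every finite-dimensional argument below: a basis with bounded coordinate
  functionals. Boundedness follows from \<open>basis_norm_lower_bound\<close>, applied to the
  largest coordinate of the given vector.\<close>

lemma findim_coords:
  assumes "findim TYPE('a::real_normed_vector)"
  obtains B :: "'a::real_normed_vector set" and c :: "'a \<Rightarrow> 'a \<Rightarrow> real"
  where "finite B" "\<And>b. b \<in> B \<Longrightarrow> bounded_linear (c b)" "\<And>v. (\<Sum>b\<in>B. c b v *\<^sub>R b) = v"
proof -
  obtain B0 :: "'a set" where B0: "finite B0" "span B0 = UNIV"
    using assms by (auto simp: findim_def)
  obtain B where B: "B \<subseteq> B0" "independent B" "B0 \<subseteq> span B"
    using maximal_independent_subset[of B0] by blast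
  have fin: "finite B" using B(1) B0(1) finite_subset by blast
  have sp: "span B = UNIV"
    using B0(2) B(3) by (metis span_mono span_span top.extremum_uniqueI)
  define c where "c b v = representation B v b" for b v
  have lin: "linear (c b)" for b
    unfolding c_def
    by (intro linearI) (simp_all add: representation_add representation_scale B(2) sp)
  have sum: "(\<Sum>b\<in>B. c b v *\<^sub>R b) = v" for v
    unfolding c_def
    using sum_representation_eq[of B v B] B(2) sp fin by simp
  have "\<exists>m>0. \<forall>c. (\<forall>b\<in>B. \<bar>c b\<bar> \<le> \<bar>c b0\<bar>) \<longrightarrow> m * \<bar>c b0\<bar> \<le> norm (\<Sum>b\<in>B. c b *\<^sub>R b)"
    if "b0 \<in> B" for b0
    using basis_norm_lower_bound[OF fin B(2) that] by metis
  then have "\<forall>b0\<in>B. \<exists>m>0. \<forall>c. (\<forall>b\<in>B. \<bar>c b\<bar> \<le> \<bar>c b0\<bar>) \<longrightarrow> m * \<bar>c b0\<bar> \<le> norm (\<Sum>b\<in>B. c b *\<^sub>R b)"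
    by blast
  from bchoice[OF this] obtain m where m: "\<And>b0. b0 \<in> B \<Longrightarrow> m b0 > 0"
    "\<And>b0 c. b0 \<in> B \<Longrightarrow> (\<forall>b\<in>B. \<bar>c b\<bar> \<le> \<bar>c b0\<bar>) \<Longrightarrow> m b0 * \<bar>c b0\<bar> \<le> norm (\<Sum>b\<in>B. c b *\<^sub>R b)"
    by blast
  have bl: "bounded_linear (c b)" if b: "b \<in> B" for b
  proof -
    define M where "M = Min (m ` B)"
    have Mle: "\<And>b. b \<in> B \<Longrightarrow> M \<le> m b"
      using fin by (simp add: M_def)
    have "M \<in> m ` B"
      unfolding M_def using b fin by (intro Min_in) auto
    then have Mpos: "M > 0"
      using m(1) by blast
    have bd: "norm (c b v) \<le> norm v * (1 / M)" for v
    proof -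
      \<comment> \<open>The dominant coordinate depends on \<open>v\<close>; this is why the
        constant \<open>M\<close> is a minimum over the whole basis.\<close>
      obtain b0 where b0: "b0 \<in> B" "\<bar>c b0 v\<bar> = Max ((\<lambda>b. \<bar>c b v\<bar>) ` B)"
      proof -
        have "Max ((\<lambda>b. \<bar>c b v\<bar>) ` B) \<in> (\<lambda>b. \<bar>c b v\<bar>) ` B"
          using b fin by (intro Max_in) auto
        then show ?thesis using that by force
      qed
      have max: "\<forall>b\<in>B. \<bar>c b v\<bar> \<le> \<bar>c b0 v\<bar>"
        using fin by (auto simp: b0(2))
      have "M * \<bar>c b v\<bar> \<le> m b0 * \<bar>c b0 v\<bar>"
        using Mle[OF b0(1)] max b Mpos by (intro mult_mono) auto
      also have "\<dots> \<le> norm v"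
        using m(2)[OF b0(1), of "\<lambda>b. c b v"] max sum by simp
      finally show ?thesis using Mpos by (simp add: field_simps)
    qed
    show ?thesis
      using lin bd by (intro bounded_linear_intro[where K="1/M"]) (auto simp: linear_add linear_scale)
  qed
  show ?thesis using that[OF fin bl sum] by blast
qed

lemma findim_linear_bounded:
  fixes f :: "'a::real_normed_vector \<Rightarrow> 'b::real_normed_vector"
  assumes "findim TYPE('a)" and "linear f"
  shows "bounded_linear f"
proof -
  obtain B :: "'a set" and c where B: "finite B" "\<And>b. b \<in> B \<Longrightarrow> bounded_linear (c b)"
    "\<And>v. (\<Sum>b\<in>B. c b v *\<^sub>R b) = v"
    using findim_coords[OF assms(1)] by metis
  have "f v = (\<Sum>b\<in>B. c b v *\<^sub>R f b)" for v
    by (subst B(3)[of v, symmetric]) (simp add: linear_sum[OF assms(2)] linear_scale[OF assms(2)])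
  then have "f = (\<lambda>v. \<Sum>b\<in>B. c b v *\<^sub>R f b)" by blast
  moreover have "bounded_linear (\<lambda>v. \<Sum>b\<in>B. c b v *\<^sub>R f b)"
    by (intro bounded_linear_sum bounded_linear_scaleR_const B)
  ultimately show ?thesis by simp
qed

text \<open>The ball is a closed subset of the image of the cube under a continuous affine
  parametrisation.\<close>

lemma findim_compact_cball:
  fixes x :: "'a::real_normed_vector"
  assumes "findim TYPE('a)"
  shows "compact (cball x r)"
proof -
  obtain B :: "'a set" and c where B: "finite B" "\<And>b. b \<in> B \<Longrightarrow> bounded_linear (c b)"
    "\<And>v. (\<Sum>b\<in>B. c b v *\<^sub>R b) = v"
    using findim_coords[OF assms(1)] by metis
  have "\<exists>K>0. \<forall>v. \<bar>c b v\<bar> \<le> norm v * K" if "b \<in> B" for b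
    using bounded_linear.pos_bounded[OF B(2)[OF that]] by auto
  then obtain K where K: "\<And>b v. b \<in> B \<Longrightarrow> \<bar>c b v\<bar> \<le> norm v * K b" "\<And>b. b \<in> B \<Longrightarrow> K b > 0"
    by metis
  \<comment> \<open>The sum bounds every coordinate of a vector of norm at most the absolute value
    of \<open>r\<close>, so division by \<open>L\<close> lands in the cube; the summand 1 keeps
    \<open>L\<close> positive.\<close>
  define L where "L = (\<Sum>b\<in>B. K b) * \<bar>r\<bar> + 1"
  have K_le: "K b \<le> (\<Sum>b\<in>B. K b)" if "b \<in> B" for b
    using that B(1) K(2) by (intro member_le_sum) (auto intro: less_imp_le)
  have K_nonneg: "(\<Sum>b\<in>B. K b) \<ge> 0"
    by (intro sum_nonneg) (auto intro: less_imp_le K(2))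
  have Lpos: "L > 0"
    using K_nonneg by (simp add: L_def add_nonneg_pos)
  let ?g = "\<lambda>k. x + L *\<^sub>R (\<Sum>b\<in>B. k b *\<^sub>R b)"
  let ?C = "{c::'a \<Rightarrow> real. \<forall>i. c i \<in> {-1..1}}"
  have coords: "continuous_on ?C (\<lambda>c. c b)" for b
    by (rule continuous_on_subset[OF continuous_on_product_coordinates]) auto
  have "continuous_on ?C ?g"
    by (intro continuous_on_add[OF continuous_on_const] continuous_on_scaleR[OF continuous_on_const]
        continuous_on_sum continuous_on_scaleR[OF coords continuous_on_const])
  then have comp: "compact (?g ` ?C)"
    by (rule compact_continuous_image[OF _ compact_cube])
  have "cball x r \<subseteq> ?g ` ?C"
  proof
    fix y assume y: "y \<in> cball x r"
    then have n: "norm (y - x) \<le> \<bar>r\<bar>" by (simp add: dist_norm norm_minus_commute)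
    define k where "k b = (if b \<in> B then c b (y - x) / L else 0)" for b
    have "\<bar>c b (y - x)\<bar> \<le> L" if "b \<in> B" for b
    proof -
      have "\<bar>c b (y - x)\<bar> \<le> norm (y - x) * K b" by (rule K(1)[OF that])
      also have "\<dots> \<le> \<bar>r\<bar> * (\<Sum>b\<in>B. K b)"
        using n K_le[OF that] K(2)[OF that] by (intro mult_mono) auto
      finally show ?thesis by (simp add: L_def mult.commute)
    qed
    then have "k \<in> ?C"
      using Lpos by (auto simp: k_def divide_simps abs_le_iff) (smt (verit, best))+
    moreover have "?g k = y"
      using Lpos by (simp add: k_def scaleR_sum_right B(3))
    ultimately show "y \<in> ?g ` ?C" by force
  qed
  then show ?thesis
    using compact_Int_closed[OF comp, of "cball x r"] by (simp add: Int_absorb1)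
qed

lemma findim_prod:
  assumes "findim TYPE('a::real_vector)" and "findim TYPE('b::real_vector)"
  shows "findim TYPE('a \<times> 'b)"
proof -
  obtain A :: "'a set" and B :: "'b set"
    where A: "finite A" "span A = UNIV" and B: "finite B" "span B = UNIV"
    using assms by (auto simp: findim_def)
  have lin: "linear (\<lambda>x::'a. (x, 0::'b))" "linear (\<lambda>y::'b. (0::'a, y))"
    by (auto intro!: linearI)
  have sp: "span ((\<lambda>x. (x, 0::'b)) ` A) = (\<lambda>x. (x, 0)) ` UNIV"
    "span ((\<lambda>y. (0::'a, y)) ` B) = (\<lambda>y. (0, y)) ` UNIV"
    by (simp_all only: linear_span_image[OF lin(1)] linear_span_image[OF lin(2)] A(2) B(2))
  have "(x, 0::'b) \<in> span ((\<lambda>x. (x, 0)) ` A)" "(0::'a, y) \<in> span ((\<lambda>y. (0, y)) ` B)" for x :: 'a and y :: 'b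
    by (simp_all add: sp)
  then have "(x, 0) + (0, y) \<in> span ((\<lambda>x. (x, 0)) ` A \<union> (\<lambda>y. (0, y)) ` B)" for x :: 'a and y :: 'b
    by (meson span_add span_mono subsetD sup.cobounded1 sup.cobounded2)
  then have "(x, y) \<in> span ((\<lambda>x. (x, 0)) ` A \<union> (\<lambda>y. (0, y)) ` B)" for x :: 'a and y :: 'b
    by simp
  then show ?thesis
    unfolding findim_def using A(1) B(1)
    by (intro exI[of _ "(\<lambda>x. (x, 0)) ` A \<union> (\<lambda>y. (0, y)) ` B"]) auto
qed

section \<open>Calculus of smooth functions\<close>

abbreviation fd :: "('a::real_normed_vector \<Rightarrow> 'b::real_normed_vector) \<Rightarrow> 'a \<Rightarrow> 'a \<Rightarrow> 'b" where
  "fd f x \<equiv> frechet_derivative f (at x)"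

section \<open>Derivatives at a point\<close>

lemma fd_eq: "(f has_derivative f') (at x) \<Longrightarrow> fd f x = f'"
  by (rule frechet_derivative_at[symmetric])

lemma fd_has_derivative: "f differentiable (at x) \<Longrightarrow> (f has_derivative fd f x) (at x)"
  by (simp add: frechet_derivative_works)

lemma fd_cong_open:
  assumes "f differentiable (at x)" "open S" "x \<in> S" "\<And>y. y \<in> S \<Longrightarrow> f y = g y"
  shows "g differentiable (at x)" "fd g x = fd f x"
  using has_derivative_transform_within_open[OF fd_has_derivative[OF assms(1)] assms(2-4)]
  by (auto simp: fd_eq differentiable_def)

lemma fd_compose:
  assumes "f differentiable (at x)" "g differentiable (at (f x))"
  shows "fd (\<lambda>x. g (f x)) x v = fd g (f x) (fd f x v)" "(\<lambda>x. g (f x)) differentiable (at x)"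
  using has_derivative_compose[OF fd_has_derivative[OF assms(1)] fd_has_derivative[OF assms(2)]]
  by (auto simp: fd_eq differentiable_def)

text \<open>Openness of \<open>S\<close> matters because \<open>fd\<close> at a point of
  \<open>S\<close> sees a full neighbourhood of it.\<close>

lemma Ck_on_cong:
  assumes "open S" "\<And>x. x \<in> S \<Longrightarrow> f x = g x" "Ck_on k S f"
  shows "Ck_on k S g"
  using assms(2,3)
proof (induction k arbitrary: f g)
  case 0
  then show ?case by (simp add: continuous_on_eq)
next
  case (Suc k)
  have d: "f differentiable (at x)" if "x \<in> S" for x
    using Suc.prems that by simp
  have g: "g differentiable (at x)" "fd g x = fd f x" if "x \<in> S" for x
    using fd_cong_open[OF d[OF that] assms(1) that, of g] Suc.prems(1) by auto
  have "Ck_on k S (\<lambda>x. fd g x v)" for v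
    by (rule Suc.IH[of "\<lambda>x. fd f x v"]) (use Suc.prems g in auto)
  then show ?case using g by simp
qed

lemma Ck_on_subset: "Ck_on k S f \<Longrightarrow> T \<subseteq> S \<Longrightarrow> Ck_on k T f"
  by (induction k arbitrary: f) (auto intro: continuous_on_subset)

lemma Ck_on_SucD: "Ck_on (Suc k) S f \<Longrightarrow> Ck_on k S f"
proof (induction k arbitrary: f)
  case 0
  then show ?case
    by (auto intro!: continuous_at_imp_continuous_on differentiable_imp_continuous_within)
qed auto

lemma Ck_on_local:
  assumes "\<And>x. x \<in> S \<Longrightarrow> \<exists>U. open U \<and> x \<in> U \<and> Ck_on k U f"
  shows "Ck_on k S f"
  using assms
proof (induction k arbitrary: f)
  case 0
  have "isCont f x" if "x \<in> S" for x
    using 0[OF that] by (auto simp: continuous_on_eq_continuous_at)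
  then show ?case by (auto intro: continuous_at_imp_continuous_on)
next
  case (Suc k)
  have "f differentiable (at x)" if "x \<in> S" for x
    using Suc.prems[OF that] by auto
  moreover have "Ck_on k S (\<lambda>x. fd f x v)" for v
    by (rule Suc.IH) (use Suc.prems in fastforce)
  ultimately show ?case by simp
qed

lemma Ck_on_linear_compose:
  assumes "open S" "bounded_linear L" "Ck_on k S f"
  shows "Ck_on k S (\<lambda>x. L (f x))"
  using assms(3)
proof (induction k arbitrary: f)
  case 0
  then show ?case using assms(2) by (simp add: bounded_linear.continuous_on)
next
  case (Suc k)
  have d: "((\<lambda>x. L (f x)) has_derivative (\<lambda>v. L (fd f x v))) (at x)" if "x \<in> S" for x
    using Suc.prems that by (intro bounded_linear.has_derivative[OF assms(2)] fd_has_derivative) simp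
  have "Ck_on k S (\<lambda>x. fd (\<lambda>x. L (f x)) x v)" for v
  proof (rule Ck_on_cong[OF assms(1)])
    show "Ck_on k S (\<lambda>x. L (fd f x v))" using Suc by simp
  qed (simp add: fd_eq[OF d])
  then show ?case using d by (auto simp: differentiable_def)
qed

lemma Ck_on_const: "Ck_on k S (\<lambda>x. c)"
  by (induction k arbitrary: c) auto

lemma Ck_on_bounded_linear:
  assumes "bounded_linear L"
  shows "Ck_on k S L"
proof (cases k)
  case 0
  then show ?thesis using assms by (simp add: linear_continuous_on)
next
  case (Suc n)
  have d: "(L has_derivative L) (at x)" for x
    by (rule bounded_linear_imp_has_derivative[OF assms])
  show ?thesis unfolding Suc
    by (auto simp: fd_eq[OF d] Ck_on_const intro: differentiableI[OF d])
qed

lemma Ck_on_add: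
  assumes "open S" "Ck_on k S f" "Ck_on k S g"
  shows "Ck_on k S (\<lambda>x. f x + g x)"
  using assms(2,3)
proof (induction k arbitrary: f g)
  case (Suc k)
  have d: "((\<lambda>x. f x + g x) has_derivative (\<lambda>v. fd f x v + fd g x v)) (at x)" if "x \<in> S" for x
    using Suc.prems that by (intro has_derivative_add fd_has_derivative) auto
  have "Ck_on k S (\<lambda>x. fd (\<lambda>x. f x + g x) x v)" for v
    by (rule Ck_on_cong[OF assms(1), of "\<lambda>x. fd f x v + fd g x v"]) (use Suc fd_eq[OF d] in auto)
  then show ?case using d by (auto simp: differentiable_def)
qed (auto intro: continuous_on_add)

lemma Ck_on_sum:
  assumes "open S" "\<And>i. i \<in> I \<Longrightarrow> Ck_on k S (f i)"
  shows "Ck_on k S (\<lambda>x. \<Sum>i\<in>I. f i x)"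
  using assms(2)
  by (induction I rule: infinite_finite_induct) (auto intro: Ck_on_add[OF assms(1)] Ck_on_const)

lemma Ck_on_bilinear:
  assumes "bounded_bilinear B" "open S" "Ck_on k S f" "Ck_on k S g"
  shows "Ck_on k S (\<lambda>x. B (f x) (g x))"
  using assms(3,4)
proof (induction k arbitrary: f g)
  case 0
  then show ?case using bounded_bilinear.continuous_on[OF assms(1)] by auto
next
  case (Suc k)
  have d: "((\<lambda>x. B (f x) (g x)) has_derivative (\<lambda>v. B (f x) (fd g x v) + B (fd f x v) (g x))) (at x)"
    if "x \<in> S" for x
    using Suc.prems that by (intro bounded_bilinear.FDERIV[OF assms(1)] fd_has_derivative) auto
  have "Ck_on k S (\<lambda>x. fd (\<lambda>x. B (f x) (g x)) x v)" for v
  proof (rule Ck_on_cong[OF assms(2)])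
    show "Ck_on k S (\<lambda>x. B (f x) (fd g x v) + B (fd f x v) (g x))"
      by (intro Ck_on_add[OF assms(2)] Suc.IH) (use Suc.prems Ck_on_SucD in auto)
  qed (simp add: fd_eq[OF d])
  then show ?case using d by (auto simp: differentiable_def)
qed

lemma linear_coord_expand:
  assumes B: "finite B" "\<And>b. b \<in> B \<Longrightarrow> bounded_linear (c b)" "\<And>v. (\<Sum>b\<in>B. c b v *\<^sub>R b) = v"
    and lin: "linear f"
  shows "f v = (\<Sum>b\<in>B. c b v *\<^sub>R f b)"
proof -
  have "f v = f (\<Sum>b\<in>B. c b v *\<^sub>R b)" by (simp add: B(3))
  then show ?thesis by (simp add: linear_sum[OF lin] linear_scale[OF lin])
qed

text \<open>The chain rule applies the derivative of \<open>g\<close> to a direction that varies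
  with \<open>x\<close>, whereas \<open>Ck_on\<close> speaks of fixed directions only. Expanding
  this direction in a basis of \<open>'b\<close> turns the derivative into a finite sum of products,
  to which the induction hypothesis applies.\<close>

lemma Ck_on_compose:
  fixes f :: "'a::real_normed_vector \<Rightarrow> 'b::real_normed_vector" and g :: "'b \<Rightarrow> 'c::real_normed_vector"
  assumes fin: "findim TYPE('b)" and S: "open S" and T: "open T"
    and f: "Ck_on k S f" and fST: "\<And>x. x \<in> S \<Longrightarrow> f x \<in> T" and g: "Ck_on k T g"
  shows "Ck_on k S (\<lambda>x. g (f x))"
proof -
  obtain B :: "'b set" and c where B: "finite B" "\<And>b. b \<in> B \<Longrightarrow> bounded_linear (c b)"
    "\<And>v. (\<Sum>b\<in>B. c b v *\<^sub>R b) = v"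
    using findim_coords[OF fin] by metis
  show ?thesis
    using f g
  proof (induction k arbitrary: g)
    case 0
    then show ?case using fST continuous_on_compose2[of T g S f] by auto
  next
    case (Suc k)
    have df: "f differentiable (at x)" and dg: "g differentiable (at (f x))" if "x \<in> S" for x
      using Suc.prems that fST by auto
    have expand: "fd (\<lambda>x. g (f x)) x v = (\<Sum>b\<in>B. c b (fd f x v) *\<^sub>R fd g (f x) b)" if "x \<in> S" for x v
      unfolding fd_compose(1)[OF df[OF that] dg[OF that]]
      by (rule linear_coord_expand[OF B linear_frechet_derivative[OF dg[OF that]]])
    have "Ck_on k S (\<lambda>x. fd (\<lambda>x. g (f x)) x v)" for v
    proof (rule Ck_on_cong[OF S])
      show "Ck_on k S (\<lambda>x. \<Sum>b\<in>B. c b (fd f x v) *\<^sub>R fd g (f x) b)"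
        by (intro Ck_on_sum[OF S] Ck_on_bilinear[OF bounded_bilinear_scaleR S]
            Ck_on_linear_compose[OF S B(2)] Suc.IH)
          (use Suc.prems Ck_on_SucD[OF Suc.prems(1)] in auto)
    qed (simp add: expand)
    then show ?case using fd_compose(2)[OF df dg] by simp
  qed
qed

section \<open>Closure properties of smooth functions\<close>

lemma Cinf_onD: "Cinf_on S f \<Longrightarrow> Ck_on k S f"
  by (simp add: Cinf_on_def)

lemma Cinf_on_differentiable: "Cinf_on S f \<Longrightarrow> x \<in> S \<Longrightarrow> f differentiable (at x)"
  using Cinf_onD[of S f "Suc 0"] by auto

lemma Cinf_on_continuous: "Cinf_on S f \<Longrightarrow> continuous_on S f"
  using Cinf_onD[of S f 0] by auto

lemma Cinf_on_fd: "Cinf_on S f \<Longrightarrow> Cinf_on S (\<lambda>x. fd f x v)"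
  unfolding Cinf_on_def using Ck_on.simps(2) by blast

lemma Cinf_on_cong: "open S \<Longrightarrow> (\<And>x. x \<in> S \<Longrightarrow> f x = g x) \<Longrightarrow> Cinf_on S f \<Longrightarrow> Cinf_on S g"
  unfolding Cinf_on_def using Ck_on_cong by metis

lemma Cinf_on_subset: "Cinf_on S f \<Longrightarrow> T \<subseteq> S \<Longrightarrow> Cinf_on T f"
  unfolding Cinf_on_def using Ck_on_subset by metis

lemma Cinf_on_local:
  assumes "\<And>x. x \<in> S \<Longrightarrow> \<exists>U. open U \<and> x \<in> U \<and> Cinf_on U f"
  shows "Cinf_on S f"
  unfolding Cinf_on_def
  by (intro allI Ck_on_local) (use assms Cinf_onD in metis)

lemma Cinf_on_linear_compose:
  "open S \<Longrightarrow> bounded_linear L \<Longrightarrow> Cinf_on S f \<Longrightarrow> Cinf_on S (\<lambda>x. L (f x))"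
  unfolding Cinf_on_def by (simp add: Ck_on_linear_compose)

lemma Cinf_on_const: "Cinf_on S (\<lambda>x. c)"
  by (simp add: Cinf_on_def Ck_on_const)

lemma Cinf_on_bounded_linear: "bounded_linear L \<Longrightarrow> Cinf_on S L"
  by (simp add: Cinf_on_def Ck_on_bounded_linear)

lemma Cinf_on_id: "Cinf_on S (\<lambda>x. x)"
  by (rule Cinf_on_bounded_linear[OF bounded_linear_ident])

lemma Cinf_on_add: "open S \<Longrightarrow> Cinf_on S f \<Longrightarrow> Cinf_on S g \<Longrightarrow> Cinf_on S (\<lambda>x. f x + g x)"
  by (simp add: Cinf_on_def Ck_on_add)

lemma Cinf_on_minus: "open S \<Longrightarrow> Cinf_on S f \<Longrightarrow> Cinf_on S (\<lambda>x. - f x)"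
  by (rule Cinf_on_linear_compose[OF _ bounded_linear_minus[OF bounded_linear_ident]])

lemma Cinf_on_diff: "open S \<Longrightarrow> Cinf_on S f \<Longrightarrow> Cinf_on S g \<Longrightarrow> Cinf_on S (\<lambda>x. f x - g x)"
  using Cinf_on_add[of S f "\<lambda>x. - g x"] Cinf_on_minus[of S g] by simp

lemma Cinf_on_sum: "open S \<Longrightarrow> (\<And>i. i \<in> I \<Longrightarrow> Cinf_on S (f i)) \<Longrightarrow> Cinf_on S (\<lambda>x. \<Sum>i\<in>I. f i x)"
  by (simp add: Cinf_on_def Ck_on_sum)

lemma Cinf_on_bilinear:
  "bounded_bilinear B \<Longrightarrow> open S \<Longrightarrow> Cinf_on S f \<Longrightarrow> Cinf_on S g \<Longrightarrow> Cinf_on S (\<lambda>x. B (f x) (g x))"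
  by (simp add: Cinf_on_def Ck_on_bilinear)

lemmas Cinf_on_scaleR = Cinf_on_bilinear[OF bounded_bilinear_scaleR]

lemma Cinf_on_Pair:
  assumes "open S" "Cinf_on S f" "Cinf_on S g"
  shows "Cinf_on S (\<lambda>x. (f x, g x))"
proof -
  have "bounded_linear (\<lambda>x::'b. (x, 0::'c))" "bounded_linear (\<lambda>y::'c. (0::'b, y))"
    by (intro bounded_linear_Pair bounded_linear_ident bounded_linear_zero)+
  then have "Cinf_on S (\<lambda>x. (f x, 0) + (0, g x))"
    by (intro Cinf_on_add assms(1) Cinf_on_linear_compose[OF assms(1) _ assms(2)]
        Cinf_on_linear_compose[OF assms(1) _ assms(3)])
  then show ?thesis by simp
qed

lemma Cinf_on_fst: "open S \<Longrightarrow> Cinf_on S f \<Longrightarrow> Cinf_on S (\<lambda>x. fst (f x))"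
  by (rule Cinf_on_linear_compose[OF _ bounded_linear_fst])

lemma Cinf_on_snd: "open S \<Longrightarrow> Cinf_on S f \<Longrightarrow> Cinf_on S (\<lambda>x. snd (f x))"
  by (rule Cinf_on_linear_compose[OF _ bounded_linear_snd])

lemma Cinf_on_compose:
  fixes f :: "'a::real_normed_vector \<Rightarrow> 'b::real_normed_vector" and g :: "'b \<Rightarrow> 'c::real_normed_vector"
  assumes "findim TYPE('b)" "open S" "open T" "Cinf_on S f" "\<And>x. x \<in> S \<Longrightarrow> f x \<in> T" "Cinf_on T g"
  shows "Cinf_on S (\<lambda>x. g (f x))"
  using assms by (simp add: Cinf_on_def Ck_on_compose)

text \<open>The basis expansion of \<open>Ck_on_compose\<close> again, now for an arbitrary smooth
  direction \<open>v x\<close>. It serves to change coordinates of vector fields and to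
  differentiate brackets.\<close>

lemma Cinf_on_fd_apply:
  fixes f :: "'a::real_normed_vector \<Rightarrow> 'b::real_normed_vector" and g :: "'b \<Rightarrow> 'c::real_normed_vector"
  assumes fin: "findim TYPE('b)" and S: "open S" and T: "open T"
    and f: "Cinf_on S f" and fST: "\<And>x. x \<in> S \<Longrightarrow> f x \<in> T" and g: "Cinf_on T g" and v: "Cinf_on S v"
  shows "Cinf_on S (\<lambda>x. fd g (f x) (v x))"
proof -
  obtain B :: "'b set" and c where B: "finite B" "\<And>b. b \<in> B \<Longrightarrow> bounded_linear (c b)"
    "\<And>v. (\<Sum>b\<in>B. c b v *\<^sub>R b) = v"
    using findim_coords[OF fin] by metis
  show ?thesis
  proof (rule Cinf_on_cong[OF S])
    show "Cinf_on S (\<lambda>x. \<Sum>b\<in>B. c b (v x) *\<^sub>R fd g (f x) b)"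
      by (intro Cinf_on_sum[OF S] Cinf_on_scaleR[OF S] Cinf_on_linear_compose[OF S B(2) v]
          Cinf_on_compose[OF fin S T f fST Cinf_on_fd[OF g]])
  next
    fix x assume "x \<in> S"
    then show "(\<Sum>b\<in>B. c b (v x) *\<^sub>R fd g (f x) b) = fd g (f x) (v x)"
      using linear_coord_expand[OF B linear_frechet_derivative, of g "at (f x)" "v x"]
        Cinf_on_differentiable[OF g fST] by simp
  qed
qed

section \<open>Second derivatives, brackets and one-forms in coordinates\<close>

text \<open>The mean value inequality on an interval, in the form that is nested twice in the next
  estimate.\<close>

lemma norm_increment_bound:
  fixes F :: "real \<Rightarrow> 'b::real_normed_vector"
  assumes t: "0 \<le> t"
    and d: "\<And>u. 0 \<le> u \<Longrightarrow> u \<le> t \<Longrightarrow> (F has_derivative (\<lambda>h. h *\<^sub>R F' u)) (at u)"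
    and b: "\<And>u. 0 \<le> u \<Longrightarrow> u \<le> t \<Longrightarrow> norm (F' u) \<le> B"
  shows "norm (F t - F 0) \<le> B * t"
proof -
  have "norm (F t - F 0) \<le> B * norm (t - 0)"
  proof (rule differentiable_bound[of "{0..t}" F "\<lambda>u h. h *\<^sub>R F' u"])
    show "(F has_derivative (\<lambda>h. h *\<^sub>R F' u)) (at u within {0..t})" if "u \<in> {0..t}" for u
      using d[of u] that by (auto intro: has_derivative_at_withinI)
    show "onorm (\<lambda>h. h *\<^sub>R F' u) \<le> B" if "u \<in> {0..t}" for u
      using b[of u] that by (intro onorm_le) (auto intro!: mult_left_mono simp: mult.commute[of B])
  qed (use t in auto)
  then show ?thesis using t by simp
qed

lemma has_derivative_along_path:
  assumes "(p has_derivative (\<lambda>h. h *\<^sub>R w)) (at u)" "f differentiable (at (p u))"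
  shows "((\<lambda>u. f (p u)) has_derivative (\<lambda>h. h *\<^sub>R fd f (p u) w)) (at u)"
  using has_derivative_compose[OF assms(1) fd_has_derivative[OF assms(2)]]
    linear_frechet_derivative[OF assms(2)] by (simp add: linear_scale)

text \<open>Two mean value estimates, one inside the other. The outer one moves along
  \<open>v\<close>, and its derivative is a first difference of \<open>fd f _ v\<close> along
  \<open>w\<close>; the inner one bounds that by continuity of the mixed derivative at
  \<open>x\<close>.\<close>

lemma second_difference_bound:
  fixes f :: "'a::real_normed_vector \<Rightarrow> 'b::real_normed_vector"
  assumes S: "open S" "x \<in> S" and f: "Ck_on 2 S f" and e: "e > 0"
  shows "\<exists>d>0. \<forall>s. 0 < s \<and> s < d \<longrightarrow>
    norm (f (x + s *\<^sub>R v + s *\<^sub>R w) - f (x + s *\<^sub>R v) - f (x + s *\<^sub>R w) + f x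
      - (s * s) *\<^sub>R fd (\<lambda>z. fd f z v) x w) \<le> s * s * e"
proof -
  define g where "g z = fd f z v" for z
  define L where "L = fd g x w"
  have df: "f differentiable (at z)" and dg: "g differentiable (at z)" if "z \<in> S" for z
    using f that unfolding g_def by (auto simp: numeral_2_eq_2)
  have "continuous_on S (\<lambda>z. fd g z w)"
    using f unfolding g_def by (simp add: numeral_2_eq_2)
  then have "isCont (\<lambda>z. fd g z w) x"
    using S by (simp add: continuous_on_eq_continuous_at)
  then obtain d1 where d1: "d1 > 0" "\<And>z. dist z x < d1 \<Longrightarrow> dist (fd g z w) L < e"
    using e unfolding continuous_at_eps_delta L_def by blast
  obtain d2 where d2: "d2 > 0" "ball x d2 \<subseteq> S"
    using S openE by blast
  \<comment> \<open>Scaled so that all corners of the parallelogram with sides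
    \<open>s *\<^sub>R v\<close> and \<open>s *\<^sub>R w\<close> stay within
    \<open>min d1 d2\<close> of \<open>x\<close>; the summand 1 excludes division by zero.\<close>
  define d where "d = min d1 d2 / (norm v + norm w + 1)"
  have nn: "norm v + norm w + 1 > 0" using norm_ge_zero[of v] norm_ge_zero[of w] by linarith
  have dpos: "d > 0" using d1 d2 nn by (simp add: d_def)
  have near: "dist (x + a *\<^sub>R v + b *\<^sub>R w) x < min d1 d2" if ab: "0 \<le> a" "0 \<le> b" "a \<le> s" "b \<le> s" "s < d" for a b s
  proof -
    have "dist (x + a *\<^sub>R v + b *\<^sub>R w) x = norm (a *\<^sub>R v + b *\<^sub>R w)" by (simp add: dist_norm)
    also have "\<dots> \<le> a * norm v + b * norm w" using norm_triangle_ineq[of "a *\<^sub>R v" "b *\<^sub>R w"] ab by simp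
    also have "\<dots> \<le> s * norm v + s * norm w" using ab by (intro add_mono mult_right_mono) auto
    also have "\<dots> \<le> s * (norm v + norm w + 1)" using ab by (simp add: algebra_simps)
    also have "\<dots> < d * (norm v + norm w + 1)" using ab nn by simp
    also have "\<dots> = min d1 d2" using nn by (simp add: d_def)
    finally show ?thesis .
  qed
  have inS: "x + a *\<^sub>R v + b *\<^sub>R w \<in> S" if "0 \<le> a" "0 \<le> b" "a \<le> s" "b \<le> s" "s < d" for a b s
    using near[OF that] d2(2) by (auto simp: subset_eq dist_commute)
  have "norm (f (x + s *\<^sub>R v + s *\<^sub>R w) - f (x + s *\<^sub>R v) - f (x + s *\<^sub>R w) + f x - (s * s) *\<^sub>R L) \<le> s * s * e"
    if s: "0 < s" "s < d" for s
  proof -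
    have step1: "norm (g (x + a *\<^sub>R v + s *\<^sub>R w) - g (x + a *\<^sub>R v) - s *\<^sub>R L) \<le> e * s" if a: "0 \<le> a" "a \<le> s" for a
    proof -
      define F where "F u = g (x + a *\<^sub>R v + u *\<^sub>R w) - u *\<^sub>R L" for u
      have "(F has_derivative (\<lambda>h. h *\<^sub>R (fd g (x + a *\<^sub>R v + u *\<^sub>R w) w - L))) (at u)" if u: "0 \<le> u" "u \<le> s" for u
      proof -
        have zS: "x + a *\<^sub>R v + u *\<^sub>R w \<in> S"
          by (rule inS) (use a u s in auto)
        have "((\<lambda>u. g (x + a *\<^sub>R v + u *\<^sub>R w)) has_derivative (\<lambda>h. h *\<^sub>R fd g (x + a *\<^sub>R v + u *\<^sub>R w) w)) (at u)"
          by (rule has_derivative_along_path[where p="\<lambda>u. x + a *\<^sub>R v + u *\<^sub>R w", OF _ dg[OF zS]])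
            (auto intro!: derivative_eq_intros)
        then show ?thesis
          unfolding F_def by (auto intro!: derivative_eq_intros simp: algebra_simps)
      qed
      moreover have "norm (fd g (x + a *\<^sub>R v + u *\<^sub>R w) w - L) \<le> e" if "0 \<le> u" "u \<le> s" for u
        using d1(2)[of "x + a *\<^sub>R v + u *\<^sub>R w"] near[of a u s] a s that by (simp add: dist_norm)
      ultimately have "norm (F s - F 0) \<le> e * s"
        using s by (intro norm_increment_bound[of s F "\<lambda>u. fd g (x + a *\<^sub>R v + u *\<^sub>R w) w - L"]) auto
      then show ?thesis by (simp add: F_def algebra_simps)
    qed
    define F where "F a = f (x + a *\<^sub>R v + s *\<^sub>R w) - f (x + a *\<^sub>R v) - (a * s) *\<^sub>R L" for a
    have "(F has_derivative (\<lambda>h. h *\<^sub>R (g (x + a *\<^sub>R v + s *\<^sub>R w) - g (x + a *\<^sub>R v) - s *\<^sub>R L))) (at a)"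
      if a: "0 \<le> a" "a \<le> s" for a
    proof -
      have in1: "x + a *\<^sub>R v + s *\<^sub>R w \<in> S" and in2: "x + a *\<^sub>R v \<in> S"
        using inS[of a s s] inS[of a 0 s] a s by auto
      have "((\<lambda>a. f (x + a *\<^sub>R v + s *\<^sub>R w)) has_derivative (\<lambda>h. h *\<^sub>R g (x + a *\<^sub>R v + s *\<^sub>R w))) (at a)"
        unfolding g_def
        by (rule has_derivative_along_path[where p="\<lambda>a. x + a *\<^sub>R v + s *\<^sub>R w", OF _ df[OF in1]])
          (auto intro!: derivative_eq_intros)
      moreover have "((\<lambda>a. f (x + a *\<^sub>R v)) has_derivative (\<lambda>h. h *\<^sub>R g (x + a *\<^sub>R v))) (at a)"
        unfolding g_def
        by (rule has_derivative_along_path[where p="\<lambda>a. x + a *\<^sub>R v", OF _ df[OF in2]])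
          (auto intro!: derivative_eq_intros)
      ultimately show ?thesis
        unfolding F_def by (auto intro!: derivative_eq_intros simp: algebra_simps)
    qed
    then have "norm (F s - F 0) \<le> e * s * s"
      using s step1 by (intro norm_increment_bound[of s F "\<lambda>a. g (x + a *\<^sub>R v + s *\<^sub>R w) - g (x + a *\<^sub>R v) - s *\<^sub>R L"]) auto
    then show ?thesis by (simp add: F_def algebra_simps)
  qed
  then show ?thesis
    using dpos unfolding L_def g_def by blast
qed

text \<open>The second difference is symmetric in \<open>v\<close> and \<open>w\<close>, and after
  division by \<open>s * s\<close> it is close to both mixed derivatives.\<close>

lemma second_derivative_symmetric:
  fixes f :: "'a::real_normed_vector \<Rightarrow> 'b::real_normed_vector"
  assumes S: "open S" "x \<in> S" and f: "Ck_on 2 S f"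
  shows "fd (\<lambda>z. fd f z v) x w = fd (\<lambda>z. fd f z w) x v" (is "?L = ?M")
proof -
  have "norm (?L - ?M) \<le> 2 * e" if e: "e > 0" for e
  proof -
    obtain d1 d2 where d: "d1 > 0" "d2 > 0"
      "\<And>s. 0 < s \<and> s < d1 \<Longrightarrow> norm (f (x + s *\<^sub>R v + s *\<^sub>R w) - f (x + s *\<^sub>R v) - f (x + s *\<^sub>R w) + f x
         - (s * s) *\<^sub>R ?L) \<le> s * s * e"
      "\<And>s. 0 < s \<and> s < d2 \<Longrightarrow> norm (f (x + s *\<^sub>R w + s *\<^sub>R v) - f (x + s *\<^sub>R w) - f (x + s *\<^sub>R v) + f x
         - (s * s) *\<^sub>R ?M) \<le> s * s * e"
      using second_difference_bound[OF S f e, of v w] second_difference_bound[OF S f e, of w v] by blast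
    define s where "s = min d1 d2 / 2"
    have s: "0 < s" "s < d1" "s < d2" using d(1,2) by (auto simp: s_def)
    define D where "D = f (x + s *\<^sub>R v + s *\<^sub>R w) - f (x + s *\<^sub>R v) - f (x + s *\<^sub>R w) + f x"
    have "norm (D - (s * s) *\<^sub>R ?L) \<le> s * s * e" "norm (D - (s * s) *\<^sub>R ?M) \<le> s * s * e"
      using d(3)[of s] d(4)[of s] s by (auto simp: D_def algebra_simps)
    then have "norm ((D - (s * s) *\<^sub>R ?M) - (D - (s * s) *\<^sub>R ?L)) \<le> s * s * e + s * s * e"
      using norm_triangle_ineq4[of "D - (s * s) *\<^sub>R ?M" "D - (s * s) *\<^sub>R ?L"] by linarith
    moreover have "(D - (s * s) *\<^sub>R ?M) - (D - (s * s) *\<^sub>R ?L) = (s * s) *\<^sub>R (?L - ?M)"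
      by (simp add: algebra_simps)
    ultimately have "(s * s) * norm (?L - ?M) \<le> (s * s) * (2 * e)" by (simp add: mult_ac)
    then show ?thesis using s by (simp add: mult_le_cancel_left)
  qed
  \<comment> \<open>With a third of the distance as error, the distance is at most two thirds of
    itself, hence zero.\<close>
  from this[of "norm (?L - ?M) / 3"] show ?thesis
    by (cases "?L = ?M") auto
qed

text \<open>A product rule for a family of linear maps of which only the values on fixed vectors are
  known to be differentiable. A basis expansion replaces any topology on the space of linear
  maps.\<close>

lemma has_derivative_linear_field:
  fixes A :: "'z::real_normed_vector \<Rightarrow> 'b::real_normed_vector \<Rightarrow> 'c::real_normed_vector"
  assumes fin: "findim TYPE('b)" and U: "open U" "y \<in> U"
    and lin: "\<And>z. z \<in> U \<Longrightarrow> linear (A z)"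
    and A: "\<And>b. (\<lambda>z. A z b) differentiable (at y)"
    and W: "(W has_derivative W') (at y)"
  shows "((\<lambda>z. A z (W z)) has_derivative (\<lambda>h. fd (\<lambda>z. A z (W y)) y h + A y (W' h))) (at y)"
proof -
  obtain B :: "'b set" and c where B: "finite B" "\<And>b. b \<in> B \<Longrightarrow> bounded_linear (c b)"
    "\<And>v. (\<Sum>b\<in>B. c b v *\<^sub>R b) = v"
    using findim_coords[OF fin] by metis
  have expand: "(\<Sum>b\<in>B. c b v *\<^sub>R A z b) = A z v" if "z \<in> U" for z v
    by (rule linear_coord_expand[OF B lin[OF that], symmetric])
  have dA: "((\<lambda>z. A z b) has_derivative fd (\<lambda>z. A z b) y) (at y)" for b
    by (rule fd_has_derivative[OF A])
  have "((\<lambda>z. \<Sum>b\<in>B. c b (W y) *\<^sub>R A z b) has_derivative (\<lambda>h. \<Sum>b\<in>B. c b (W y) *\<^sub>R fd (\<lambda>z. A z b) y h)) (at y)"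
    by (intro has_derivative_sum has_derivative_scaleR_right dA)
  then have "((\<lambda>z. A z (W y)) has_derivative (\<lambda>h. \<Sum>b\<in>B. c b (W y) *\<^sub>R fd (\<lambda>z. A z b) y h)) (at y)"
    by (rule has_derivative_transform_within_open[OF _ U]) (simp add: expand)
  then have e1: "fd (\<lambda>z. A z (W y)) y h = (\<Sum>b\<in>B. c b (W y) *\<^sub>R fd (\<lambda>z. A z b) y h)" for h
    by (simp add: fd_eq)
  have "((\<lambda>z. \<Sum>b\<in>B. c b (W z) *\<^sub>R A z b) has_derivative
      (\<lambda>h. \<Sum>b\<in>B. c b (W y) *\<^sub>R fd (\<lambda>z. A z b) y h + c b (W' h) *\<^sub>R A y b)) (at y)"
    by (intro has_derivative_sum has_derivative_scaleR dA bounded_linear.has_derivative[OF B(2) W])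
  then have "((\<lambda>z. A z (W z)) has_derivative
      (\<lambda>h. \<Sum>b\<in>B. c b (W y) *\<^sub>R fd (\<lambda>z. A z b) y h + c b (W' h) *\<^sub>R A y b)) (at y)"
    by (rule has_derivative_transform_within_open[OF _ U]) (simp add: expand)
  then show ?thesis
    by (simp add: sum.distrib e1 expand[OF U(2)])
qed

lemma has_derivative_fd_apply:
  fixes f :: "'a::real_normed_vector \<Rightarrow> 'b::real_normed_vector"
  assumes "findim TYPE('a)" "open S" "y \<in> S" "Cinf_on S f" "(W has_derivative W') (at y)"
  shows "((\<lambda>z. fd f z (W z)) has_derivative (\<lambda>h. fd (\<lambda>z. fd f z (W y)) y h + fd f y (W' h))) (at y)"
  by (rule has_derivative_linear_field[OF assms(1-3) _ _ assms(5)])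
    (use assms Cinf_on_differentiable[OF assms(4)] Cinf_on_differentiable[OF Cinf_on_fd[OF assms(4)]]
      in \<open>auto intro: linear_frechet_derivative\<close>)

text \<open>Differentiating the two relations yields a second derivative of \<open>f\<close> in
  each; these cancel in the difference by symmetry.\<close>

lemma bracket_pushforward:
  fixes f :: "'a::real_normed_vector \<Rightarrow> 'b::real_normed_vector"
  assumes fin: "findim TYPE('a)" and S: "open S" "y \<in> S" and f: "Cinf_on S f"
    and V: "(V has_derivative V') (at y)" and W: "(W has_derivative W') (at y)"
    and V2: "(V2 has_derivative V2') (at (f y))" and W2: "(W2 has_derivative W2') (at (f y))"
    and relV: "\<And>z. z \<in> S \<Longrightarrow> V2 (f z) = fd f z (V z)"
    and relW: "\<And>z. z \<in> S \<Longrightarrow> W2 (f z) = fd f z (W z)"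
  shows "fd f y (W' (V y) - V' (W y)) = W2' (V2 (f y)) - V2' (W2 (f y))"
proof -
  have df: "(f has_derivative fd f y) (at y)"
    by (rule fd_has_derivative[OF Cinf_on_differentiable[OF f S(2)]])
  have lin: "linear (fd f y)" by (rule has_derivative_linear[OF df])
  have eq: "X2' (fd f y h) = fd (\<lambda>z. fd f z (X y)) y h + fd f y (X' h)"
    if X: "(X has_derivative X') (at y)" and X2: "(X2 has_derivative X2') (at (f y))"
      and rel: "\<And>z. z \<in> S \<Longrightarrow> X2 (f z) = fd f z (X z)" for X X' X2 X2' h
  proof -
    have "((\<lambda>z. fd f z (X z)) has_derivative (\<lambda>h. X2' (fd f y h))) (at y)"
      by (rule has_derivative_transform_within_open[OF has_derivative_compose[OF df X2] S]) (simp add: rel)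
    from has_derivative_unique[OF this has_derivative_fd_apply[OF fin S f X]] show ?thesis
      by (rule fun_cong)
  qed
  have sym: "fd (\<lambda>z. fd f z (V y)) y (W y) = fd (\<lambda>z. fd f z (W y)) y (V y)"
    by (rule second_derivative_symmetric[OF S Cinf_onD[OF f]])
  show ?thesis
    using eq[OF V V2 relV, of "W y"] eq[OF W W2 relW, of "V y"] sym
    by (simp add: relV relW S linear_diff[OF lin])
qed

text \<open>This is \<open>-d\<omega>(s, t)\<close>, the sign with which the curvature pairs with brackets.\<close>

definition ext_deriv ::
  "('r::real_normed_vector \<Rightarrow> 'r \<Rightarrow> 'w::real_normed_vector) \<Rightarrow> 'r \<Rightarrow> 'r \<Rightarrow> 'r \<Rightarrow> 'w" where
  "ext_deriv \<omega> y s t = fd (\<lambda>y. \<omega> y s) y t - fd (\<lambda>y. \<omega> y t) y s"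

text \<open>The product rule for the pullback of \<omega> along \<psi> evaluated on
  \<open>X\<close>: the three terms come from the base point of \<omega>, from the derivative of
  \<psi>, and from \<open>X\<close>.\<close>

lemma has_derivative_one_form:
  fixes \<psi> :: "'z::real_normed_vector \<Rightarrow> 'r::real_normed_vector"
    and \<omega> :: "'r \<Rightarrow> 'r \<Rightarrow> 'w::real_normed_vector"
  assumes fin: "findim TYPE('z)" "findim TYPE('r)" and S: "open S" "p \<in> S" and \<psi>: "Cinf_on S \<psi>"
    and T: "open T" "\<psi> p \<in> T" and lin: "\<And>y. y \<in> T \<Longrightarrow> linear (\<omega> y)"
    and \<omega>: "\<And>e. (\<lambda>y. \<omega> y e) differentiable (at (\<psi> p))"
    and X: "(X has_derivative X') (at p)"
  shows "((\<lambda>z. \<omega> (\<psi> z) (fd \<psi> z (X z))) has_derivative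
    (\<lambda>h. fd (\<lambda>y. \<omega> y (fd \<psi> p (X p))) (\<psi> p) (fd \<psi> p h)
      + \<omega> (\<psi> p) (fd (\<lambda>z. fd \<psi> z (X p)) p h + fd \<psi> p (X' h)))) (at p)"
proof -
  have d\<psi>: "\<psi> differentiable (at p)"
    by (rule Cinf_on_differentiable[OF \<psi> S(2)])
  have "continuous_on S \<psi>" by (rule Cinf_on_continuous[OF \<psi>])
  then have op: "open (S \<inter> \<psi> -` T)"
    using S(1) T(1) continuous_open_preimage by blast
  have mem: "p \<in> S \<inter> \<psi> -` T" using S T by simp
  have lin': "linear (\<omega> (\<psi> z))" if "z \<in> S \<inter> \<psi> -` T" for z
    using lin that by simp
  have "(\<lambda>z. \<omega> (\<psi> z) e) differentiable (at p)"
    and "fd (\<lambda>z. \<omega> (\<psi> z) e) p h = fd (\<lambda>y. \<omega> y e) (\<psi> p) (fd \<psi> p h)" for e h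
    using fd_compose[OF d\<psi> \<omega>] by auto
  then show ?thesis
    using has_derivative_linear_field[where A="\<lambda>z. \<omega> (\<psi> z)", OF fin(2) op mem lin' _ has_derivative_fd_apply[OF fin(1) S \<psi> X]]
    by simp
qed

text \<open>Cartan's formula \<open>d\<omega>(U, V) = U \<omega>(V) - V \<omega>(U) - \<omega>[U, V]\<close> for the pullback of \<open>\<omega>\<close> along \<open>\<psi>\<close>,
  when the first two terms vanish.\<close>

lemma one_form_bracket:
  fixes \<psi> :: "'z::real_normed_vector \<Rightarrow> 'r::real_normed_vector"
    and \<omega> :: "'r \<Rightarrow> 'r \<Rightarrow> 'w::real_normed_vector"
  assumes fin: "findim TYPE('z)" "findim TYPE('r)" and S: "open S" "p \<in> S" and \<psi>: "Cinf_on S \<psi>"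
    and T: "open T" "\<psi> p \<in> T" and lin: "\<And>y. y \<in> T \<Longrightarrow> linear (\<omega> y)"
    and \<omega>: "\<And>e. (\<lambda>y. \<omega> y e) differentiable (at (\<psi> p))"
    and U: "(U has_derivative U') (at p)" and V: "(V has_derivative V') (at p)"
    and zU: "fd (\<lambda>z. \<omega> (\<psi> z) (fd \<psi> z (U z))) p (V p) = 0"
    and zV: "fd (\<lambda>z. \<omega> (\<psi> z) (fd \<psi> z (V z))) p (U p) = 0"
  shows "\<omega> (\<psi> p) (fd \<psi> p (V' (U p) - U' (V p))) = ext_deriv \<omega> (\<psi> p) (fd \<psi> p (U p)) (fd \<psi> p (V p))"
proof -
  have eq: "fd (\<lambda>z. \<omega> (\<psi> z) (fd \<psi> z (X z))) p h = fd (\<lambda>y. \<omega> y (fd \<psi> p (X p))) (\<psi> p) (fd \<psi> p h)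
      + \<omega> (\<psi> p) (fd (\<lambda>z. fd \<psi> z (X p)) p h + fd \<psi> p (X' h))"
    if X: "(X has_derivative X') (at p)" for X X' h
    by (rule fun_cong[OF fd_eq], rule has_derivative_one_form[OF fin S \<psi> T lin \<omega> X])
  have sym: "fd (\<lambda>z. fd \<psi> z (V p)) p (U p) = fd (\<lambda>z. fd \<psi> z (U p)) p (V p)"
    by (rule second_derivative_symmetric[OF S Cinf_onD[OF \<psi>]])
  have l: "linear (\<omega> (\<psi> p))" "linear (fd \<psi> p)"
    using lin T(2) linear_frechet_derivative[OF Cinf_on_differentiable[OF \<psi> S(2)]] by auto
  \<comment> \<open>Here \<open>x\<close> is the term with the second derivative of \<psi>, common
    to both expansions by \<open>sym\<close>; \<open>a\<close> and \<open>b\<close> come from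
    differentiating the fields, \<open>t\<close> and \<open>u\<close> from differentiating
    \<omega>.\<close>
  have cancel: "b - a = t - u" if "0 = t + (x + a)" "0 = u + (x + b)" for a b x t u :: 'w
  proof -
    have "b - a = (u + (x + b)) - (t + (x + a)) + (t - u)" by simp
    also have "\<dots> = t - u" by (simp only: that[symmetric]) simp
    finally show ?thesis .
  qed
  show ?thesis
    unfolding ext_deriv_def linear_diff[OF l(1)] linear_diff[OF l(2)]
  proof (rule cancel)
    show "0 = fd (\<lambda>y. \<omega> y (fd \<psi> p (U p))) (\<psi> p) (fd \<psi> p (V p))
        + (\<omega> (\<psi> p) (fd (\<lambda>z. fd \<psi> z (U p)) p (V p)) + \<omega> (\<psi> p) (fd \<psi> p (U' (V p))))"
      using eq[OF U, of "V p"] by (simp add: zU linear_add[OF l(1)])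
    show "0 = fd (\<lambda>y. \<omega> y (fd \<psi> p (V p))) (\<psi> p) (fd \<psi> p (U p))
        + (\<omega> (\<psi> p) (fd (\<lambda>z. fd \<psi> z (U p)) p (V p)) + \<omega> (\<psi> p) (fd \<psi> p (V' (U p))))"
      using eq[OF V, of "U p"] by (simp add: zV linear_add[OF l(1)] sym)
  qed
qed

section \<open>Curves in fibre products\<close>

lemma cball_complete:
  fixes x :: "'a::real_normed_vector"
  assumes "findim TYPE('a)"
  shows "complete (cball x r)"
  by (rule compact_imp_complete[OF findim_compact_cball[OF assms]])

text \<open>A right inverse of the derivative at \<open>x\<close> remains an approximate one nearby.
  The function \<open>E\<close> dominates the operator norm of the error through coordinates; it is
  continuous and vanishes at \<open>x\<close>.\<close>

lemma near_right_inverse: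
  fixes f :: "'a::real_normed_vector \<Rightarrow> 'c::real_normed_vector"
  assumes fin: "findim TYPE('c)" and S: "open S" "x \<in> S" and f: "Cinf_on S f"
    and R: "linear R" and inv: "\<And>v. fd f x (R v) = v"
  shows "\<exists>r>0. ball x r \<subseteq> S \<and> (\<forall>p\<in>ball x r. \<forall>v. norm (fd f p (R v) - v) \<le> 1/2 * norm v)"
proof -
  obtain B :: "'c set" and c where B: "finite B" "\<And>b. b \<in> B \<Longrightarrow> bounded_linear (c b)"
    "\<And>v. (\<Sum>b\<in>B. c b v *\<^sub>R b) = v"
    using findim_coords[OF fin] by metis
  have "\<forall>b\<in>B. \<exists>K. \<forall>v. norm (c b v) \<le> norm v * K"
    using bounded_linear.bounded[OF B(2)] by blast
  from bchoice[OF this] obtain K where K: "\<And>b v. b \<in> B \<Longrightarrow> norm (c b v) \<le> norm v * K b"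
    by blast
  define E where "E p = (\<Sum>b\<in>B. K b * norm (fd f p (R b) - b))" for p
  have "continuous_on S E"
    unfolding E_def
    by (intro continuous_intros Cinf_on_continuous[OF Cinf_on_fd[OF f]])
  then have "isCont E x" using S by (simp add: continuous_on_eq_continuous_at)
  moreover have "E x = 0" by (simp add: E_def inv)
  ultimately obtain d where d: "d > 0" "\<And>p. dist p x < d \<Longrightarrow> dist (E p) 0 < 1/2"
    unfolding continuous_at_eps_delta by (metis half_gt_zero zero_less_one)
  obtain d2 where d2: "d2 > 0" "ball x d2 \<subseteq> S"
    using S openE by blast
  have "norm (fd f p (R v) - v) \<le> 1/2 * norm v" if p: "p \<in> ball x (min d d2)" for p v
  proof -
    have pS: "p \<in> S" using p d2 by auto
    have l: "linear (\<lambda>v. fd f p (R v) - v)"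
      using linear_compose[OF R linear_frechet_derivative[OF Cinf_on_differentiable[OF f pS]]]
      by (intro linear_compose_sub) (auto simp: o_def linear_id[unfolded id_def])
    have "norm (fd f p (R v) - v) = norm (\<Sum>b\<in>B. c b v *\<^sub>R (fd f p (R b) - b))"
      by (rule arg_cong[OF linear_coord_expand[OF B l]])
    also have "\<dots> \<le> (\<Sum>b\<in>B. norm v * K b * norm (fd f p (R b) - b))"
      using K by (intro sum_norm_le) (auto intro!: mult_right_mono)
    also have "\<dots> = norm v * E p" by (simp add: E_def sum_distrib_left mult.assoc)
    also have "\<dots> \<le> norm v * (1/2)"
      using d(2)[of p] p by (intro mult_left_mono) (auto simp: dist_commute)
    finally show ?thesis by simp
  qed
  then show ?thesis
    using d d2 by (intro exI[of _ "min d d2"]) auto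
qed

text \<open>A simplified Newton iteration, with the right inverse frozen at \<open>x\<close>, is a
  contraction with constant 1/2. What matters later is the linear bound on \<open>u\<close> by the
  defect \<open>y - f z\<close>, uniformly in \<open>z\<close> and \<open>y\<close>.\<close>

lemma local_solvability:
  fixes f :: "'a::real_normed_vector \<Rightarrow> 'c::real_normed_vector"
  assumes fin: "findim TYPE('c)" and S: "open S" "x \<in> S" and f: "Cinf_on S f"
    and R: "linear R" and inv: "\<And>v. fd f x (R v) = v"
  shows "\<exists>\<delta>>0. \<forall>z y. dist z x < \<delta> \<and> dist y (f x) < \<delta> \<longrightarrow>
    (\<exists>u. norm u \<le> 2 * norm (y - f z) \<and> f (z + R u) = y)"
proof -
  obtain r where r: "r > 0" "ball x r \<subseteq> S"
    "\<And>p v. p \<in> ball x r \<Longrightarrow> norm (fd f p (R v) - v) \<le> 1/2 * norm v"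
    using near_right_inverse[OF assms] by blast
  have blR: "bounded_linear R" by (rule findim_linear_bounded[OF fin R])
  obtain K where K: "K > 0" "\<And>u. norm (R u) \<le> norm u * K"
    using bounded_linear.pos_bounded[OF blR] by blast
  \<comment> \<open>For \<open>u\<close> in the ball of radius \<rho> the displacement
    \<open>R u\<close> has norm at most \<open>r/4\<close>; with \<open>z\<close> within
    \<open>r/2\<close> of \<open>x\<close> this stays inside the ball where the derivative is
    controlled.\<close>
  define \<rho> where "\<rho> = r / (4 * K)"
  have \<rho>: "\<rho> > 0" using r(1) K(1) by (simp add: \<rho>_def)
  have "isCont f x" using Cinf_on_differentiable[OF f S(2)] by (rule differentiable_imp_continuous_within)
  then obtain d where d: "d > 0" "\<And>z. dist z x < d \<Longrightarrow> dist (f z) (f x) < \<rho> / 4"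
    unfolding continuous_at_eps_delta using \<rho> by (metis divide_pos_pos zero_less_numeral)
  define \<delta> where "\<delta> = min (min (r/2) (\<rho>/4)) d"
  have "\<exists>u. norm u \<le> 2 * norm (y - f z) \<and> f (z + R u) = y" if zy: "dist z x < \<delta>" "dist y (f x) < \<delta>" for z y
  proof -
    have small: "norm (y - f z) \<le> \<rho> / 2"
    proof -
      have "dist y (f z) \<le> dist y (f x) + dist (f z) (f x)" by (rule dist_triangle2)
      also have "\<dots> \<le> \<rho> / 4 + \<rho> / 4"
        using zy d(2)[of z] by (intro add_mono) (auto simp: \<delta>_def)
      finally show ?thesis by (simp add: dist_norm)
    qed
    have inb: "z + R u \<in> ball x r" if "u \<in> cball 0 \<rho>" for u
    proof -
      have "dist (z + R u) x \<le> dist z x + norm (R u)"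
        by (metis (no_types, opaque_lifting) add.commute add_diff_cancel dist_norm dist_triangle2 dist_commute)
      also have "\<dots> < r/2 + r/4"
      proof (rule add_less_le_mono)
        show "dist z x < r/2" using zy by (simp add: \<delta>_def)
        have "norm (R u) \<le> norm u * K" by (rule K(2))
        also have "\<dots> \<le> \<rho> * K" using that K(1) by (intro mult_right_mono) auto
        finally show "norm (R u) \<le> r/4" using K(1) by (simp add: \<rho>_def field_simps)
      qed
      finally show ?thesis using r(1) by (simp add: dist_commute)
    qed
    \<comment> \<open>Fixed points of \<phi> are exactly the solutions of
      \<open>f (z + R u) = y\<close>.\<close>
    define \<phi> where "\<phi> u = u + (y - f (z + R u))" for u
    have d\<phi>: "(\<phi> has_derivative (\<lambda>h. h - fd f (z + R u) (R h))) (at u)" if "u \<in> cball 0 \<rho>" for u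
    proof -
      have "((\<lambda>u. f (z + R u)) has_derivative (\<lambda>h. fd f (z + R u) (R h))) (at u)"
        by (rule has_derivative_compose[OF _ fd_has_derivative[OF Cinf_on_differentiable[OF f]]])
          (use inb[OF that] r(2) in \<open>auto intro!: derivative_eq_intros bounded_linear.has_derivative[OF blR]\<close>)
      then show ?thesis unfolding \<phi>_def by (auto intro!: derivative_eq_intros)
    qed
    have lip: "norm (\<phi> u - \<phi> v) \<le> 1/2 * norm (u - v)" if "u \<in> cball 0 \<rho>" "v \<in> cball 0 \<rho>" for u v
    proof (rule differentiable_bound[of "cball 0 \<rho>" \<phi> "\<lambda>u h. h - fd f (z + R u) (R h)"])
      show "onorm (\<lambda>h. h - fd f (z + R u) (R h)) \<le> 1/2" if "u \<in> cball 0 \<rho>" for u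
        by (rule onorm_bound) (use r(3)[OF inb[OF that]] in \<open>simp_all add: norm_minus_commute\<close>)
    qed (use that d\<phi> in \<open>auto intro: has_derivative_at_withinI\<close>)
    have \<phi>0: "\<phi> 0 = y - f z" using linear_0[OF R] by (simp add: \<phi>_def)
    have bound: "norm (\<phi> u) \<le> 1/2 * norm u + norm (y - f z)" if "u \<in> cball 0 \<rho>" for u
    proof -
      have "norm (\<phi> u) \<le> norm (\<phi> u - \<phi> 0) + norm (\<phi> 0)" by (metis diff_add_cancel norm_triangle_ineq)
      then show ?thesis using lip[OF that, of 0] \<rho> \<phi>0 by simp
    qed
    have "\<exists>!u\<in>cball 0 \<rho>. \<phi> u = u"
    proof (rule Banach_fix[of _ "1/2"])
      show "\<phi> ` cball 0 \<rho> \<subseteq> cball 0 \<rho>"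
      proof
        fix w assume "w \<in> \<phi> ` cball 0 \<rho>"
        then obtain u where u: "u \<in> cball 0 \<rho>" "w = \<phi> u" by blast
        then show "w \<in> cball 0 \<rho>" using bound[OF u(1)] small by simp
      qed
    qed (use lip \<rho> cball_complete[OF fin] in \<open>auto simp: dist_norm\<close>)
    then obtain u where u: "u \<in> cball 0 \<rho>" "\<phi> u = u" by blast
    then show ?thesis
      using bound[OF u(1)] by (intro exI[of _ u]) (auto simp: \<phi>_def)
  qed
  moreover have "\<delta> > 0" using r(1) \<rho> d(1) by (simp add: \<delta>_def)
  ultimately show ?thesis by blast
qed

text \<open>The straight line in direction \<open>(h, w)\<close> misses the fibre product by a
  defect \<open>e\<close> that is o(t), by tangency. \<open>local_solvability\<close> corrects the
  first component by \<open>R (u t)\<close> with \<open>u\<close> bounded by twice the defect, so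
  the velocity at 0 is unchanged. As differentiability is asked at 0 only, \<open>u\<close> may be
  chosen independently for each \<open>t\<close>.\<close>

lemma fibre_product_curve:
  fixes s :: "'a::real_normed_vector \<Rightarrow> 'c::real_normed_vector" and q :: "'b::real_normed_vector \<Rightarrow> 'c"
  assumes fin: "findim TYPE('c)" and S: "open S" "x \<in> S" and s: "Cinf_on S s"
    and surj: "surj (fd s x)" and q: "q differentiable (at y)" and eq: "q y = s x"
    and tangent: "fd s x h = fd q y w" and Om: "open \<Omega>" "(x, y) \<in> \<Omega>"
  obtains c :: "real \<Rightarrow> 'a \<times> 'b" where "c 0 = (x, y)" "(c has_vector_derivative (h, w)) (at 0)"
    "\<And>t. c t \<in> \<Omega>" "\<And>t. s (fst (c t)) = q (snd (c t))"
proof -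
  have ds: "(s has_derivative fd s x) (at x)"
    by (rule fd_has_derivative[OF Cinf_on_differentiable[OF s S(2)]])
  have dq: "(q has_derivative fd q y) (at y)"
    by (rule fd_has_derivative[OF q])
  obtain R where R: "linear R" "fd s x \<circ> R = id"
    using linear_surjective_right_inverse[OF has_derivative_linear[OF ds] surj] by blast
  have inv: "fd s x (R v) = v" for v
    using R(2) by (metis comp_apply id_apply)
  obtain \<delta> where \<delta>: "\<delta> > 0"
    "\<And>z v. dist z x < \<delta> \<Longrightarrow> dist v (s x) < \<delta> \<Longrightarrow> \<exists>u. norm u \<le> 2 * norm (v - s z) \<and> s (z + R u) = v"
    using local_solvability[OF fin S s R(1) inv] by blast
  define e where "e t = q (y + t *\<^sub>R w) - s (x + t *\<^sub>R h)" for t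
  have dq': "((\<lambda>t. q (y + t *\<^sub>R w)) has_derivative (\<lambda>k. fd q y (k *\<^sub>R w))) (at 0)"
    by (rule has_derivative_compose[where g=q]) (use dq in \<open>auto intro!: derivative_eq_intros\<close>)
  have ds': "((\<lambda>t. s (x + t *\<^sub>R h)) has_derivative (\<lambda>k. fd s x (k *\<^sub>R h))) (at 0)"
    by (rule has_derivative_compose[where g=s]) (use ds in \<open>auto intro!: derivative_eq_intros\<close>)
  have de: "(e has_derivative (\<lambda>k. 0)) (at 0)"
    unfolding e_def using has_derivative_diff[OF dq' ds'] tangent
    by (simp add: linear_scale[OF has_derivative_linear[OF ds]] linear_scale[OF has_derivative_linear[OF dq]])
  have e0: "e 0 = 0" by (simp add: e_def eq)
  define good where "good t \<longleftrightarrow> dist (x + t *\<^sub>R h) x < \<delta> \<and> dist (q (y + t *\<^sub>R w)) (s x) < \<delta>" for t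
  \<comment> \<open>The default 0 keeps the bound on \<open>u t\<close> valid for all
    \<open>t\<close>, also where the equation is not known to be solvable.\<close>
  define u where "u t = (if good t then (SOME u. norm u \<le> 2 * norm (e t) \<and> s (x + t *\<^sub>R h + R u) = q (y + t *\<^sub>R w)) else 0)" for t
  have u: "norm (u t) \<le> 2 * norm (e t)" "good t \<Longrightarrow> s (x + t *\<^sub>R h + R (u t)) = q (y + t *\<^sub>R w)" for t
  proof -
    have "\<exists>u. norm u \<le> 2 * norm (e t) \<and> s (x + t *\<^sub>R h + R u) = q (y + t *\<^sub>R w)" if "good t"
      using \<delta>(2)[of "x + t *\<^sub>R h" "q (y + t *\<^sub>R w)"] that by (auto simp: good_def e_def)
    from someI_ex[OF this]
    show "norm (u t) \<le> 2 * norm (e t)" "good t \<Longrightarrow> s (x + t *\<^sub>R h + R (u t)) = q (y + t *\<^sub>R w)"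
      by (auto simp: u_def)
  qed
  have u0: "u 0 = 0" using u(1)[of 0] by (simp add: e0)
  have du: "(u has_derivative (\<lambda>k. 0)) (at 0)"
  proof -
    have "((\<lambda>t. e t /\<^sub>R norm t) \<longlongrightarrow> 0) (at 0)"
      using de by (simp add: has_derivative_at_within e0)
    then have "((\<lambda>t. 2 * norm (e t /\<^sub>R norm t)) \<longlongrightarrow> 0) (at 0)"
      by (intro tendsto_mult_right_zero tendsto_norm_zero)
    then have "((\<lambda>t. u t /\<^sub>R norm t) \<longlongrightarrow> 0) (at 0)"
      by (rule Lim_null_comparison[rotated])
        (use u(1) in \<open>auto intro!: always_eventually simp: field_simps divide_simps\<close>)
    then show ?thesis by (simp add: has_derivative_at_within u0)
  qed
  have blR: "bounded_linear R" by (rule findim_linear_bounded[OF fin R(1)])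
  define c0 where "c0 t = (x + t *\<^sub>R h + R (u t), y + t *\<^sub>R w)" for t
  have dc0: "(c0 has_derivative (\<lambda>k. k *\<^sub>R (h, w))) (at 0)"
    unfolding c0_def
    by (auto intro!: derivative_eq_intros bounded_linear.has_derivative[OF blR] du simp: linear_0[OF R(1)])
  have c00: "c0 0 = (x, y)" by (simp add: c0_def u0 linear_0[OF R(1)])
  have "isCont c0 0" using dc0 by (rule has_derivative_continuous)
  then have "(c0 \<longlongrightarrow> (x, y)) (at 0)" by (simp add: isCont_def c00)
  then have ev1: "\<forall>\<^sub>F t in nhds 0. c0 t \<in> \<Omega>"
    using Om c00 by (simp add: eventually_at_filter[symmetric] tendsto_def eventually_nhds_conv_at)
  have cont: "isCont (\<lambda>t. x + t *\<^sub>R h) 0" "isCont (\<lambda>t. q (y + t *\<^sub>R w)) 0"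
    by (auto intro!: continuous_intros has_derivative_continuous[OF dq'])
  have ev2: "\<forall>\<^sub>F t in nhds 0. good t"
    unfolding good_def
  proof (rule eventually_conj)
    show "\<forall>\<^sub>F t in nhds 0. dist (x + t *\<^sub>R h) x < \<delta>"
      using tendstoD[OF cont(1)[unfolded isCont_def] \<delta>(1)] \<delta>(1) by (simp add: eventually_nhds_conv_at)
    show "\<forall>\<^sub>F t in nhds 0. dist (q (y + t *\<^sub>R w)) (s x) < \<delta>"
      using tendstoD[OF cont(2)[unfolded isCont_def] \<delta>(1)] \<delta>(1) by (simp add: eventually_nhds_conv_at eq)
  qed
  obtain N where N: "open N" "0 \<in> N" "\<And>t. t \<in> N \<Longrightarrow> c0 t \<in> \<Omega> \<and> good t"
    using eventually_conj[OF ev1 ev2] unfolding eventually_nhds by blast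
  \<comment> \<open>Being constant off \<open>N\<close>, the curve lies in \<Omega> and on the fibre
    product for every \<open>t\<close>; the derivative at 0 only sees \<open>N\<close>.\<close>
  define c where "c t = (if t \<in> N then c0 t else (x, y))" for t
  show ?thesis
  proof (rule that[of c])
    show "c 0 = (x, y)" by (simp add: c_def c00)
    show "(c has_vector_derivative (h, w)) (at 0)"
      unfolding has_vector_derivative_def
      by (rule has_derivative_transform_within_open[OF dc0 N(1,2)]) (simp add: c_def)
    show "c t \<in> \<Omega>" for t using N Om by (simp add: c_def)
    show "s (fst (c t)) = q (snd (c t))" for t
      using N(3)[of t] u(2)[of t] eq by (auto simp: c_def c0_def)
  qed
qed

text \<open>Vectors tangent to a fibre product have well-defined images under derivatives within it.\<close>

lemma fibre_product_derivative_unique: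
  fixes s :: "'a::real_normed_vector \<Rightarrow> 'c::real_normed_vector" and q :: "'b::real_normed_vector \<Rightarrow> 'c"
  assumes fin: "findim TYPE('c)" and S: "open S" "x \<in> S" and s: "Cinf_on S s"
    and surj: "surj (fd s x)" and q: "q differentiable (at y)" and eq: "q y = s x"
    and tangent: "fd s x h = fd q y w" and Om: "open \<Omega>" "(x, y) \<in> \<Omega>"
    and g: "(g has_derivative G) (at (x, y) within C)" and g2: "(g2 has_derivative G2) (at (x, y) within C2)"
    and CC: "\<And>a b. (a, b) \<in> \<Omega> \<Longrightarrow> s a = q b \<Longrightarrow> (a, b) \<in> C \<and> (a, b) \<in> C2 \<and> g (a, b) = g2 (a, b)"
  shows "G (h, w) = G2 (h, w)"
proof -
  obtain c :: "real \<Rightarrow> 'a \<times> 'b" where c: "c 0 = (x, y)" "(c has_vector_derivative (h, w)) (at 0)"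
    "\<And>t. c t \<in> \<Omega>" "\<And>t. s (fst (c t)) = q (snd (c t))"
    using fibre_product_curve[OF fin S s surj q eq tangent Om] by blast
  have cc: "c t \<in> C" "c t \<in> C2" "g (c t) = g2 (c t)" for t
    using CC[of "fst (c t)" "snd (c t)"] c(3,4)[of t] by auto
  have "((g \<circ> c) has_vector_derivative G (h, w)) (at 0 within UNIV)"
    by (rule vector_derivative_diff_chain_within) (use c cc in \<open>auto intro: has_derivative_subset[OF g]\<close>)
  moreover have "((g2 \<circ> c) has_vector_derivative G2 (h, w)) (at 0 within UNIV)"
    by (rule vector_derivative_diff_chain_within) (use c cc in \<open>auto intro: has_derivative_subset[OF g2]\<close>)
  moreover have "g \<circ> c = g2 \<circ> c" using cc by auto
  ultimately show ?thesis
    using vector_derivative_unique_at by fastforce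
qed

section \<open>Bump functions\<close>

text \<open>The polynomial factor in 1/t makes the family closed under differentiation: with X the
  indeterminate, \<open>p\<close> passes to X^2 (p - p').\<close>

definition flat_exp :: "real poly \<Rightarrow> real \<Rightarrow> real" where
  "flat_exp p t = (if t > 0 then poly p (inverse t) * exp (- inverse t) else 0)"

lemma flat_exp_tendsto_0: "(flat_exp p \<longlongrightarrow> 0) (at 0)"
proof -
  have "((\<lambda>x. \<Sum>i\<le>degree p. coeff p i * (x ^ i / exp x)) \<longlongrightarrow> (\<Sum>i\<le>degree p. coeff p i * 0)) at_top"
    by (intro tendsto_sum tendsto_mult tendsto_const tendsto_power_div_exp_0)
  then have "((\<lambda>x. poly p x * exp (- x)) \<longlongrightarrow> 0) at_top"
    by (simp add: poly_altdef sum_divide_distrib exp_minus divide_inverse[symmetric])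
  then have "((\<lambda>t. poly p (inverse t) * exp (- inverse t)) \<longlongrightarrow> 0) (at_right 0)"
    by (rule filterlim_compose[OF _ filterlim_inverse_at_top_right])
  then have "(flat_exp p \<longlongrightarrow> 0) (at_right 0)"
    by (rule Lim_transform_eventually)
      (auto simp: flat_exp_def eventually_at_right_field intro!: exI[of _ 1])
  moreover have "(flat_exp p \<longlongrightarrow> 0) (at_left 0)"
    by (rule Lim_transform_eventually[OF tendsto_const])
      (auto simp: flat_exp_def eventually_at_left_field intro!: exI[of _ "-1"])
  ultimately show ?thesis by (simp add: filterlim_split_at)
qed

text \<open>Away from 0 this is calculus on either side. At 0 the difference quotient is again a
  member of the family, with \<open>p\<close> multiplied by the indeterminate, and so tends to
  0.\<close>

lemma flat_exp_has_derivative: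
  "(flat_exp p has_real_derivative flat_exp (monom 1 2 * (p - pderiv p)) t) (at t)"
proof -
  consider "t > 0" | "t < 0" | "t = 0" by linarith
  then show ?thesis
  proof cases
    case 1
    have "((\<lambda>t. poly p (inverse t) * exp (- inverse t)) has_real_derivative
        flat_exp (monom 1 2 * (p - pderiv p)) t) (at t)"
      using 1 by (auto intro!: derivative_eq_intros DERIV_chain2[OF poly_DERIV]
          simp: flat_exp_def poly_monom power2_eq_square algebra_simps)
    then show ?thesis
      by (rule DERIV_cong_ev[OF refl _ refl, THEN iffD1, rotated])
        (use 1 in \<open>auto simp: flat_exp_def eventually_nhds intro!: exI[of _ "{0<..}"]\<close>)
  next
    case 2
    have "((\<lambda>t. 0) has_real_derivative 0) (at t)" by simp
    then have "(flat_exp p has_real_derivative 0) (at t)"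
      by (rule DERIV_cong_ev[OF refl _ refl, THEN iffD1, rotated])
        (use 2 in \<open>auto simp: flat_exp_def eventually_nhds intro!: exI[of _ "{..<0}"]\<close>)
    then show ?thesis using 2 by (simp add: flat_exp_def)
  next
    case 3
    have "((\<lambda>h. flat_exp p h / h) \<longlongrightarrow> 0) (at 0)"
      by (rule Lim_transform_eventually[OF flat_exp_tendsto_0[of "pCons 0 p"]])
        (auto simp: flat_exp_def eventually_at_filter field_simps)
    then show ?thesis using 3 by (simp add: DERIV_def flat_exp_def)
  qed
qed

lemma Cinf_on_flat_exp: "Cinf_on UNIV (flat_exp p)"
proof -
  have "Ck_on k UNIV (flat_exp p)" for k
  proof (induction k arbitrary: p)
    case 0
    then show ?case
      using flat_exp_has_derivative[of p] by (auto intro!: continuous_at_imp_continuous_on DERIV_isCont)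
  next
    case (Suc k)
    have d: "(flat_exp p has_derivative (*) (flat_exp (monom 1 2 * (p - pderiv p)) t)) (at t)" for t
      using flat_exp_has_derivative[of p t] by (simp add: has_field_derivative_def)
    have "Ck_on k UNIV (\<lambda>t. flat_exp (monom 1 2 * (p - pderiv p)) t * v)" for v
      by (rule Ck_on_linear_compose[OF open_UNIV bounded_linear_mult_left Suc])
    then show ?case using d by (auto simp: fd_eq[OF d] intro: differentiableI[OF d])
  qed
  then show ?thesis by (simp add: Cinf_on_def)
qed

text \<open>The squared distance is replaced by the sum \<open>q\<close> of squared coordinates,
  since a general norm need not be smooth away from 0.\<close>

lemma bump_exists:
  fixes y0 :: "'a::real_normed_vector"
  assumes fin: "findim TYPE('a)" and S: "open S" "y0 \<in> S"
  shows "\<exists>(\<rho> :: 'a \<Rightarrow> real) K. Cinf_on UNIV \<rho> \<and> \<rho> y0 = 1 \<and> compact K \<and> K \<subseteq> S \<and> (\<forall>y. y \<notin> K \<longrightarrow> \<rho> y = 0)"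
proof -
  obtain B :: "'a set" and c where B: "finite B" "\<And>b. b \<in> B \<Longrightarrow> bounded_linear (c b)"
    "\<And>v. (\<Sum>b\<in>B. c b v *\<^sub>R b) = v"
    using findim_coords[OF fin] by metis
  obtain d where d: "d > 0" "cball y0 d \<subseteq> S"
    using S open_contains_cball by blast
  \<comment> \<open>Coordinates bounded by \<open>r\<close> give a vector of norm at most
    \<open>r * N\<close>, so \<open>r = d / N\<close> confines the support to the ball of radius
    \<open>d\<close>.\<close>
  define N where "N = (\<Sum>b\<in>B. norm b) + 1"
  have N: "N > 0" unfolding N_def by (intro add_nonneg_pos sum_nonneg) auto
  define r where "r = d / N"
  have r: "r > 0" using d N by (simp add: r_def)
  define q where "q y = (\<Sum>b\<in>B. c b (y - y0) * c b (y - y0))" for y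
  \<comment> \<open>The exponential factor normalises the value at \<open>y0\<close>, where
    \<open>q\<close> is 0, to 1.\<close>
  define \<rho> where "\<rho> y = exp (inverse (r\<^sup>2)) * flat_exp 1 (r\<^sup>2 - q y)" for y
  have sub: "Cinf_on UNIV (\<lambda>y. y - y0)"
    by (intro Cinf_on_diff Cinf_on_id Cinf_on_const open_UNIV)
  have q: "Cinf_on UNIV q"
    unfolding q_def
    by (intro Cinf_on_sum Cinf_on_bilinear[OF bounded_bilinear_mult] Cinf_on_linear_compose[OF _ B(2)] sub open_UNIV)
  have fR: "findim TYPE(real)"
    unfolding findim_def by (rule exI[of _ "{1}"]) (auto simp: span_singleton)
  have "Cinf_on UNIV (\<lambda>y. flat_exp 1 (r\<^sup>2 - q y))"
    by (rule Cinf_on_compose[OF fR open_UNIV open_UNIV _ _ Cinf_on_flat_exp])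
      (intro Cinf_on_diff Cinf_on_const q open_UNIV, simp)
  then have \<rho>: "Cinf_on UNIV \<rho>"
    unfolding \<rho>_def by (intro Cinf_on_linear_compose[OF open_UNIV bounded_linear_mult_right])
  have "c b 0 = 0" if "b \<in> B" for b
    by (rule linear_0[OF bounded_linear.linear[OF B(2)[OF that]]])
  then have "q y0 = 0" by (simp add: q_def)
  then have \<rho>1: "\<rho> y0 = 1"
    using r by (simp add: \<rho>_def flat_exp_def exp_add[symmetric])
  have "\<rho> y = 0" if y: "y \<notin> cball y0 d" for y
  proof -
    have "\<not> (q y < r\<^sup>2)"
    proof
      assume lt: "q y < r\<^sup>2"
      have cb: "\<bar>c b (y - y0)\<bar> \<le> r" if b: "b \<in> B" for b
      proof -
        have "c b (y - y0) * c b (y - y0) \<le> q y"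
          unfolding q_def using b B(1) by (intro member_le_sum) auto
        then have "\<bar>c b (y - y0)\<bar>\<^sup>2 \<le> r\<^sup>2" using lt by (simp add: power2_eq_square)
        then show ?thesis by (rule power2_le_imp_le) (use r in simp)
      qed
      have "norm (y - y0) = norm (\<Sum>b\<in>B. c b (y - y0) *\<^sub>R b)" by (simp only: B(3))
      also have "\<dots> \<le> (\<Sum>b\<in>B. r * norm b)"
        by (intro sum_norm_le) (auto intro!: mult_right_mono cb)
      also have "\<dots> \<le> r * N" using r by (simp add: N_def sum_distrib_left[symmetric])
      also have "\<dots> = d" using N by (simp add: r_def)
      finally show False using y by (simp add: dist_norm norm_minus_commute)
    qed
    then show ?thesis by (simp add: \<rho>_def flat_exp_def)
  qed
  then show ?thesis
    using \<rho> \<rho>1 findim_compact_cball[OF fin, of y0 d] d(2) by (intro exI[of _ \<rho>] exI[of _ "cball y0 d"]) auto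
qed

section \<open>Charts and tangent maps\<close>

lemma smooth_manifold_findim:
  fixes M :: "('a::{t2_space, second_countable_topology}, 'e::real_normed_vector) charted"
  shows "smooth_manifold M \<Longrightarrow> findim TYPE('e)"
  by (simp add: smooth_manifold_def findim_def)

lemma smooth_manifold_is_chart: "smooth_manifold M \<Longrightarrow> c \<in> atlas M \<Longrightarrow> is_chart c"
  by (simp add: smooth_manifold_def)

lemma chart_at_atlas: "smooth_manifold M \<Longrightarrow> chart_at M x \<in> atlas M"
  by (simp add: smooth_manifold_def)

lemma chart_at_dom: "smooth_manifold M \<Longrightarrow> x \<in> chart_dom (chart_at M x)"
  by (simp add: smooth_manifold_def)

lemma chart_open_dom: "is_chart c \<Longrightarrow> open (chart_dom c)"
  by (simp add: is_chart_def)

lemma chart_inv_map: "is_chart c \<Longrightarrow> x \<in> chart_dom c \<Longrightarrow> chart_inv c (chart_map c x) = x"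
  by (auto simp: is_chart_def homeomorphism_def)

lemma chart_continuous: "is_chart c \<Longrightarrow> continuous_on (chart_dom c) (chart_map c)"
  by (auto simp: is_chart_def homeomorphism_def)

lemma chart_inv_continuous: "is_chart c \<Longrightarrow> continuous_on (chart_map c ` chart_dom c) (chart_inv c)"
  by (auto simp: is_chart_def homeomorphism_def)

lemma chart_image_eq:
  "is_chart c \<Longrightarrow> chart_map c ` (U \<inter> chart_dom c) = chart_map c ` chart_dom c \<inter> chart_inv c -` U"
  using chart_inv_map by fastforce

lemma chart_open_image:
  assumes "is_chart c" "open U"
  shows "open (chart_map c ` (U \<inter> chart_dom c))"
  unfolding chart_image_eq[OF assms(1)]
  using continuous_open_preimage[OF chart_inv_continuous[OF assms(1)] _ assms(2)] assms(1)
  by (simp add: is_chart_def)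

lemma chart_open_image_sub:
  assumes "is_chart c" "open U" "U \<subseteq> chart_dom c"
  shows "open (chart_map c ` U)"
  using chart_open_image[OF assms(1,2)] assms(3) by (simp add: Int_absorb2)

section \<open>Local representatives of smooth maps\<close>

abbreviation lrep :: "('a, 'e) chart \<Rightarrow> ('b, 'f) chart \<Rightarrow> ('a \<Rightarrow> 'b) \<Rightarrow> 'e \<Rightarrow> 'f" where
  "lrep c d f \<equiv> chart_map d \<circ> f \<circ> chart_inv c"

lemma lrep_apply: "is_chart c \<Longrightarrow> x \<in> chart_dom c \<Longrightarrow> lrep c d f (chart_map c x) = chart_map d (f x)"
  by (simp add: chart_inv_map)

lemma smooth_open_open: "smooth_open M N U f \<Longrightarrow> open U"
  by (simp add: smooth_open_def)

lemma smooth_open_preimage: "smooth_open M N U f \<Longrightarrow> open W \<Longrightarrow> open (U \<inter> f -` W)"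
  unfolding smooth_open_def by (metis continuous_open_preimage)

lemma smooth_open_lrep:
  "smooth_open M N U f \<Longrightarrow> c \<in> atlas M \<Longrightarrow> d \<in> atlas N \<Longrightarrow>
    Cinf_on (chart_map c ` (U \<inter> chart_dom c \<inter> f -` chart_dom d)) (lrep c d f)"
  by (simp add: smooth_open_def)

lemma lrep_domain_open:
  assumes "smooth_open M N U f" "is_chart c" "is_chart d"
  shows "open (chart_map c ` (U \<inter> chart_dom c \<inter> f -` chart_dom d))"
proof -
  have "open ((U \<inter> f -` chart_dom d) \<inter> chart_dom c)"
    by (intro open_Int smooth_open_preimage[OF assms(1)] chart_open_dom assms)
  then have "open (chart_map c ` ((U \<inter> f -` chart_dom d) \<inter> chart_dom c))"
    by (intro chart_open_image_sub assms) auto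
  then show ?thesis by (simp add: Int_ac)
qed

text \<open>On an open \<open>U\<close> each local extension coincides with \<open>f\<close> on the
  open set \<open>U \<inter> W\<close>, and both continuity and smoothness in charts are local. This
  turns \<open>smooth_map_on\<close> into \<open>smooth_open\<close> on open sets.\<close>

lemma smooth_openI:
  assumes M: "smooth_manifold M" and N: "smooth_manifold N" and U: "open U"
    and loc: "\<And>x. x \<in> U \<Longrightarrow> \<exists>W F. x \<in> W \<and> smooth_open M N W F \<and> (\<forall>y\<in>U \<inter> W. F y = f y)"
  shows "smooth_open M N U f"
proof -
  have cont: "continuous_on U f"
  proof (rule continuous_at_imp_continuous_on, rule ballI)
    fix x assume x: "x \<in> U"
    then obtain W F where W: "x \<in> W" "smooth_open M N W F" "\<forall>y\<in>U \<inter> W. F y = f y"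
      using loc by blast
    have o: "open (U \<inter> W)" using U smooth_open_open[OF W(2)] by auto
    have "continuous_on (U \<inter> W) F"
      using W(2) by (auto simp: smooth_open_def intro: continuous_on_subset)
    then have "continuous_on (U \<inter> W) f" by (rule continuous_on_eq) (use W(3) in blast)
    then show "isCont f x" using o x W(1) by (simp add: continuous_on_eq_continuous_at)
  qed
  have "Cinf_on (chart_map c ` (U \<inter> chart_dom c \<inter> f -` chart_dom d)) (lrep c d f)"
    if c: "c \<in> atlas M" and d: "d \<in> atlas N" for c d
  proof (rule Cinf_on_local)
    have isc: "is_chart c" "is_chart d" using M N c d by (auto intro: smooth_manifold_is_chart)
    fix y assume "y \<in> chart_map c ` (U \<inter> chart_dom c \<inter> f -` chart_dom d)"
    then obtain x where x: "x \<in> U" "x \<in> chart_dom c" "f x \<in> chart_dom d" "y = chart_map c x"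
      by auto
    obtain W F where W: "x \<in> W" "smooth_open M N W F" "\<forall>y\<in>U \<inter> W. F y = f y"
      using loc[OF x(1)] by blast
    let ?D = "U \<inter> (W \<inter> F -` chart_dom d) \<inter> chart_dom c"
    have oD: "open ?D"
      by (intro open_Int U smooth_open_preimage[OF W(2)] chart_open_dom isc)
    have o: "open (chart_map c ` ?D)"
      using oD isc(1) by (intro chart_open_image_sub) auto
    have "Cinf_on (chart_map c ` ?D) (lrep c d F)"
      by (rule Cinf_on_subset[OF smooth_open_lrep[OF W(2) c d]]) auto
    then have "Cinf_on (chart_map c ` ?D) (lrep c d f)"
      by (rule Cinf_on_cong[OF o, rotated]) (use W(3) in \<open>auto simp: chart_inv_map[OF isc(1)]\<close>)
    moreover have "y \<in> chart_map c ` ?D" using x W by auto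
    ultimately show "\<exists>U. open U \<and> y \<in> U \<and> Cinf_on U (lrep c d f)" using o by blast
  qed
  then show ?thesis using U cont by (simp add: smooth_open_def)
qed

lemma smooth_map_on_open:
  assumes "smooth_manifold M" "smooth_manifold N" "open U" "smooth_map_on M N U f"
  shows "smooth_open M N U f"
  using assms(4) by (intro smooth_openI assms) (auto simp: smooth_map_on_def)

lemma smooth_open_subset:
  assumes "smooth_open M N U f" "open W" "W \<subseteq> U"
  shows "smooth_open M N W f"
proof -
  have "Cinf_on (chart_map c ` (W \<inter> chart_dom c \<inter> f -` chart_dom d)) (lrep c d f)"
    if "c \<in> atlas M" "d \<in> atlas N" for c d
    by (rule Cinf_on_subset[OF smooth_open_lrep[OF assms(1) that]]) (use assms(3) in blast)
  moreover have "continuous_on W f"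
    using assms(1,3) by (auto simp: smooth_open_def intro: continuous_on_subset)
  ultimately show ?thesis using assms(2) by (simp add: smooth_open_def)
qed

lemma smooth_open_id:
  assumes "smooth_manifold M"
  shows "smooth_open M M UNIV (\<lambda>x. x)"
proof -
  have "chart_dom c \<inter> (\<lambda>x. x) -` chart_dom d = chart_dom c \<inter> chart_dom d" for c d :: "('a, 'b) chart"
    by auto
  then show ?thesis using assms by (auto simp: smooth_open_def smooth_manifold_def comp_def)
qed

lemma smooth_open_const:
  assumes "smooth_manifold M" "open U"
  shows "smooth_open M N U (\<lambda>x. b)"
  using assms by (auto simp: smooth_open_def comp_def Cinf_on_const)

lemma smooth_open_compose:
  assumes M: "smooth_manifold M" and N: "smooth_manifold N" and L: "smooth_manifold L"
    and f: "smooth_open M N U f" and g: "smooth_open N L W g" and fW: "\<And>x. x \<in> U \<Longrightarrow> f x \<in> W"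
  shows "smooth_open M L U (\<lambda>x. g (f x))"
proof -
  have U: "open U" by (rule smooth_open_open[OF f])
  have cont: "continuous_on U (\<lambda>x. g (f x))"
    by (rule continuous_on_compose2[of W g]) (use f g fW in \<open>auto simp: smooth_open_def\<close>)
  have "Cinf_on (chart_map c ` (U \<inter> chart_dom c \<inter> (\<lambda>x. g (f x)) -` chart_dom e)) (lrep c e (\<lambda>x. g (f x)))"
    if c: "c \<in> atlas M" and e: "e \<in> atlas L" for c e
  proof (rule Cinf_on_local)
    have isc: "is_chart c" "is_chart e" using M L c e by (auto intro: smooth_manifold_is_chart)
    fix y assume "y \<in> chart_map c ` (U \<inter> chart_dom c \<inter> (\<lambda>x. g (f x)) -` chart_dom e)"
    then obtain x where x: "x \<in> U" "x \<in> chart_dom c" "g (f x) \<in> chart_dom e" "y = chart_map c x"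
      by auto
    let ?d = "chart_at N (f x)"
    have d: "?d \<in> atlas N" "is_chart ?d" "f x \<in> chart_dom ?d"
      using N by (auto intro: chart_at_atlas chart_at_dom smooth_manifold_is_chart)
    let ?T = "W \<inter> chart_dom ?d \<inter> g -` chart_dom e"
    have oT: "open ?T" using open_Int[OF smooth_open_preimage[OF g chart_open_dom[OF isc(2)]] chart_open_dom[OF d(2)]]
      by (simp add: Int_ac)
    have oT': "open (chart_map ?d ` ?T)" by (intro chart_open_image_sub d oT) auto
    let ?D = "(U \<inter> f -` ?T) \<inter> chart_dom c"
    have o: "open (chart_map c ` ?D)"
      by (intro chart_open_image_sub isc open_Int smooth_open_preimage[OF f oT] chart_open_dom) auto
    have "Cinf_on (chart_map c ` ?D) (\<lambda>y. lrep ?d e g (lrep c ?d f y))"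
    proof (rule Cinf_on_compose[OF smooth_manifold_findim[OF N] o oT'])
      show "Cinf_on (chart_map c ` ?D) (lrep c ?d f)"
        by (rule Cinf_on_subset[OF smooth_open_lrep[OF f c d(1)]]) auto
      show "Cinf_on (chart_map ?d ` ?T) (lrep ?d e g)"
        by (rule smooth_open_lrep[OF g d(1) e])
    qed (auto simp: chart_inv_map[OF isc(1)])
    then have "Cinf_on (chart_map c ` ?D) (lrep c e (\<lambda>x. g (f x)))"
      by (rule Cinf_on_cong[OF o, rotated]) (auto simp: chart_inv_map[OF isc(1)] chart_inv_map[OF d(2)])
    moreover have "y \<in> chart_map c ` ?D" using x d fW by auto
    ultimately show "\<exists>U. open U \<and> y \<in> U \<and> Cinf_on U (lrep c e (\<lambda>x. g (f x)))" using o by blast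
  qed
  then show ?thesis using U cont by (simp add: smooth_open_def)
qed

lemma lrep_differentiable:
  fixes M :: "('a::{t2_space, second_countable_topology}, 'e::real_normed_vector) charted"
    and N :: "('b::{t2_space, second_countable_topology}, 'f::real_normed_vector) charted"
  assumes "smooth_open M N U f" "c \<in> atlas M" "d \<in> atlas N" "x \<in> U" "x \<in> chart_dom c" "f x \<in> chart_dom d"
  shows "lrep c d f differentiable (at (chart_map c x))"
  by (rule Cinf_on_differentiable[OF smooth_open_lrep[OF assms(1-3)]]) (use assms in auto)

text \<open>The chain rule with free choice of charts at all three stages. With identity maps for
  \<open>f\<close> or \<open>g\<close> it also contains every rule for changing tangent
  coordinates.\<close>

lemma fd_lrep_compose:
  fixes M :: "('a::{t2_space, second_countable_topology}, 'e::real_normed_vector) charted"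
    and N :: "('b::{t2_space, second_countable_topology}, 'f::real_normed_vector) charted"
    and L :: "('c::{t2_space, second_countable_topology}, 'h::real_normed_vector) charted"
  assumes M: "smooth_manifold M" and N: "smooth_manifold N"
    and f: "smooth_open M N U f" and g: "smooth_open N L W g"
    and c: "c \<in> atlas M" "x \<in> chart_dom c" and d: "d \<in> atlas N" "f x \<in> chart_dom d"
    and e: "e \<in> atlas L" "g (f x) \<in> chart_dom e" and x: "x \<in> U" "f x \<in> W"
  shows "fd (lrep c e (\<lambda>x. g (f x))) (chart_map c x) v
    = fd (lrep d e g) (chart_map d (f x)) (fd (lrep c d f) (chart_map c x) v)"
proof -
  have isc: "is_chart c" "is_chart d" using M N c d by (auto intro: smooth_manifold_is_chart)
  have df: "lrep c d f differentiable (at (chart_map c x))"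
    by (rule lrep_differentiable[OF f c(1) d(1) x(1) c(2) d(2)])
  have dg: "lrep d e g differentiable (at (lrep c d f (chart_map c x)))"
    unfolding lrep_apply[OF isc(1) c(2)] by (rule lrep_differentiable[OF g d(1) e(1) x(2) d(2) e(2)])
  let ?D = "(U \<inter> f -` chart_dom d) \<inter> chart_dom c"
  have o: "open (chart_map c ` ?D)"
    by (intro chart_open_image_sub isc open_Int smooth_open_preimage[OF f] chart_open_dom) auto
  have "fd (lrep c e (\<lambda>x. g (f x))) (chart_map c x) = fd (\<lambda>y. lrep d e g (lrep c d f y)) (chart_map c x)"
    by (rule fd_cong_open(2)[OF fd_compose(2)[OF df dg] o])
      (use x c d in \<open>auto simp: chart_inv_map isc\<close>)
  then show ?thesis
    using fd_compose(1)[OF df dg, of v] by (simp only: lrep_apply[OF isc(1) c(2)])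
qed

lemma tmap_eq_fd:
  assumes M: "smooth_manifold M"
  shows "tmap M N f x = fd (lrep (chart_at M x) (chart_at N (f x)) f) (chart_map (chart_at M x) x)"
proof -
  have c: "is_chart (chart_at M x)" "x \<in> chart_dom (chart_at M x)"
    using M by (auto intro: chart_at_atlas chart_at_dom smooth_manifold_is_chart)
  have "open (chart_map (chart_at M x) ` (UNIV \<inter> chart_dom (chart_at M x)))"
    by (intro chart_open_image c) auto
  then show ?thesis
    unfolding tmap_within_def Let_def using c by (subst at_within_open) auto
qed

text \<open>Inverse to \<open>tcoord\<close>: from coordinates in \<open>c\<close> back to the
  preferred chart at \<open>x\<close>, by which tangent vectors are named.\<close>

definition tval ::
  "('a, 'e::real_normed_vector) charted \<Rightarrow> ('a, 'e) chart \<Rightarrow> 'a \<Rightarrow> 'e \<Rightarrow> 'e" where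
  "tval M c x = fd (chart_map (chart_at M x) \<circ> chart_inv c) (chart_map c x)"

section \<open>Changes of tangent coordinates\<close>

context
  fixes M :: "('a::{t2_space, second_countable_topology}, 'e::real_normed_vector) charted"
  assumes M: "smooth_manifold M"
begin

lemma tcoord_lrep: "tcoord M c x = fd (lrep (chart_at M x) c (\<lambda>x. x)) (chart_map (chart_at M x) x)"
  by (simp add: tcoord_def comp_def)

lemma tval_lrep: "tval M c x = fd (lrep c (chart_at M x) (\<lambda>x. x)) (chart_map c x)"
  by (simp add: tval_def comp_def)

lemma fd_lrep_self:
  assumes c: "c \<in> atlas M" "x \<in> chart_dom c"
  shows "fd (lrep c c (\<lambda>x. x)) (chart_map c x) v = v"
proof -
  have isc: "is_chart c" using M c by (auto intro: smooth_manifold_is_chart)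
  have o: "open (chart_map c ` chart_dom c)" by (intro chart_open_image_sub isc chart_open_dom) auto
  have "fd (lrep c c (\<lambda>x. x)) (chart_map c x) = fd (\<lambda>y. y) (chart_map c x)"
    by (rule fd_cong_open(2)[OF _ o]) (use c in \<open>auto simp: chart_inv_map isc\<close>)
  then show ?thesis by simp
qed

lemma tcoord_linear: "c \<in> atlas M \<Longrightarrow> x \<in> chart_dom c \<Longrightarrow> linear (tcoord M c x)"
  unfolding tcoord_lrep
  by (rule linear_frechet_derivative[OF lrep_differentiable[OF smooth_open_id[OF M]]])
    (auto simp: M chart_at_atlas chart_at_dom)

lemma tval_linear: "c \<in> atlas M \<Longrightarrow> x \<in> chart_dom c \<Longrightarrow> linear (tval M c x)"
  unfolding tval_lrep
  by (rule linear_frechet_derivative[OF lrep_differentiable[OF smooth_open_id[OF M]]])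
    (auto simp: M chart_at_atlas chart_at_dom)

lemma fd_lrep_trans:
  assumes "c \<in> atlas M" "x \<in> chart_dom c" "d \<in> atlas M" "x \<in> chart_dom d" "e \<in> atlas M" "x \<in> chart_dom e"
  shows "fd (lrep d e (\<lambda>x. x)) (chart_map d x) (fd (lrep c d (\<lambda>x. x)) (chart_map c x) v)
    = fd (lrep c e (\<lambda>x. x)) (chart_map c x) v"
  using fd_lrep_compose[OF M M smooth_open_id[OF M] smooth_open_id[OF M] assms] by simp

lemma tcoord_tval: "c \<in> atlas M \<Longrightarrow> x \<in> chart_dom c \<Longrightarrow> tcoord M c x (tval M c x e) = e"
  unfolding tcoord_lrep tval_lrep
  by (simp add: fd_lrep_trans fd_lrep_self M chart_at_atlas chart_at_dom)

lemma tval_tcoord: "c \<in> atlas M \<Longrightarrow> x \<in> chart_dom c \<Longrightarrow> tval M c x (tcoord M c x e) = e"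
  unfolding tcoord_lrep tval_lrep
  by (simp add: fd_lrep_trans fd_lrep_self M chart_at_atlas chart_at_dom)

lemma tcoord_chart_at [simp]: "tcoord M (chart_at M x) x v = v"
  unfolding tcoord_lrep by (simp add: fd_lrep_self M chart_at_atlas chart_at_dom)

lemma tval_chart_at [simp]: "tval M (chart_at M x) x v = v"
  unfolding tval_lrep by (simp add: fd_lrep_self M chart_at_atlas chart_at_dom)

lemma tcoord_change:
  assumes "c \<in> atlas M" "x \<in> chart_dom c" "d \<in> atlas M" "x \<in> chart_dom d"
  shows "tcoord M d x v = fd (lrep c d (\<lambda>x. x)) (chart_map c x) (tcoord M c x v)"
  unfolding tcoord_lrep using assms by (simp add: fd_lrep_trans M chart_at_atlas chart_at_dom)

end

section \<open>Differentials of smooth maps\<close>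

context
  fixes M :: "('a::{t2_space, second_countable_topology}, 'e::real_normed_vector) charted"
    and N :: "('b::{t2_space, second_countable_topology}, 'f::real_normed_vector) charted"
  assumes M: "smooth_manifold M" and N: "smooth_manifold N"
begin

text \<open>Both sides represent the same differential from the preferred chart at \<open>x\<close>
  to the chart \<open>d\<close>: the left splits off a change of charts at the source, the right one
  at the target.\<close>

lemma tmap_chart:
  assumes f: "smooth_open M N U f" and x: "x \<in> U"
    and c: "c \<in> atlas M" "x \<in> chart_dom c" and d: "d \<in> atlas N" "f x \<in> chart_dom d"
  shows "fd (lrep c d f) (chart_map c x) (tcoord M c x v) = tcoord N d (f x) (tmap M N f x v)"
proof -
  note ca = chart_at_atlas[OF M, of x] chart_at_dom[OF M, of x]
  note da = chart_at_atlas[OF N, of "f x"] chart_at_dom[OF N, of "f x"]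
  have "fd (lrep c d f) (chart_map c x) (tcoord M c x v) = fd (lrep (chart_at M x) d f) (chart_map (chart_at M x) x) v"
    unfolding tcoord_lrep[OF M]
    using fd_lrep_compose[OF M M smooth_open_id[OF M] f ca c d UNIV_I x] by simp
  also have "\<dots> = tcoord N d (f x) (tmap M N f x v)"
    unfolding tcoord_lrep[OF N] tmap_eq_fd[OF M]
    using fd_lrep_compose[OF M N f smooth_open_id[OF N] ca da d x UNIV_I] by simp
  finally show ?thesis .
qed

lemma tmap_linear: "smooth_open M N U f \<Longrightarrow> x \<in> U \<Longrightarrow> linear (tmap M N f x)"
  unfolding tmap_eq_fd[OF M]
  by (rule linear_frechet_derivative[OF lrep_differentiable]) (auto simp: M N chart_at_atlas chart_at_dom)

lemma tmap_cong_open: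
  assumes f: "smooth_open M N U f" and x: "x \<in> U" and W: "open W" "x \<in> W" and eq: "\<And>y. y \<in> W \<Longrightarrow> f y = g y"
  shows "tmap M N g x = tmap M N f x"
proof -
  let ?c = "chart_at M x"
  note ca = chart_at_atlas[OF M, of x] chart_at_dom[OF M, of x]
  note isc = smooth_manifold_is_chart[OF M ca(1)]
  have gx: "g x = f x" using eq W by simp
  have o: "open (chart_map ?c ` (W \<inter> chart_dom ?c))" by (rule chart_open_image[OF isc W(1)])
  have "lrep ?c (chart_at N (f x)) f differentiable (at (chart_map ?c x))"
    by (rule lrep_differentiable[OF f ca(1) chart_at_atlas[OF N] x ca(2) chart_at_dom[OF N]])
  then show ?thesis
    unfolding tmap_eq_fd[OF M] gx
    by (rule fd_cong_open(2)[OF _ o]) (use W ca eq in \<open>auto simp: chart_inv_map isc\<close>)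
qed

lemma tmap_const: "tmap M N (\<lambda>x. b) x v = 0"
  by (simp add: tmap_eq_fd[OF M] comp_def)

end

lemma tmap_compose:
  assumes M: "smooth_manifold M" and N: "smooth_manifold N" and L: "smooth_manifold L"
    and f: "smooth_open M N U f" and g: "smooth_open N L W g" and x: "x \<in> U" "f x \<in> W"
  shows "tmap M L (\<lambda>x. g (f x)) x v = tmap N L g (f x) (tmap M N f x v)"
  unfolding tmap_eq_fd[OF M] tmap_eq_fd[OF N]
  by (rule fd_lrep_compose[OF M N f g]) (auto simp: M N L chart_at_atlas chart_at_dom x)

lemma tmap_id:
  assumes "smooth_manifold M"
  shows "tmap M M (\<lambda>x. x) x v = v"
  unfolding tmap_eq_fd[OF assms]
  by (rule fd_lrep_self[OF assms chart_at_atlas[OF assms] chart_at_dom[OF assms]])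

section \<open>Product manifolds\<close>

lemma prod_chart_inv:
  assumes "is_chart c" "is_chart d" "x \<in> chart_dom c" "y \<in> chart_dom d"
  shows "chart_inv (prod_chart c d) (chart_map c x, chart_map d y) = (x, y)"
proof -
  have inj: "inj_on (chart_map c) (chart_dom c)" "inj_on (chart_map d) (chart_dom d)"
    using assms chart_inv_map by (metis inj_onI)+
  have "inj_on (map_prod (chart_map c) (chart_map d)) (chart_dom c \<times> chart_dom d)"
    using inj by (rule map_prod_inj_on)
  from inv_into_f_f[OF this, of "(x, y)"] show ?thesis
    using assms by (simp add: chart_inv_def prod_chart_def)
qed

lemma prod_chart_dom [simp]: "chart_dom (prod_chart c d) = chart_dom c \<times> chart_dom d"
  by (simp add: prod_chart_def)

lemma prod_chart_map [simp]: "chart_map (prod_chart c d) (x, y) = (chart_map c x, chart_map d y)"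
  by (simp add: prod_chart_def)

lemma prod_chart_image: "chart_map (prod_chart c d) ` (A \<times> B) = chart_map c ` A \<times> chart_map d ` B"
  by (auto simp: prod_chart_def)

lemma prod_chart_inv':
  assumes "is_chart c" "is_chart d" "z \<in> chart_map c ` chart_dom c \<times> chart_map d ` chart_dom d"
  shows "chart_inv (prod_chart c d) z = (chart_inv c (fst z), chart_inv d (snd z))"
  using assms(3) prod_chart_inv[OF assms(1,2)] chart_inv_map[OF assms(1)] chart_inv_map[OF assms(2)] by auto

lemma prod_chart_is_chart:
  assumes c: "is_chart c" and d: "is_chart d"
  shows "is_chart (prod_chart c d)"
proof -
  let ?A = "chart_map c ` chart_dom c \<times> chart_map d ` chart_dom d"
  have im: "chart_map (prod_chart c d) ` chart_dom (prod_chart c d) = ?A"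
    by (simp add: prod_chart_image)
  have "open (chart_dom (prod_chart c d))" "open ?A"
    using c d by (auto simp: is_chart_def intro: open_Times)
  moreover have "homeomorphism (chart_dom (prod_chart c d)) ?A (chart_map (prod_chart c d)) (chart_inv (prod_chart c d))"
  proof (rule homeomorphismI)
    show "continuous_on (chart_dom (prod_chart c d)) (chart_map (prod_chart c d))"
      unfolding prod_chart_def map_prod_def
      by (auto intro!: continuous_on_Pair continuous_on_compose2[OF chart_continuous[OF c]]
          continuous_on_compose2[OF chart_continuous[OF d]] continuous_intros simp: split_def)
    have "continuous_on ?A (\<lambda>z. (chart_inv c (fst z), chart_inv d (snd z)))"
      by (auto intro!: continuous_on_Pair continuous_on_compose2[OF chart_inv_continuous[OF c]]
          continuous_on_compose2[OF chart_inv_continuous[OF d]] continuous_intros)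
    then show "continuous_on ?A (chart_inv (prod_chart c d))"
      by (rule continuous_on_eq) (simp only: prod_chart_inv'[OF c d])
    show "chart_map (prod_chart c d) ` chart_dom (prod_chart c d) \<subseteq> ?A"
      by (rule equalityD1[OF im])
    show "chart_inv (prod_chart c d) ` ?A \<subseteq> chart_dom (prod_chart c d)"
      using prod_chart_inv[OF c d] by auto
  qed (use prod_chart_inv[OF c d] in auto)
  ultimately show ?thesis unfolding is_chart_def im by blast
qed

lemma prod_mfd_atlas: "atlas (prod_mfd M N) = {prod_chart c d | c d. c \<in> atlas M \<and> d \<in> atlas N}"
  by (simp add: prod_mfd_def)

lemma prod_mfd_chart_at [simp]: "chart_at (prod_mfd M N) (x, y) = prod_chart (chart_at M x) (chart_at N y)"
  by (simp add: prod_mfd_def)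

lemma prod_chart_atlas: "c \<in> atlas M \<Longrightarrow> d \<in> atlas N \<Longrightarrow> prod_chart c d \<in> atlas (prod_mfd M N)"
  unfolding prod_mfd_atlas by blast

lemma prod_mfd_smooth_manifold:
  assumes M: "smooth_manifold M" and N: "smooth_manifold N"
  shows "smooth_manifold (prod_mfd M N)"
proof -
  note fin = smooth_manifold_findim[OF M] smooth_manifold_findim[OF N]
  have "Cinf_on (chart_map p ` (chart_dom p \<inter> chart_dom q)) (chart_map q \<circ> chart_inv p)"
    if pq: "p \<in> atlas (prod_mfd M N)" "q \<in> atlas (prod_mfd M N)" for p q
  proof -
    obtain c d c' d' where c: "c \<in> atlas M" "c' \<in> atlas M" and d: "d \<in> atlas N" "d' \<in> atlas N"
      and p: "p = prod_chart c d" and q: "q = prod_chart c' d'"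
      using pq by (auto simp: prod_mfd_atlas)
    note ic = smooth_manifold_is_chart[OF M c(1)] smooth_manifold_is_chart[OF M c(2)]
    note id = smooth_manifold_is_chart[OF N d(1)] smooth_manifold_is_chart[OF N d(2)]
    let ?A = "chart_map c ` (chart_dom c \<inter> chart_dom c')" and ?B = "chart_map d ` (chart_dom d \<inter> chart_dom d')"
    have im: "chart_map p ` (chart_dom p \<inter> chart_dom q) = ?A \<times> ?B"
      unfolding p q prod_chart_dom Times_Int_Times prod_chart_image ..
    have o: "open ?A" "open ?B"
      using chart_open_image[OF ic(1) chart_open_dom[OF ic(2)]] chart_open_image[OF id(1) chart_open_dom[OF id(2)]]
      by (simp_all add: Int_commute)
    have o2: "open (?A \<times> ?B)" using o by (rule open_Times)
    have cd: "Cinf_on ?A (chart_map c' \<circ> chart_inv c)" "Cinf_on ?B (chart_map d' \<circ> chart_inv d)"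
      using M N c d by (auto simp: smooth_manifold_def)
    have "Cinf_on (?A \<times> ?B) (\<lambda>z. ((chart_map c' \<circ> chart_inv c) (fst z), (chart_map d' \<circ> chart_inv d) (snd z)))"
      by (intro Cinf_on_Pair[OF o2] Cinf_on_compose[OF fin(1) o2 o(1) _ _ cd(1)]
          Cinf_on_compose[OF fin(2) o2 o(2) _ _ cd(2)] Cinf_on_fst[OF o2 Cinf_on_id] Cinf_on_snd[OF o2 Cinf_on_id]) auto
    then show ?thesis
      unfolding im
      by (rule Cinf_on_cong[OF o2, rotated])
        (auto simp: p q prod_chart_inv[OF ic(1) id(1)] chart_inv_map[OF ic(1)] chart_inv_map[OF id(1)])
  qed
  moreover have "is_chart p" if "p \<in> atlas (prod_mfd M N)" for p
    using that by (auto simp: prod_mfd_atlas intro: prod_chart_is_chart smooth_manifold_is_chart M N)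
  moreover have "chart_at (prod_mfd M N) z \<in> atlas (prod_mfd M N)"
    "z \<in> chart_dom (chart_at (prod_mfd M N) z)" for z
    by (cases z; simp add: prod_chart_atlas chart_at_atlas[OF M] chart_at_atlas[OF N]
        chart_at_dom[OF M] chart_at_dom[OF N])+
  ultimately show ?thesis
    using findim_prod[OF fin] unfolding smooth_manifold_def findim_def by blast
qed

context
  fixes M :: "('a::{t2_space, second_countable_topology}, 'e::real_normed_vector) charted"
    and N :: "('b::{t2_space, second_countable_topology}, 'f::real_normed_vector) charted"
    and L :: "('c::{t2_space, second_countable_topology}, 'h::real_normed_vector) charted"
  assumes M: "smooth_manifold M" and N: "smooth_manifold N" and L: "smooth_manifold L"
begin

lemma smooth_open_Pair:
  assumes f: "smooth_open L M U f" and g: "smooth_open L N U g"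
  shows "smooth_open L (prod_mfd M N) U (\<lambda>x. (f x, g x))"
proof -
  have U: "open U" by (rule smooth_open_open[OF f])
  have "continuous_on U (\<lambda>x. (f x, g x))"
    using f g by (auto simp: smooth_open_def intro: continuous_on_Pair)
  moreover have "Cinf_on (chart_map c ` (U \<inter> chart_dom c \<inter> (\<lambda>x. (f x, g x)) -` chart_dom p)) (lrep c p (\<lambda>x. (f x, g x)))"
    if c: "c \<in> atlas L" and p: "p \<in> atlas (prod_mfd M N)" for c p
  proof -
    obtain d e where d: "d \<in> atlas M" and e: "e \<in> atlas N" and p: "p = prod_chart d e"
      using p by (auto simp: prod_mfd_atlas)
    note isc = smooth_manifold_is_chart[OF L c] smooth_manifold_is_chart[OF M d] smooth_manifold_is_chart[OF N e]
    let ?D = "(U \<inter> f -` chart_dom d) \<inter> (U \<inter> g -` chart_dom e) \<inter> chart_dom c"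
    have o: "open (chart_map c ` ?D)"
      by (intro chart_open_image_sub isc open_Int smooth_open_preimage[OF f] smooth_open_preimage[OF g] chart_open_dom) auto
    have D: "U \<inter> chart_dom c \<inter> (\<lambda>x. (f x, g x)) -` chart_dom p = ?D" by (auto simp: p)
    have "Cinf_on (chart_map c ` ?D) (\<lambda>y. (lrep c d f y, lrep c e g y))"
      by (intro Cinf_on_Pair[OF o] Cinf_on_subset[OF smooth_open_lrep[OF f c d]]
          Cinf_on_subset[OF smooth_open_lrep[OF g c e]]) auto
    then show ?thesis unfolding D by (simp add: p comp_def)
  qed
  ultimately show ?thesis using U by (simp add: smooth_open_def)
qed

lemma tmap_Pair:
  assumes f: "smooth_open L M U f" and g: "smooth_open L N U g" and x: "x \<in> U"
  shows "tmap L (prod_mfd M N) (\<lambda>x. (f x, g x)) x v = (tmap L M f x v, tmap L N g x v)"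
proof -
  let ?c = "chart_at L x"
  note c = chart_at_atlas[OF L, of x] chart_at_dom[OF L, of x]
  have df: "lrep ?c (chart_at M (f x)) f differentiable (at (chart_map ?c x))"
    "lrep ?c (chart_at N (g x)) g differentiable (at (chart_map ?c x))"
    by (rule lrep_differentiable[OF f] lrep_differentiable[OF g]; simp add: c x M N chart_at_atlas chart_at_dom)+
  have "lrep ?c (prod_chart (chart_at M (f x)) (chart_at N (g x))) (\<lambda>x. (f x, g x))
      = (\<lambda>y. (lrep ?c (chart_at M (f x)) f y, lrep ?c (chart_at N (g x)) g y))"
    by (simp add: comp_def)
  then show ?thesis
    unfolding tmap_eq_fd[OF L]
    using has_derivative_Pair[OF fd_has_derivative[OF df(1)] fd_has_derivative[OF df(2)]]
    by (simp add: fd_eq)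
qed

end

context
  fixes M :: "('a::{t2_space, second_countable_topology}, 'e::real_normed_vector) charted"
    and N :: "('b::{t2_space, second_countable_topology}, 'f::real_normed_vector) charted"
  assumes M: "smooth_manifold M" and N: "smooth_manifold N"
begin

text \<open>In product charts the representative of \<open>fst\<close> is a change of charts after
  the linear projection. In the preferred charts the change of charts disappears near the point, so
  the differential is the projection itself.\<close>

lemma tmap_fst:
  "smooth_open (prod_mfd M N) M UNIV fst" "tmap (prod_mfd M N) M fst (a, b) w = fst w"
proof -
  note fin = smooth_manifold_findim[OF M] smooth_manifold_findim[OF N]
  have *: "lrep (prod_chart d e) c fst z = lrep d c (\<lambda>x. x) (fst z)"
    if "d \<in> atlas M" "e \<in> atlas N" "z \<in> chart_map d ` chart_dom d \<times> chart_map e ` chart_dom e" for d e c z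
    using prod_chart_inv'[OF smooth_manifold_is_chart[OF M that(1)] smooth_manifold_is_chart[OF N that(2)] that(3)]
    by simp
  have "Cinf_on (chart_map p ` (UNIV \<inter> chart_dom p \<inter> fst -` chart_dom c)) (lrep p c fst)"
    if p: "p \<in> atlas (prod_mfd M N)" and c: "c \<in> atlas M" for p c
  proof -
    obtain d e where d: "d \<in> atlas M" and e: "e \<in> atlas N" and p: "p = prod_chart d e"
      using p by (auto simp: prod_mfd_atlas)
    note isc = smooth_manifold_is_chart[OF M c] smooth_manifold_is_chart[OF M d] smooth_manifold_is_chart[OF N e]
    let ?A = "chart_map d ` (UNIV \<inter> chart_dom d \<inter> (\<lambda>x. x) -` chart_dom c)"
    have D: "chart_map p ` (UNIV \<inter> chart_dom p \<inter> fst -` chart_dom c) = ?A \<times> chart_map e ` chart_dom e"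
      unfolding p prod_chart_image[symmetric] by (rule arg_cong[where f="image _"]) auto
    have oA: "open ?A" by (rule lrep_domain_open[OF smooth_open_id[OF M] isc(2,1)])
    have o: "open (?A \<times> chart_map e ` chart_dom e)"
      by (intro open_Times oA chart_open_image_sub isc chart_open_dom) auto
    have "Cinf_on (?A \<times> chart_map e ` chart_dom e) (\<lambda>z. lrep d c (\<lambda>x. x) (fst z))"
      by (rule Cinf_on_compose[OF fin(1) o oA Cinf_on_fst[OF o Cinf_on_id] _ smooth_open_lrep[OF smooth_open_id[OF M] d c]]) auto
    then show ?thesis
      unfolding D unfolding p by (rule Cinf_on_cong[OF o, rotated]) (rule *[OF d e, symmetric], auto)
  qed
  then show sm: "smooth_open (prod_mfd M N) M UNIV fst"
    by (auto simp: smooth_open_def intro: continuous_intros)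
  have P: "smooth_manifold (prod_mfd M N)" by (rule prod_mfd_smooth_manifold[OF M N])
  let ?d = "chart_at M a" and ?e = "chart_at N b"
  note d = chart_at_atlas[OF M, of a] chart_at_dom[OF M, of a]
  note e = chart_at_atlas[OF N, of b] chart_at_dom[OF N, of b]
  note isc = smooth_manifold_is_chart[OF M d(1)] smooth_manifold_is_chart[OF N e(1)]
  have o: "open (chart_map ?d ` chart_dom ?d \<times> chart_map ?e ` chart_dom ?e)"
    by (intro open_Times chart_open_image_sub isc chart_open_dom) auto
  have "(fst has_derivative fst) (at (chart_map ?d a, chart_map ?e b))"
    by (rule bounded_linear_imp_has_derivative[OF bounded_linear_fst])
  then have "(lrep (prod_chart ?d ?e) ?d fst has_derivative fst) (at (chart_map ?d a, chart_map ?e b))"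
    by (rule has_derivative_transform_within_open[OF _ o])
      (use d e in \<open>auto simp: prod_chart_inv[OF isc]\<close>)
  then show "tmap (prod_mfd M N) M fst (a, b) w = fst w"
    by (simp add: tmap_eq_fd[OF P] fd_eq)
qed

lemma tmap_snd:
  "smooth_open (prod_mfd M N) N UNIV snd" "tmap (prod_mfd M N) N snd (a, b) w = snd w"
proof -
  note fin = smooth_manifold_findim[OF M] smooth_manifold_findim[OF N]
  have *: "lrep (prod_chart d e) c snd z = lrep e c (\<lambda>x. x) (snd z)"
    if "d \<in> atlas M" "e \<in> atlas N" "z \<in> chart_map d ` chart_dom d \<times> chart_map e ` chart_dom e" for d e c z
    using prod_chart_inv'[OF smooth_manifold_is_chart[OF M that(1)] smooth_manifold_is_chart[OF N that(2)] that(3)]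
    by simp
  have "Cinf_on (chart_map p ` (UNIV \<inter> chart_dom p \<inter> snd -` chart_dom c)) (lrep p c snd)"
    if p: "p \<in> atlas (prod_mfd M N)" and c: "c \<in> atlas N" for p c
  proof -
    obtain d e where d: "d \<in> atlas M" and e: "e \<in> atlas N" and p: "p = prod_chart d e"
      using p by (auto simp: prod_mfd_atlas)
    note isc = smooth_manifold_is_chart[OF N c] smooth_manifold_is_chart[OF M d] smooth_manifold_is_chart[OF N e]
    let ?A = "chart_map e ` (UNIV \<inter> chart_dom e \<inter> (\<lambda>x. x) -` chart_dom c)"
    have D: "chart_map p ` (UNIV \<inter> chart_dom p \<inter> snd -` chart_dom c) = chart_map d ` chart_dom d \<times> ?A"
      unfolding p prod_chart_image[symmetric] by (rule arg_cong[where f="image _"]) auto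
    have oA: "open ?A" by (rule lrep_domain_open[OF smooth_open_id[OF N] isc(3,1)])
    have o: "open (chart_map d ` chart_dom d \<times> ?A)"
      by (intro open_Times oA chart_open_image_sub isc chart_open_dom) auto
    have "Cinf_on (chart_map d ` chart_dom d \<times> ?A) (\<lambda>z. lrep e c (\<lambda>x. x) (snd z))"
      by (rule Cinf_on_compose[OF fin(2) o oA Cinf_on_snd[OF o Cinf_on_id] _ smooth_open_lrep[OF smooth_open_id[OF N] e c]]) auto
    then show ?thesis
      unfolding D unfolding p by (rule Cinf_on_cong[OF o, rotated]) (rule *[OF d e, symmetric], auto)
  qed
  then show sm: "smooth_open (prod_mfd M N) N UNIV snd"
    by (auto simp: smooth_open_def intro: continuous_intros)
  have P: "smooth_manifold (prod_mfd M N)" by (rule prod_mfd_smooth_manifold[OF M N])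
  let ?d = "chart_at M a" and ?e = "chart_at N b"
  note d = chart_at_atlas[OF M, of a] chart_at_dom[OF M, of a]
  note e = chart_at_atlas[OF N, of b] chart_at_dom[OF N, of b]
  note isc = smooth_manifold_is_chart[OF M d(1)] smooth_manifold_is_chart[OF N e(1)]
  have o: "open (chart_map ?d ` chart_dom ?d \<times> chart_map ?e ` chart_dom ?e)"
    by (intro open_Times chart_open_image_sub isc chart_open_dom) auto
  have "(snd has_derivative snd) (at (chart_map ?d a, chart_map ?e b))"
    by (rule bounded_linear_imp_has_derivative[OF bounded_linear_snd])
  then have "(lrep (prod_chart ?d ?e) ?e snd has_derivative snd) (at (chart_map ?d a, chart_map ?e b))"
    by (rule has_derivative_transform_within_open[OF _ o])
      (use d e in \<open>auto simp: prod_chart_inv[OF isc]\<close>)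
  then show "tmap (prod_mfd M N) N snd (a, b) w = snd w"
    by (simp add: tmap_eq_fd[OF P] fd_eq)
qed

lemma tcoord_prod:
  assumes c: "c \<in> atlas M" "x \<in> chart_dom c" and d: "d \<in> atlas N" "y \<in> chart_dom d"
  shows "tcoord (prod_mfd M N) (prod_chart c d) (x, y) (v, w) = (tcoord M c x v, tcoord N d y w)"
proof -
  note c' = chart_at_atlas[OF M, of x] chart_at_dom[OF M, of x]
  note d' = chart_at_atlas[OF N, of y] chart_at_dom[OF N, of y]
  let ?c = "chart_at M x" and ?d = "chart_at N y"
  note isc = smooth_manifold_is_chart[OF M c'(1)] smooth_manifold_is_chart[OF N d'(1)]
  have o: "open (chart_map ?c ` chart_dom ?c \<times> chart_map ?d ` chart_dom ?d)"
    by (intro open_Times chart_open_image_sub isc chart_open_dom) auto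
  let ?f = "lrep ?c c (\<lambda>x. x)" and ?g = "lrep ?d d (\<lambda>x. x)"
  have df: "(?f has_derivative tcoord M c x) (at (chart_map ?c x))"
    unfolding tcoord_lrep[OF M]
    by (intro fd_has_derivative lrep_differentiable[OF smooth_open_id[OF M]] c c' UNIV_I)
  have dg: "(?g has_derivative tcoord N d y) (at (chart_map ?d y))"
    unfolding tcoord_lrep[OF N]
    by (intro fd_has_derivative lrep_differentiable[OF smooth_open_id[OF N]] d d' UNIV_I)
  have "((\<lambda>z. ?f (fst z)) has_derivative (\<lambda>h. tcoord M c x (fst h))) (at (chart_map ?c x, chart_map ?d y))"
    by (rule has_derivative_compose[where f=fst and g="?f"])
      (use df in \<open>auto intro: bounded_linear_imp_has_derivative bounded_linear_fst\<close>)
  moreover have "((\<lambda>z. ?g (snd z)) has_derivative (\<lambda>h. tcoord N d y (snd h))) (at (chart_map ?c x, chart_map ?d y))"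
    by (rule has_derivative_compose[where f=snd and g="?g"])
      (use dg in \<open>auto intro: bounded_linear_imp_has_derivative bounded_linear_snd\<close>)
  ultimately have "((\<lambda>z. (?f (fst z), ?g (snd z))) has_derivative (\<lambda>h. (tcoord M c x (fst h), tcoord N d y (snd h))))
      (at (chart_map ?c x, chart_map ?d y))"
    by (rule has_derivative_Pair)
  then have "((chart_map (prod_chart c d) \<circ> chart_inv (prod_chart ?c ?d)) has_derivative
      (\<lambda>h. (tcoord M c x (fst h), tcoord N d y (snd h)))) (at (chart_map ?c x, chart_map ?d y))"
    by (rule has_derivative_transform_within_open[OF _ o])
      (use c' d' in \<open>auto simp: prod_chart_inv[OF isc] chart_inv_map isc\<close>)
  then show ?thesis
    by (simp add: tcoord_def[of "prod_mfd M N"] fd_eq)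
qed

end

section \<open>Vector fields along maps\<close>

text \<open>\<open>Z x\<close> is a tangent vector of \<open>N\<close> at \<open>\<psi> x\<close>.\<close>

definition smooth_along ::
  "('a::topological_space, 'e::real_normed_vector) charted
     \<Rightarrow> ('b::topological_space, 'f::real_normed_vector) charted
     \<Rightarrow> 'a set \<Rightarrow> ('a \<Rightarrow> 'b) \<Rightarrow> ('a \<Rightarrow> 'f) \<Rightarrow> bool" where
  "smooth_along M N U \<psi> Z \<longleftrightarrow>
     (\<forall>c\<in>atlas M. \<forall>d\<in>atlas N. Cinf_on (chart_map c ` (U \<inter> chart_dom c \<inter> \<psi> -` chart_dom d))
        (\<lambda>y. tcoord N d (\<psi> (chart_inv c y)) (Z (chart_inv c y))))"

lemma smooth_alongD:
  "smooth_along M N U \<psi> Z \<Longrightarrow> c \<in> atlas M \<Longrightarrow> d \<in> atlas N \<Longrightarrow>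
    Cinf_on (chart_map c ` (U \<inter> chart_dom c \<inter> \<psi> -` chart_dom d))
      (\<lambda>y. tcoord N d (\<psi> (chart_inv c y)) (Z (chart_inv c y)))"
  by (simp add: smooth_along_def)

lemma vector_field_onD:
  "vector_field_on M U V \<Longrightarrow> c \<in> atlas M \<Longrightarrow> Cinf_on (chart_map c ` (U \<inter> chart_dom c)) (vf_rep M c V)"
  by (simp add: vector_field_on_def)

lemma chart_trans_smooth:
  assumes "smooth_manifold M" "c \<in> atlas M" "d \<in> atlas M"
  shows "Cinf_on (chart_map c ` (chart_dom c \<inter> chart_dom d)) (lrep c d (\<lambda>x. x))"
  using assms by (auto simp: smooth_manifold_def comp_def)

context
  fixes M :: "('a::{t2_space, second_countable_topology}, 'e::real_normed_vector) charted"
    and N :: "('b::{t2_space, second_countable_topology}, 'f::real_normed_vector) charted"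
  assumes M: "smooth_manifold M" and N: "smooth_manifold N"
begin

text \<open>One pair of charts around each point suffices: in any other pair the coordinates arise
  by composing with a transition map at the source and applying the derivative of a transition map
  at the target.\<close>

lemma smooth_along_local:
  assumes \<psi>: "smooth_open M N U \<psi>"
    and loc: "\<And>x. x \<in> U \<Longrightarrow> \<exists>c\<in>atlas M. \<exists>d\<in>atlas N. \<exists>W. open W \<and> x \<in> W \<and> W \<subseteq> U \<inter> chart_dom c \<inter> \<psi> -` chart_dom d \<and>
      Cinf_on (chart_map c ` W) (\<lambda>y. tcoord N d (\<psi> (chart_inv c y)) (Z (chart_inv c y)))"
  shows "smooth_along M N U \<psi> Z"
  unfolding smooth_along_def
proof (intro ballI)
  fix c' d' assume c': "c' \<in> atlas M" and d': "d' \<in> atlas N"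
  show "Cinf_on (chart_map c' ` (U \<inter> chart_dom c' \<inter> \<psi> -` chart_dom d'))
      (\<lambda>y. tcoord N d' (\<psi> (chart_inv c' y)) (Z (chart_inv c' y)))"
  proof (rule Cinf_on_local)
    fix y assume "y \<in> chart_map c' ` (U \<inter> chart_dom c' \<inter> \<psi> -` chart_dom d')"
    then obtain x where x: "x \<in> U" "x \<in> chart_dom c'" "\<psi> x \<in> chart_dom d'" "y = chart_map c' x" by auto
    obtain c d W where c: "c \<in> atlas M" and d: "d \<in> atlas N" and W: "open W" "x \<in> W"
      "W \<subseteq> U \<inter> chart_dom c \<inter> \<psi> -` chart_dom d"
      and Z: "Cinf_on (chart_map c ` W) (\<lambda>y. tcoord N d (\<psi> (chart_inv c y)) (Z (chart_inv c y)))"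
      using loc[OF x(1)] by blast
    note isc = smooth_manifold_is_chart[OF M c] smooth_manifold_is_chart[OF M c']
      smooth_manifold_is_chart[OF N d] smooth_manifold_is_chart[OF N d']
    let ?D = "W \<inter> chart_dom c' \<inter> (U \<inter> \<psi> -` chart_dom d')"
    let ?T = "chart_dom d \<inter> chart_dom d'"
    have oD: "open (chart_map c' ` ?D)"
      by (intro chart_open_image_sub isc open_Int W smooth_open_preimage[OF \<psi>] chart_open_dom) auto
    have oW: "open (chart_map c ` W)" using W by (intro chart_open_image_sub isc) auto
    have oT: "open (chart_map d ` ?T)" by (intro chart_open_image_sub isc open_Int chart_open_dom) auto
    have "Cinf_on (chart_map c' ` ?D) (\<lambda>y. fd (lrep d d' (\<lambda>x. x)) (lrep c' d \<psi> y)
        ((\<lambda>y. tcoord N d (\<psi> (chart_inv c y)) (Z (chart_inv c y))) (lrep c' c (\<lambda>x. x) y)))"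
    proof (rule Cinf_on_fd_apply[OF smooth_manifold_findim[OF N] oD oT])
      show "Cinf_on (chart_map c' ` ?D) (lrep c' d \<psi>)"
        by (rule Cinf_on_subset[OF smooth_open_lrep[OF \<psi> c' d]]) (use W in auto)
      show "Cinf_on (chart_map d ` ?T) (lrep d d' (\<lambda>x. x))"
        by (rule chart_trans_smooth[OF N d d'])
      show "Cinf_on (chart_map c' ` ?D) (\<lambda>y. tcoord N d (\<psi> (chart_inv c (lrep c' c (\<lambda>x. x) y)))
          (Z (chart_inv c (lrep c' c (\<lambda>x. x) y))))"
      proof (rule Cinf_on_compose[OF smooth_manifold_findim[OF M] oD oW _ _ Z])
        show "Cinf_on (chart_map c' ` ?D) (lrep c' c (\<lambda>x. x))"
          by (rule Cinf_on_subset[OF chart_trans_smooth[OF M c' c]]) (use W in auto)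
      qed (auto simp: chart_inv_map[OF isc(2)])
    qed (use W in \<open>auto simp: chart_inv_map[OF isc(2)]\<close>)
    then have "Cinf_on (chart_map c' ` ?D) (\<lambda>y. tcoord N d' (\<psi> (chart_inv c' y)) (Z (chart_inv c' y)))"
    proof (rule Cinf_on_cong[OF oD, rotated])
      fix y assume "y \<in> chart_map c' ` ?D"
      then obtain z where z: "z \<in> ?D" "y = chart_map c' z" by blast
      then have zd: "z \<in> chart_dom c'" "z \<in> chart_dom c" "\<psi> z \<in> chart_dom d" "\<psi> z \<in> chart_dom d'"
        using W(3) by auto
      show "fd (lrep d d' (\<lambda>x. x)) (lrep c' d \<psi> y)
        ((\<lambda>y. tcoord N d (\<psi> (chart_inv c y)) (Z (chart_inv c y))) (lrep c' c (\<lambda>x. x) y))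
        = tcoord N d' (\<psi> (chart_inv c' y)) (Z (chart_inv c' y))"
        using zd tcoord_change[OF N d zd(3) d' zd(4), of "Z z"]
        by (simp add: z(2) chart_inv_map[OF isc(2)] chart_inv_map[OF isc(1)])
    qed
    moreover have "y \<in> chart_map c' ` ?D" using x W by auto
    ultimately show "\<exists>U. open U \<and> y \<in> U \<and> Cinf_on U (\<lambda>y. tcoord N d' (\<psi> (chart_inv c' y)) (Z (chart_inv c' y)))"
      using oD by blast
  qed
qed

lemma smooth_along_zero: "smooth_open M N U \<psi> \<Longrightarrow> smooth_along M N U \<psi> (\<lambda>x. 0)"
proof -
  assume \<psi>: "smooth_open M N U \<psi>"
  have "Cinf_on (chart_map c ` (U \<inter> chart_dom c \<inter> \<psi> -` chart_dom d)) (\<lambda>y. tcoord N d (\<psi> (chart_inv c y)) 0)"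
    if c: "c \<in> atlas M" and d: "d \<in> atlas N" for c d
  proof -
    note isc = smooth_manifold_is_chart[OF M c] smooth_manifold_is_chart[OF N d]
    show ?thesis
      by (rule Cinf_on_cong[OF lrep_domain_open[OF \<psi> isc] _ Cinf_on_const[of _ 0]])
        (auto simp: chart_inv_map[OF isc(1)] linear_0[OF tcoord_linear[OF N d]])
  qed
  then show ?thesis by (simp add: smooth_along_def)
qed

lemma smooth_along_field:
  assumes V: "vector_field_on N W V" and W: "open W" and \<psi>: "smooth_open M N U \<psi>" and \<psi>W: "\<And>x. x \<in> U \<Longrightarrow> \<psi> x \<in> W"
  shows "smooth_along M N U \<psi> (\<lambda>x. V (\<psi> x))"
proof -
  have "Cinf_on (chart_map c ` (U \<inter> chart_dom c \<inter> \<psi> -` chart_dom d))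
      (\<lambda>y. tcoord N d (\<psi> (chart_inv c y)) (V (\<psi> (chart_inv c y))))"
    if c: "c \<in> atlas M" and d: "d \<in> atlas N" for c d
  proof -
    note isc = smooth_manifold_is_chart[OF M c] smooth_manifold_is_chart[OF N d]
    note o = lrep_domain_open[OF \<psi> isc]
    have "Cinf_on (chart_map c ` (U \<inter> chart_dom c \<inter> \<psi> -` chart_dom d)) (\<lambda>y. vf_rep N d V (lrep c d \<psi> y))"
      by (rule Cinf_on_compose[OF smooth_manifold_findim[OF N] o chart_open_image[OF isc(2) W]
            smooth_open_lrep[OF \<psi> c d] _ vector_field_onD[OF V d]])
        (use \<psi>W in \<open>auto simp: chart_inv_map[OF isc(1)]\<close>)
    then show ?thesis
      by (rule Cinf_on_cong[OF o, rotated]) (auto simp: vf_rep_def chart_inv_map[OF isc(1)] chart_inv_map[OF isc(2)])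
  qed
  then show ?thesis by (simp add: smooth_along_def)
qed

text \<open>Along a constant map all vectors lie in one tangent space, and a change of chart there
  is a fixed linear map. This accommodates functions with values in the Lie algebra, the tangent
  space at the unit.\<close>

lemma smooth_along_const:
  assumes f: "smooth_fun_on M U f" and U: "open U"
  shows "smooth_along M N U (\<lambda>x. b) f"
proof -
  have "Cinf_on (chart_map c ` (U \<inter> chart_dom c \<inter> (\<lambda>x. b) -` chart_dom d)) (\<lambda>y. tcoord N d b (f (chart_inv c y)))"
    if c: "c \<in> atlas M" and d: "d \<in> atlas N" for c d
  proof (cases "b \<in> chart_dom d")
    case True
    have "bounded_linear (tcoord N d b)"
      by (rule findim_linear_bounded[OF smooth_manifold_findim[OF N] tcoord_linear[OF N d True]])
    moreover have "Cinf_on (chart_map c ` (U \<inter> chart_dom c)) (f \<circ> chart_inv c)"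
      using f c by (simp add: smooth_fun_on_def)
    ultimately have "Cinf_on (chart_map c ` (U \<inter> chart_dom c)) (\<lambda>y. tcoord N d b ((f \<circ> chart_inv c) y))"
      by (rule Cinf_on_linear_compose[OF chart_open_image[OF smooth_manifold_is_chart[OF M c] U]])
    then show ?thesis unfolding comp_def by (rule Cinf_on_subset) auto
  next
    case False
    then have "chart_map c ` (U \<inter> chart_dom c \<inter> (\<lambda>x. b) -` chart_dom d) = {}" by auto
    then show ?thesis by (metis Cinf_on_local empty_iff)
  qed
  then show ?thesis by (simp add: smooth_along_def)
qed

lemma smooth_along_diff:
  assumes \<psi>: "smooth_open M N U \<psi>" and Z: "smooth_along M N U \<psi> Z" and Y: "smooth_along M N U \<psi> Y"
  shows "smooth_along M N U \<psi> (\<lambda>x. Z x - Y x)"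
proof -
  have "Cinf_on (chart_map c ` (U \<inter> chart_dom c \<inter> \<psi> -` chart_dom d))
      (\<lambda>y. tcoord N d (\<psi> (chart_inv c y)) (Z (chart_inv c y) - Y (chart_inv c y)))"
    if c: "c \<in> atlas M" and d: "d \<in> atlas N" for c d
  proof -
    note isc = smooth_manifold_is_chart[OF M c] smooth_manifold_is_chart[OF N d]
    note o = lrep_domain_open[OF \<psi> isc]
    show ?thesis
      by (rule Cinf_on_cong[OF o _ Cinf_on_diff[OF o smooth_alongD[OF Z c d] smooth_alongD[OF Y c d]]])
        (auto simp: chart_inv_map[OF isc(1)] linear_diff[OF tcoord_linear[OF N d]])
  qed
  then show ?thesis by (simp add: smooth_along_def)
qed

end

text \<open>The device by which new smooth fields are produced below: a field is paired with zero or
  a constant point, and pushed forward by a smooth map.\<close>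

lemma smooth_along_tmap:
  assumes M: "smooth_manifold M" and N: "smooth_manifold N" and L: "smooth_manifold L"
    and \<psi>: "smooth_open M N U \<psi>" and Z: "smooth_along M N U \<psi> Z"
    and \<Theta>: "smooth_open N L W \<Theta>" and \<psi>W: "\<And>x. x \<in> U \<Longrightarrow> \<psi> x \<in> W"
  shows "smooth_along M L U (\<lambda>x. \<Theta> (\<psi> x)) (\<lambda>x. tmap N L \<Theta> (\<psi> x) (Z x))"
proof (rule smooth_along_local[OF M L smooth_open_compose[OF M N L \<psi> \<Theta> \<psi>W]])
  fix x assume x: "x \<in> U"
  let ?c = "chart_at M x" and ?d = "chart_at N (\<psi> x)" and ?e = "chart_at L (\<Theta> (\<psi> x))"
  note c = chart_at_atlas[OF M, of x] chart_at_dom[OF M, of x]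
  note d = chart_at_atlas[OF N, of "\<psi> x"] chart_at_dom[OF N, of "\<psi> x"]
  note e = chart_at_atlas[OF L, of "\<Theta> (\<psi> x)"] chart_at_dom[OF L, of "\<Theta> (\<psi> x)"]
  note isc = smooth_manifold_is_chart[OF M c(1)] smooth_manifold_is_chart[OF N d(1)] smooth_manifold_is_chart[OF L e(1)]
  let ?T = "W \<inter> \<Theta> -` chart_dom ?e \<inter> chart_dom ?d"
  let ?D = "U \<inter> \<psi> -` ?T \<inter> chart_dom ?c"
  have oT: "open ?T" by (intro open_Int smooth_open_preimage[OF \<Theta>] chart_open_dom isc)
  have oT': "open (chart_map ?d ` ?T)" by (intro chart_open_image_sub oT isc) auto
  have oD: "open ?D" by (intro open_Int smooth_open_preimage[OF \<psi> oT] chart_open_dom isc)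
  have oD': "open (chart_map ?c ` ?D)" by (intro chart_open_image_sub oD isc) auto
  have "Cinf_on (chart_map ?c ` ?D) (\<lambda>y. fd (lrep ?d ?e \<Theta>) (lrep ?c ?d \<psi> y)
      (tcoord N ?d (\<psi> (chart_inv ?c y)) (Z (chart_inv ?c y))))"
  proof (rule Cinf_on_fd_apply[OF smooth_manifold_findim[OF N] oD' oT'])
    show "Cinf_on (chart_map ?c ` ?D) (lrep ?c ?d \<psi>)"
      by (rule Cinf_on_subset[OF smooth_open_lrep[OF \<psi> c(1) d(1)]]) auto
    show "Cinf_on (chart_map ?d ` ?T) (lrep ?d ?e \<Theta>)"
      by (rule Cinf_on_subset[OF smooth_open_lrep[OF \<Theta> d(1) e(1)]]) auto
    show "Cinf_on (chart_map ?c ` ?D) (\<lambda>y. tcoord N ?d (\<psi> (chart_inv ?c y)) (Z (chart_inv ?c y)))"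
      by (rule Cinf_on_subset[OF smooth_alongD[OF Z c(1) d(1)]]) auto
  qed (auto simp: chart_inv_map[OF isc(1)])
  then have "Cinf_on (chart_map ?c ` ?D) (\<lambda>y. tcoord L ?e (\<Theta> (\<psi> (chart_inv ?c y)))
      (tmap N L \<Theta> (\<psi> (chart_inv ?c y)) (Z (chart_inv ?c y))))"
    by (rule Cinf_on_cong[OF oD', rotated])
      (auto simp: chart_inv_map[OF isc(1)] tmap_chart[OF N L \<Theta> _ d(1) _ e(1)])
  then show "\<exists>c\<in>atlas M. \<exists>e\<in>atlas L. \<exists>D. open D \<and> x \<in> D \<and> D \<subseteq> U \<inter> chart_dom c \<inter> (\<lambda>x. \<Theta> (\<psi> x)) -` chart_dom e \<and>
      Cinf_on (chart_map c ` D) (\<lambda>y. tcoord L e (\<Theta> (\<psi> (chart_inv c y))) (tmap N L \<Theta> (\<psi> (chart_inv c y)) (Z (chart_inv c y))))"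
    using x c d e oD \<psi>W
    by (intro bexI[of _ ?c] bexI[of _ ?e] exI[of _ ?D]) auto
qed

lemma smooth_along_Pair:
  assumes M: "smooth_manifold M" and N: "smooth_manifold N" and L: "smooth_manifold L"
    and f: "smooth_open L M U f" and g: "smooth_open L N U g"
    and Z: "smooth_along L M U f Z" and Y: "smooth_along L N U g Y"
  shows "smooth_along L (prod_mfd M N) U (\<lambda>x. (f x, g x)) (\<lambda>x. (Z x, Y x))"
  unfolding smooth_along_def
proof (intro ballI)
  fix c p assume c: "c \<in> atlas L" and p: "p \<in> atlas (prod_mfd M N)"
  obtain d e where d: "d \<in> atlas M" and e: "e \<in> atlas N" and p: "p = prod_chart d e"
    using p by (auto simp: prod_mfd_atlas)
  note isc = smooth_manifold_is_chart[OF L c] smooth_manifold_is_chart[OF M d] smooth_manifold_is_chart[OF N e]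
  let ?D = "(U \<inter> f -` chart_dom d) \<inter> (U \<inter> g -` chart_dom e) \<inter> chart_dom c"
  have o: "open (chart_map c ` ?D)"
    by (intro chart_open_image_sub isc open_Int smooth_open_preimage[OF f] smooth_open_preimage[OF g] chart_open_dom) auto
  have D: "U \<inter> chart_dom c \<inter> (\<lambda>x. (f x, g x)) -` chart_dom p = ?D" by (auto simp: p)
  have "Cinf_on (chart_map c ` ?D) (\<lambda>y. (tcoord M d (f (chart_inv c y)) (Z (chart_inv c y)), tcoord N e (g (chart_inv c y)) (Y (chart_inv c y))))"
    by (intro Cinf_on_Pair[OF o] Cinf_on_subset[OF smooth_alongD[OF Z c d]]
        Cinf_on_subset[OF smooth_alongD[OF Y c e]]) auto
  then show "Cinf_on (chart_map c ` (U \<inter> chart_dom c \<inter> (\<lambda>x. (f x, g x)) -` chart_dom p))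
      (\<lambda>y. tcoord (prod_mfd M N) p (f (chart_inv c y), g (chart_inv c y)) (Z (chart_inv c y), Y (chart_inv c y)))"
    unfolding D
    by (rule Cinf_on_cong[OF o, rotated]) (auto simp: p chart_inv_map[OF isc(1)] tcoord_prod[OF M N d _ e])
qed

section \<open>Vector fields and brackets on manifolds\<close>

text \<open>The bracket in the coordinates of an arbitrary chart; \<open>lie_bracket\<close> is its
  value in the preferred chart at the point.\<close>

definition brk ::
  "('a, 'e::real_normed_vector) charted \<Rightarrow> ('a, 'e) chart \<Rightarrow> ('a \<Rightarrow> 'e) \<Rightarrow> ('a \<Rightarrow> 'e) \<Rightarrow> 'e \<Rightarrow> 'e" where
  "brk M c V W y = fd (vf_rep M c W) y (vf_rep M c V y) - fd (vf_rep M c V) y (vf_rep M c W y)"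

lemma lie_bracket_brk: "lie_bracket M V W x = brk M (chart_at M x) V W (chart_map (chart_at M x) x)"
  by (simp add: lie_bracket_def brk_def Let_def)

context
  fixes M :: "('a::{t2_space, second_countable_topology}, 'e::real_normed_vector) charted"
  assumes M: "smooth_manifold M"
begin

lemma vf_rep_apply:
  "c \<in> atlas M \<Longrightarrow> x \<in> chart_dom c \<Longrightarrow> vf_rep M c V (chart_map c x) = tcoord M c x (V x)"
  using smooth_manifold_is_chart[OF M] by (simp add: vf_rep_def chart_inv_map)

lemma vf_rep_differentiable:
  "vector_field_on M U V \<Longrightarrow> x \<in> U \<Longrightarrow> c \<in> atlas M \<Longrightarrow> x \<in> chart_dom c
    \<Longrightarrow> vf_rep M c V differentiable (at (chart_map c x))"
  by (rule Cinf_on_differentiable[OF vector_field_onD]) auto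

lemma smooth_open_ident: "open U \<Longrightarrow> smooth_open M M U (\<lambda>x. x)"
  by (rule smooth_open_subset[OF smooth_open_id[OF M]]) auto

lemma vector_field_on_local:
  assumes U: "open U"
    and loc: "\<And>x. x \<in> U \<Longrightarrow> \<exists>c\<in>atlas M. \<exists>W. open W \<and> x \<in> W \<and> W \<subseteq> U \<inter> chart_dom c \<and>
      Cinf_on (chart_map c ` W) (vf_rep M c V)"
  shows "vector_field_on M U V"
proof -
  have *: "smooth_along M M U (\<lambda>x. x) V"
  proof (rule smooth_along_local[OF M M smooth_open_ident[OF U]])
    fix x assume "x \<in> U"
    then obtain c W where *: "c \<in> atlas M" "open W" "x \<in> W" "W \<subseteq> U \<inter> chart_dom c"
      "Cinf_on (chart_map c ` W) (vf_rep M c V)"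
      using loc by blast
    show "\<exists>c\<in>atlas M. \<exists>d\<in>atlas M. \<exists>W. open W \<and> x \<in> W \<and> W \<subseteq> U \<inter> chart_dom c \<inter> (\<lambda>x. x) -` chart_dom d \<and>
      Cinf_on (chart_map c ` W) (\<lambda>y. tcoord M d (chart_inv c y) (V (chart_inv c y)))"
      using * by (intro bexI[of _ c] exI[of _ W]) (auto simp: vf_rep_def[abs_def])
  qed
  have eq: "U \<inter> chart_dom c \<inter> (\<lambda>x. x) -` chart_dom c = U \<inter> chart_dom c" for c :: "('a, 'e) chart"
    by auto
  show ?thesis
    unfolding vector_field_on_def vf_rep_def[abs_def]
  proof
    fix c assume c: "c \<in> atlas M"
    show "Cinf_on (chart_map c ` (U \<inter> chart_dom c)) (\<lambda>y. tcoord M c (chart_inv c y) (V (chart_inv c y)))"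
      using smooth_alongD[OF * c c] unfolding eq .
  qed
qed

lemma smooth_along_ident:
  assumes U: "open U"
  shows "smooth_along M M U (\<lambda>x. x) V \<longleftrightarrow> vector_field_on M U V"
proof
  assume *: "smooth_along M M U (\<lambda>x. x) V"
  have eq: "U \<inter> chart_dom c \<inter> (\<lambda>x. x) -` chart_dom c = U \<inter> chart_dom c" for c :: "('a, 'e) chart"
    by auto
  show "vector_field_on M U V"
    unfolding vector_field_on_def vf_rep_def[abs_def]
  proof
    fix c assume c: "c \<in> atlas M"
    show "Cinf_on (chart_map c ` (U \<inter> chart_dom c)) (\<lambda>y. tcoord M c (chart_inv c y) (V (chart_inv c y)))"
      using smooth_alongD[OF * c c] unfolding eq .
  qed
next
  assume "vector_field_on M U V"
  from smooth_along_field[OF M M this U smooth_open_ident[OF U]]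
  show "smooth_along M M U (\<lambda>x. x) V" by simp
qed

lemma vector_field_on_tval: "c \<in> atlas M \<Longrightarrow> vector_field_on M (chart_dom c) (\<lambda>x. tval M c x e)"
proof (rule vector_field_on_local)
  assume c: "c \<in> atlas M"
  note isc = smooth_manifold_is_chart[OF M c]
  show o: "open (chart_dom c)" by (rule chart_open_dom[OF isc])
  have o': "open (chart_map c ` chart_dom c)" by (rule chart_open_image_sub[OF isc o]) auto
  fix x assume x: "x \<in> chart_dom c"
  have "Cinf_on (chart_map c ` chart_dom c) (vf_rep M c (\<lambda>x. tval M c x e))"
    by (rule Cinf_on_cong[OF o' _ Cinf_on_const[of _ e]])
      (auto simp: vf_rep_apply[OF c] tcoord_tval[OF M c])
  then show "\<exists>d\<in>atlas M. \<exists>W. open W \<and> x \<in> W \<and> W \<subseteq> chart_dom c \<inter> chart_dom d \<and>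
      Cinf_on (chart_map d ` W) (vf_rep M d (\<lambda>x. tval M c x e))"
    using c o x by blast
qed

end

text \<open>The charts are left free so that the identity map yields chart independence of the
  bracket, and preferred charts yield naturality of \<open>lie_bracket\<close>.\<close>

lemma brk_related:
  assumes M: "smooth_manifold M" and N: "smooth_manifold N" and f: "smooth_open M N U f"
    and V: "vector_field_on M U V" and W: "vector_field_on M U W"
    and V': "vector_field_on N U' V'" and W': "vector_field_on N U' W'" and fU: "\<And>x. x \<in> U \<Longrightarrow> f x \<in> U'"
    and rV: "\<And>x. x \<in> U \<Longrightarrow> V' (f x) = tmap M N f x (V x)" and rW: "\<And>x. x \<in> U \<Longrightarrow> W' (f x) = tmap M N f x (W x)"
    and x: "x \<in> U" and c: "c \<in> atlas M" "x \<in> chart_dom c" and d: "d \<in> atlas N" "f x \<in> chart_dom d"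
  shows "fd (lrep c d f) (chart_map c x) (brk M c V W (chart_map c x)) = brk N d V' W' (chart_map d (f x))"
proof -
  note isc = smooth_manifold_is_chart[OF M c(1)] smooth_manifold_is_chart[OF N d(1)]
  have rel: "vf_rep N d Y' (lrep c d f z) = fd (lrep c d f) z (vf_rep M c Y z)"
    if z: "z \<in> chart_map c ` (U \<inter> chart_dom c \<inter> f -` chart_dom d)"
      and rY: "\<And>x. x \<in> U \<Longrightarrow> Y' (f x) = tmap M N f x (Y x)" for Y Y' z
    using z by (auto simp: chart_inv_map[OF isc(1)] vf_rep_apply[OF N d(1)] vf_rep_apply[OF M c(1)] rY
        tmap_chart[OF M N f _ c(1) _ d(1)])
  have app: "lrep c d f (chart_map c x) = chart_map d (f x)" by (rule lrep_apply[OF isc(1) c(2)])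
  have dif: "(vf_rep N d Y' has_derivative fd (vf_rep N d Y') (chart_map d (f x))) (at (lrep c d f (chart_map c x)))"
    if "vector_field_on N U' Y'" for Y'
    unfolding app by (rule fd_has_derivative[OF vf_rep_differentiable[OF N that fU[OF x] d]])
  have mem: "chart_map c x \<in> chart_map c ` (U \<inter> chart_dom c \<inter> f -` chart_dom d)"
    using x c d by auto
  show ?thesis
    unfolding brk_def
    by (rule bracket_pushforward[OF smooth_manifold_findim[OF M] lrep_domain_open[OF f isc] mem
        smooth_open_lrep[OF f c(1) d(1)] fd_has_derivative[OF vf_rep_differentiable[OF M V x c]]
        fd_has_derivative[OF vf_rep_differentiable[OF M W x c]]
        dif[OF V'] dif[OF W'] rel[OF _ rV] rel[OF _ rW], unfolded app])
qed

context
  fixes M :: "('a::{t2_space, second_countable_topology}, 'e::real_normed_vector) charted"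
  assumes M: "smooth_manifold M"
begin

lemma lie_bracket_chart:
  assumes U: "open U" and V: "vector_field_on M U V" and W: "vector_field_on M U W"
    and x: "x \<in> U" and c: "c \<in> atlas M" "x \<in> chart_dom c"
  shows "tcoord M c x (lie_bracket M V W x) = brk M c V W (chart_map c x)"
  unfolding lie_bracket_brk tcoord_lrep[OF M]
  by (rule brk_related[OF M M smooth_open_ident[OF M U] V W V W])
    (simp_all add: tmap_id M x c chart_at_atlas chart_at_dom)

lemma lie_bracket_vector_field:
  assumes U: "open U" and V: "vector_field_on M U V" and W: "vector_field_on M U W"
  shows "vector_field_on M U (lie_bracket M V W)"
  unfolding vector_field_on_def
proof
  fix c assume c: "c \<in> atlas M"
  note isc = smooth_manifold_is_chart[OF M c]
  note o = chart_open_image[OF isc U]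
  note fin = smooth_manifold_findim[OF M]
  have "Cinf_on (chart_map c ` (U \<inter> chart_dom c)) (brk M c V W)"
    unfolding brk_def[abs_def]
    by (intro Cinf_on_diff o Cinf_on_fd_apply[OF fin o o Cinf_on_id] vector_field_onD[OF V c] vector_field_onD[OF W c])
  then show "Cinf_on (chart_map c ` (U \<inter> chart_dom c)) (vf_rep M c (lie_bracket M V W))"
    by (rule Cinf_on_cong[OF o, rotated])
      (auto simp: vf_rep_apply[OF M c] lie_bracket_chart[OF U V W _ c])
qed

end

lemma lie_bracket_related:
  assumes M: "smooth_manifold M" and N: "smooth_manifold N" and f: "smooth_open M N U f"
    and V: "vector_field_on M U V" and W: "vector_field_on M U W"
    and V': "vector_field_on N U' V'" and W': "vector_field_on N U' W'" and fU: "\<And>x. x \<in> U \<Longrightarrow> f x \<in> U'"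
    and rV: "\<And>x. x \<in> U \<Longrightarrow> V' (f x) = tmap M N f x (V x)" and rW: "\<And>x. x \<in> U \<Longrightarrow> W' (f x) = tmap M N f x (W x)"
    and x: "x \<in> U"
  shows "tmap M N f x (lie_bracket M V W x) = lie_bracket N V' W' (f x)"
  unfolding lie_bracket_brk tmap_eq_fd[OF M]
  by (rule brk_related[OF M N f V W V' W' fU rV rW x chart_at_atlas[OF M] chart_at_dom[OF M]
        chart_at_atlas[OF N] chart_at_dom[OF N]])

text \<open>A bump function in the chart at \<open>x\<close> cuts the field off, and the product is
  extended by zero to the whole manifold.\<close>

lemma vector_field_bump:
  fixes M :: "('a::{t2_space, second_countable_topology}, 'e::real_normed_vector) charted"
  assumes M: "smooth_manifold M" and U: "open U" and V: "vector_field_on M U V" and x: "x \<in> U"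
  obtains f :: "'a \<Rightarrow> real" where "f x = 1" "vector_field M (\<lambda>z. f z *\<^sub>R V z)" "\<And>z. z \<notin> U \<Longrightarrow> f z = 0"
proof -
  let ?c = "chart_at M x"
  note c = chart_at_atlas[OF M, of x] chart_at_dom[OF M, of x]
  note isc = smooth_manifold_is_chart[OF M c(1)]
  note o = chart_open_image[OF isc U]
  have mem: "chart_map ?c x \<in> chart_map ?c ` (U \<inter> chart_dom ?c)" using x c by auto
  obtain \<rho> :: "'e \<Rightarrow> real" and K where \<rho>: "Cinf_on UNIV \<rho>" "\<rho> (chart_map ?c x) = 1" "compact K"
    "K \<subseteq> chart_map ?c ` (U \<inter> chart_dom ?c)" "\<And>y. y \<notin> K \<Longrightarrow> \<rho> y = 0"
    using bump_exists[OF smooth_manifold_findim[OF M] o mem] by blast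
  \<comment> \<open>The support carried to the manifold. It is compact, hence closed in the
    Hausdorff space \<open>'a\<close>, so its complement is an open set on which the extended field
    is zero.\<close>
  define C where "C = chart_inv ?c ` K"
  have "compact C"
    unfolding C_def
    by (rule compact_continuous_image[OF continuous_on_subset[OF chart_inv_continuous[OF isc]] \<rho>(3)])
      (use \<rho>(4) in blast)
  then have oC: "open (- C)" using compact_imp_closed by blast
  have CU: "C \<subseteq> U \<inter> chart_dom ?c"
  proof
    fix z assume "z \<in> C"
    then obtain y where y: "y \<in> K" "z = chart_inv ?c y" unfolding C_def by blast
    then obtain w where "w \<in> U \<inter> chart_dom ?c" "y = chart_map ?c w" using \<rho>(4) by blast
    then show "z \<in> U \<inter> chart_dom ?c" using y(2) chart_inv_map[OF isc] by simp
  qed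
  define f where "f z = (if z \<in> chart_dom ?c then \<rho> (chart_map ?c z) else 0)" for z
  have f0: "f z = 0" if "z \<notin> C" for z
  proof (cases "z \<in> chart_dom ?c")
    case True
    then have "chart_map ?c z \<notin> K"
      using that imageI[of "chart_map ?c z" K "chart_inv ?c"] unfolding C_def chart_inv_map[OF isc True] by blast
    then show ?thesis by (simp add: f_def \<rho>(5))
  qed (simp add: f_def)
  have "vector_field M (\<lambda>z. f z *\<^sub>R V z)"
  proof (rule vector_field_on_local[OF M open_UNIV])
    fix z :: 'a
    show "\<exists>d\<in>atlas M. \<exists>W. open W \<and> z \<in> W \<and> W \<subseteq> UNIV \<inter> chart_dom d \<and>
        Cinf_on (chart_map d ` W) (vf_rep M d (\<lambda>z. f z *\<^sub>R V z))"
    proof (cases "z \<in> C")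
      case True
      have oW: "open (U \<inter> chart_dom ?c)" by (intro open_Int U chart_open_dom isc)
      have "Cinf_on (chart_map ?c ` (U \<inter> chart_dom ?c)) (\<lambda>y. \<rho> y *\<^sub>R vf_rep M ?c V y)"
        by (intro Cinf_on_scaleR[OF o] Cinf_on_subset[OF \<rho>(1)] vector_field_onD[OF V c(1)]) auto
      then have "Cinf_on (chart_map ?c ` (U \<inter> chart_dom ?c)) (vf_rep M ?c (\<lambda>z. f z *\<^sub>R V z))"
        by (rule Cinf_on_cong[OF o, rotated])
          (auto simp: vf_rep_apply[OF M c(1)] f_def linear_scale[OF tcoord_linear[OF M c(1)]])
      then show ?thesis
        using True CU oW c by (intro bexI[of _ ?c] exI[of _ "U \<inter> chart_dom ?c"]) auto
    next
      case False
      let ?d = "chart_at M z"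
      note d = chart_at_atlas[OF M, of z] chart_at_dom[OF M, of z]
      note isd = smooth_manifold_is_chart[OF M d(1)]
      have oW: "open (- C \<inter> chart_dom ?d)" by (intro open_Int oC chart_open_dom isd)
      have "Cinf_on (chart_map ?d ` (- C \<inter> chart_dom ?d)) (vf_rep M ?d (\<lambda>z. f z *\<^sub>R V z))"
        by (rule Cinf_on_cong[OF chart_open_image[OF isd oC] _ Cinf_on_const[of _ 0]])
          (auto simp: vf_rep_apply[OF M d(1)] f0 linear_0[OF tcoord_linear[OF M d(1)]])
      then show ?thesis
        using False oW d by (intro bexI[of _ ?d] exI[of _ "- C \<inter> chart_dom ?d"]) auto
    qed
  qed
  moreover have "f x = 1" using c \<rho>(2) by (simp add: f_def)
  ultimately show ?thesis using f0 CU by (intro that[of f]) auto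
qed

text \<open>Ensures that the quantification over fields in \<open>curvature\<close> is not vacuous.
  The field has constant coordinates near \<open>x\<close> before the cut-off.\<close>

lemma vector_field_extension:
  assumes M: "smooth_manifold M"
  obtains V where "vector_field M V" "V x = v"
proof -
  let ?c = "chart_at M x"
  note c = chart_at_atlas[OF M, of x] chart_at_dom[OF M, of x]
  obtain f where "f x = 1" "vector_field M (\<lambda>z. f z *\<^sub>R tval M ?c z v)"
    using vector_field_bump[OF M chart_open_dom[OF smooth_manifold_is_chart[OF M c(1)]] vector_field_on_tval[OF M c(1)] c(2)]
    by metis
  then show ?thesis
    by (intro that[of "\<lambda>z. f z *\<^sub>R tval M ?c z v"]) (simp_all add: M)
qed

section \<open>Principal bundles\<close>

lemma smooth_along_cong:
  assumes "\<And>x. x \<in> U \<Longrightarrow> \<psi> x = \<psi>' x" "\<And>x. x \<in> U \<Longrightarrow> Z x = Z' x" "\<And>c. c \<in> atlas M \<Longrightarrow> is_chart c"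
    and "smooth_along M N U \<psi> Z" and "\<And>d. d \<in> atlas N \<Longrightarrow> is_chart d" and "smooth_open M N U \<psi>"
  shows "smooth_along M N U \<psi>' Z'"
  unfolding smooth_along_def
proof (intro ballI)
  fix c d assume c: "c \<in> atlas M" and d: "d \<in> atlas N"
  have D: "U \<inter> chart_dom c \<inter> \<psi>' -` chart_dom d = U \<inter> chart_dom c \<inter> \<psi> -` chart_dom d"
    using assms(1) by auto
  show "Cinf_on (chart_map c ` (U \<inter> chart_dom c \<inter> \<psi>' -` chart_dom d))
      (\<lambda>y. tcoord N d (\<psi>' (chart_inv c y)) (Z' (chart_inv c y)))"
    unfolding D
    by (rule Cinf_on_cong[OF lrep_domain_open[OF assms(6) assms(3)[OF c] assms(5)[OF d]] _ smooth_alongD[OF assms(4) c d]])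
      (auto simp: chart_inv_map[OF assms(3)[OF c]] assms(1,2))
qed

lemma vector_field_on_cong:
  assumes M: "smooth_manifold M" and U: "open U" and eq: "\<And>x. x \<in> U \<Longrightarrow> V x = V' x" and V: "vector_field_on M U V"
  shows "vector_field_on M U V'"
  unfolding vector_field_on_def
proof
  fix c assume c: "c \<in> atlas M"
  note isc = smooth_manifold_is_chart[OF M c]
  show "Cinf_on (chart_map c ` (U \<inter> chart_dom c)) (vf_rep M c V')"
    by (rule Cinf_on_cong[OF chart_open_image[OF isc U] _ vector_field_onD[OF V c]])
      (auto simp: vf_rep_apply[OF M c] eq)
qed

lemma vector_field_on_glue:
  assumes M: "smooth_manifold M" and U: "open U"
    and loc: "\<And>x. x \<in> U \<Longrightarrow> \<exists>W. open W \<and> x \<in> W \<and> W \<subseteq> U \<and> vector_field_on M W V"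
  shows "vector_field_on M U V"
proof (rule vector_field_on_local[OF M U])
  fix x assume "x \<in> U"
  then obtain W where W: "open W" "x \<in> W" "W \<subseteq> U" "vector_field_on M W V" using loc by blast
  note c = chart_at_atlas[OF M, of x] chart_at_dom[OF M, of x]
  have "open (W \<inter> chart_dom (chart_at M x))"
    by (intro open_Int W chart_open_dom smooth_manifold_is_chart[OF M c(1)])
  then show "\<exists>c\<in>atlas M. \<exists>W. open W \<and> x \<in> W \<and> W \<subseteq> U \<inter> chart_dom c \<and> Cinf_on (chart_map c ` W) (vf_rep M c V)"
    using W c vector_field_onD[OF W(4) c(1)] by blast
qed

lemma tmap_partial:
  assumes M: "smooth_manifold M" and N: "smooth_manifold N" and L: "smooth_manifold L"
    and F: "smooth_open (prod_mfd M N) L W F" and ab: "(a, b) \<in> W"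
  shows "tmap N L (\<lambda>y. F (a, y)) b w = tmap (prod_mfd M N) L F (a, b) (0, w)"
    and "tmap M L (\<lambda>x. F (x, b)) a v = tmap (prod_mfd M N) L F (a, b) (v, 0)"
proof -
  note P = prod_mfd_smooth_manifold[OF M N]
  have "tmap N L (\<lambda>y. F (a, y)) b w = tmap (prod_mfd M N) L F (a, b) (tmap N (prod_mfd M N) (\<lambda>y. (a, y)) b w)"
    by (rule tmap_compose[OF N P L smooth_open_Pair[OF M N N smooth_open_const[OF N open_UNIV] smooth_open_id[OF N]] F])
      (simp_all add: ab)
  also have "tmap N (prod_mfd M N) (\<lambda>y. (a, y)) b w = (0, w)"
    using tmap_Pair[OF M N N smooth_open_const[OF N open_UNIV] smooth_open_id[OF N] UNIV_I]
    by (simp add: tmap_id[OF N] tmap_const[OF N M])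
  finally show "tmap N L (\<lambda>y. F (a, y)) b w = tmap (prod_mfd M N) L F (a, b) (0, w)" .
  have "tmap M L (\<lambda>x. F (x, b)) a v = tmap (prod_mfd M N) L F (a, b) (tmap M (prod_mfd M N) (\<lambda>x. (x, b)) a v)"
    by (rule tmap_compose[OF M P L smooth_open_Pair[OF M N M smooth_open_id[OF M] smooth_open_const[OF M open_UNIV]] F])
      (simp_all add: ab)
  also have "tmap M (prod_mfd M N) (\<lambda>x. (x, b)) a v = (v, 0)"
    using tmap_Pair[OF M N M smooth_open_id[OF M] smooth_open_const[OF M open_UNIV] UNIV_I]
    by (simp add: tmap_id[OF M] tmap_const[OF M N])
  finally show "tmap M L (\<lambda>x. F (x, b)) a v = tmap (prod_mfd M N) L F (a, b) (v, 0)" .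
qed

locale pbundle =
  fixes MG :: "('g::{t2_space, second_countable_topology}, 'w::real_normed_vector) charted"
    and G :: "'g monoid"
    and B :: "('x::{t2_space, second_countable_topology}, 'u::real_normed_vector) charted"
    and P :: "('p::{t2_space, second_countable_topology}, 'r::real_normed_vector, 'g, 'x, 'y) gbundle"
  assumes lie: "lie_group MG G" and base: "smooth_manifold B" and principal: "principal_bundle MG G B P"
begin

section \<open>Smoothness of the structure maps\<close>

lemma MG_mfd: "smooth_manifold MG" and grp: "group G" and carrier: "carrier G = UNIV"
  using lie by (auto simp: lie_group_def)

lemma Tot_mfd: "smooth_manifold (Tot P)"
  using principal by (simp add: principal_bundle_def)

lemma Tot_MG_mfd: "smooth_manifold (prod_mfd (Tot P) MG)"
  by (rule prod_mfd_smooth_manifold[OF Tot_mfd MG_mfd])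

lemma MG_MG_mfd: "smooth_manifold (prod_mfd MG MG)"
  by (rule prod_mfd_smooth_manifold[OF MG_mfd MG_mfd])

lemma proj_smooth: "smooth_open (Tot P) B UNIV (proj P)"
  using principal by (intro smooth_map_on_open Tot_mfd base) (auto simp: principal_bundle_def)

lemma act_smooth: "smooth_open (prod_mfd (Tot P) MG) (Tot P) UNIV (\<lambda>(a, g). ract P a g)"
  using principal by (intro smooth_map_on_open Tot_mfd Tot_MG_mfd) (auto simp: principal_bundle_def)

lemma mult_smooth: "smooth_open (prod_mfd MG MG) MG UNIV (\<lambda>(g, h). g \<otimes>\<^bsub>G\<^esub> h)"
  using lie by (intro smooth_map_on_open MG_mfd MG_MG_mfd) (auto simp: lie_group_def)

lemma ract_one [simp]: "ract P a \<one>\<^bsub>G\<^esub> = a"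
  and ract_ract: "ract P (ract P a g) h = ract P a (g \<otimes>\<^bsub>G\<^esub> h)"
  and proj_ract [simp]: "proj P (ract P a g) = proj P a"
  using principal by (auto simp: principal_bundle_def)

lemma ract_smooth: "smooth_open (Tot P) (Tot P) UNIV (\<lambda>b. ract P b g)"
  using smooth_open_compose[OF Tot_mfd Tot_MG_mfd Tot_mfd smooth_open_Pair[OF Tot_mfd MG_mfd Tot_mfd smooth_open_id[OF Tot_mfd] smooth_open_const[OF Tot_mfd open_UNIV]] act_smooth]
  by simp

lemma orbit_smooth: "smooth_open MG (Tot P) UNIV (\<lambda>g. ract P a g)"
  using smooth_open_compose[OF MG_mfd Tot_MG_mfd Tot_mfd smooth_open_Pair[OF Tot_mfd MG_mfd MG_mfd smooth_open_const[OF MG_mfd open_UNIV] smooth_open_id[OF MG_mfd]] act_smooth]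
  by simp

lemma lmult_smooth: "smooth_open MG MG UNIV (\<lambda>h. g \<otimes>\<^bsub>G\<^esub> h)"
  using smooth_open_compose[OF MG_mfd MG_MG_mfd MG_mfd smooth_open_Pair[OF MG_mfd MG_mfd MG_mfd smooth_open_const[OF MG_mfd open_UNIV] smooth_open_id[OF MG_mfd]] mult_smooth]
  by simp

lemma conj_smooth: "smooth_open MG MG UNIV (\<lambda>h. g \<otimes>\<^bsub>G\<^esub> h \<otimes>\<^bsub>G\<^esub> k)"
  using smooth_open_compose[OF MG_mfd MG_MG_mfd MG_mfd smooth_open_Pair[OF MG_mfd MG_mfd MG_mfd lmult_smooth smooth_open_const[OF MG_mfd open_UNIV]] mult_smooth]
  by simp

lemma mult_inv_cancel: "g \<otimes>\<^bsub>G\<^esub> (inv\<^bsub>G\<^esub> g \<otimes>\<^bsub>G\<^esub> h) = h" "inv\<^bsub>G\<^esub> g \<otimes>\<^bsub>G\<^esub> (g \<otimes>\<^bsub>G\<^esub> h) = h"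
proof -
  interpret group G by (rule grp)
  show "g \<otimes>\<^bsub>G\<^esub> (inv\<^bsub>G\<^esub> g \<otimes>\<^bsub>G\<^esub> h) = h" "inv\<^bsub>G\<^esub> g \<otimes>\<^bsub>G\<^esub> (g \<otimes>\<^bsub>G\<^esub> h) = h"
    by (simp_all add: carrier m_assoc[symmetric])
qed

section \<open>Trivialisations and fibres\<close>

lemma trivialization:
  obtains U \<tau> where "open U" "x \<in> U" "bij_betw \<tau> (proj P -` U) (U \<times> UNIV)"
    "smooth_open (Tot P) (prod_mfd B MG) (proj P -` U) \<tau>"
    "smooth_open (prod_mfd B MG) (Tot P) (U \<times> UNIV) (inv_into (proj P -` U) \<tau>)"
    "\<And>a. proj P a \<in> U \<Longrightarrow> fst (\<tau> a) = proj P a"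
    "\<And>a g. proj P a \<in> U \<Longrightarrow> \<tau> (ract P a g) = (proj P a, snd (\<tau> a) \<otimes>\<^bsub>G\<^esub> g)"
proof -
  obtain U and \<tau> :: "'p \<Rightarrow> 'x \<times> 'g" where *: "open U" "x \<in> U" "bij_betw \<tau> (proj P -` U) (U \<times> UNIV)"
    "smooth_map_on (Tot P) (prod_mfd B MG) (proj P -` U) \<tau>"
    "smooth_map_on (prod_mfd B MG) (Tot P) (U \<times> UNIV) (inv_into (proj P -` U) \<tau>)"
    "\<forall>a\<in>proj P -` U. fst (\<tau> a) = proj P a \<and> (\<forall>g. \<tau> (ract P a g) = (proj P a, snd (\<tau> a) \<otimes>\<^bsub>G\<^esub> g))"
    using principal unfolding principal_bundle_def by blast
  note BG = prod_mfd_smooth_manifold[OF base MG_mfd]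
  have "open (proj P -` U)" using smooth_open_preimage[OF proj_smooth *(1)] by simp
  then have "smooth_open (Tot P) (prod_mfd B MG) (proj P -` U) \<tau>"
    by (rule smooth_map_on_open[OF Tot_mfd BG _ *(4)])
  moreover have "smooth_open (prod_mfd B MG) (Tot P) (U \<times> UNIV) (inv_into (proj P -` U) \<tau>)"
    by (rule smooth_map_on_open[OF BG Tot_mfd open_Times[OF *(1) open_UNIV] *(5)])
  ultimately show ?thesis using * by (intro that[of U \<tau>]) auto
qed

text \<open>A trivialisation turns the action into right multiplication in the group, where
  cancellation is available; transitivity on fibres is read off in the same way.\<close>

lemma ract_free: "ract P a g = ract P a h \<Longrightarrow> g = h"
proof -
  assume eq: "ract P a g = ract P a h"
  obtain U and \<tau> :: "'p \<Rightarrow> 'x \<times> 'g" where \<tau>: "proj P a \<in> U"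
    "\<And>a g. proj P a \<in> U \<Longrightarrow> \<tau> (ract P a g) = (proj P a, snd (\<tau> a) \<otimes>\<^bsub>G\<^esub> g)"
    using trivialization[of "proj P a"] by metis
  have "snd (\<tau> a) \<otimes>\<^bsub>G\<^esub> g = snd (\<tau> a) \<otimes>\<^bsub>G\<^esub> h"
    using \<tau>(2)[OF \<tau>(1), of g] \<tau>(2)[OF \<tau>(1), of h] eq by simp
  then show ?thesis using mult_inv_cancel(2) by metis
qed

lemma ract_transitive:
  assumes "proj P a = proj P b"
  obtains g where "b = ract P a g"
proof -
  obtain U and \<tau> :: "'p \<Rightarrow> 'x \<times> 'g" where \<tau>: "proj P a \<in> U" "bij_betw \<tau> (proj P -` U) (U \<times> UNIV)"
    "\<And>a. proj P a \<in> U \<Longrightarrow> fst (\<tau> a) = proj P a"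
    "\<And>a g. proj P a \<in> U \<Longrightarrow> \<tau> (ract P a g) = (proj P a, snd (\<tau> a) \<otimes>\<^bsub>G\<^esub> g)"
    using trivialization[of "proj P a"] by metis
  define g where "g = inv\<^bsub>G\<^esub> (snd (\<tau> a)) \<otimes>\<^bsub>G\<^esub> snd (\<tau> b)"
  have "snd (\<tau> a) \<otimes>\<^bsub>G\<^esub> g = snd (\<tau> b)"
    unfolding g_def by (rule mult_inv_cancel)
  then have "\<tau> (ract P a g) = \<tau> b"
    using \<tau>(3)[of b] \<tau>(4)[OF \<tau>(1), of g] \<tau>(1) assms by (simp add: prod_eq_iff)
  moreover have "inj_on \<tau> (proj P -` U)" using \<tau>(2) by (rule bij_betw_imp_inj_on)
  ultimately have "ract P a g = b" using \<tau>(1) assms by (auto dest: inj_onD)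
  then show ?thesis using that by blast
qed

lemma fibre_eq: "{b. proj P b = proj P a} = range (ract P a)"
proof (intro equalityI subsetI)
  fix b assume "b \<in> {b. proj P b = proj P a}"
  then have "proj P a = proj P b" by simp
  then obtain g where "b = ract P a g" by (rule ract_transitive)
  then show "b \<in> range (ract P a)" by simp
qed auto

lemma fibre_nonempty: obtains a where "proj P a = x"
proof -
  obtain U and \<tau> :: "'p \<Rightarrow> 'x \<times> 'g" where \<tau>: "x \<in> U" "bij_betw \<tau> (proj P -` U) (U \<times> UNIV)"
    "\<And>a. proj P a \<in> U \<Longrightarrow> fst (\<tau> a) = proj P a"
    using trivialization[of x] by metis
  have "(x, undefined) \<in> \<tau> ` (proj P -` U)" using \<tau>(1,2) by (auto simp: bij_betw_def)
  then obtain a where "proj P a \<in> U" "\<tau> a = (x, undefined)" by auto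
  then have "proj P a = x" using \<tau>(3)[of a] by simp
  then show ?thesis using that by blast
qed

subsection \<open>Orbits\<close>

text \<open>Common form of \<open>T_class\<close> and \<open>ad_class\<close>, so that the fibrewise
  linear structure is treated once for both bundles.\<close>

definition orbit :: "('g \<Rightarrow> 'p \<Rightarrow> 'v \<Rightarrow> 'v) \<Rightarrow> 'p \<Rightarrow> 'v \<Rightarrow> ('p \<times> 'v) set" where
  "orbit \<rho> a v = {(ract P a g, \<rho> g a v) | g. True}"

text \<open>Linearity together with the condition that \<rho> lifts the right action to the trivial
  bundle with fibre \<open>'v\<close>; this makes an orbit independent of the pair that generates
  it.\<close>

definition cocycle :: "('g \<Rightarrow> 'p \<Rightarrow> 'v::real_vector \<Rightarrow> 'v) \<Rightarrow> bool" where
  "cocycle \<rho> \<longleftrightarrow> (\<forall>g a. linear (\<rho> g a)) \<and> (\<forall>a v. \<rho> \<one>\<^bsub>G\<^esub> a v = v) \<and>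
     (\<forall>g h a v. \<rho> h (ract P a g) (\<rho> g a v) = \<rho> (g \<otimes>\<^bsub>G\<^esub> h) a v)"

context
  fixes \<rho> :: "'g \<Rightarrow> 'p \<Rightarrow> 'v::real_vector \<Rightarrow> 'v"
  assumes \<rho>: "cocycle \<rho>"
begin

lemma orbit_mem_iff: "(ract P a g, w) \<in> orbit \<rho> a v \<longleftrightarrow> w = \<rho> g a v"
  by (auto simp: orbit_def dest: ract_free)

lemma orbit_mem_self_iff: "(a, w) \<in> orbit \<rho> a v \<longleftrightarrow> w = v"
  using orbit_mem_iff[of a "\<one>\<^bsub>G\<^esub>"] \<rho> by (simp add: cocycle_def)

lemma orbit_shift: "orbit \<rho> (ract P a g) (\<rho> g a v) = orbit \<rho> a v"
proof -
  have *: "(ract P (ract P a g) h, \<rho> h (ract P a g) (\<rho> g a v)) = (ract P a (g \<otimes>\<^bsub>G\<^esub> h), \<rho> (g \<otimes>\<^bsub>G\<^esub> h) a v)" for h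
    using \<rho> by (simp add: cocycle_def ract_ract)
  let ?F = "\<lambda>k. (ract P a k, \<rho> k a v)"
  \<comment> \<open>Left translation by \<open>g\<close> is onto, so it merely reparametrises the
    orbit.\<close>
  have r: "range (\<lambda>h. g \<otimes>\<^bsub>G\<^esub> h) = UNIV"
    by (rule surjI[of _ "\<lambda>k. inv\<^bsub>G\<^esub> g \<otimes>\<^bsub>G\<^esub> k"]) (rule mult_inv_cancel(1))
  have "{?F (g \<otimes>\<^bsub>G\<^esub> h) | h. True} = ?F ` range (\<lambda>h. g \<otimes>\<^bsub>G\<^esub> h)" by auto
  also have "\<dots> = {?F k | k. True}" unfolding r by auto
  finally show ?thesis unfolding orbit_def * .
qed

lemma cl_at_orbit: "cl_at a (orbit \<rho> a v) = v"
  by (simp add: cl_at_def orbit_mem_self_iff)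

lemma cl_at_orbit_ract: "cl_at (ract P a g) (orbit \<rho> a v) = \<rho> g a v"
  by (simp add: cl_at_def orbit_mem_iff)

lemma orbit_eq_iff: "orbit \<rho> a v = orbit \<rho> a w \<longleftrightarrow> v = w"
  by (metis cl_at_orbit)

lemma orbit_rep:
  assumes "proj P a = proj P b"
  obtains w where "orbit \<rho> b v = orbit \<rho> a w"
proof -
  obtain g where "a = ract P b g" using ract_transitive[of b a] assms by metis
  then show ?thesis using orbit_shift[of b g v] that by metis
qed

lemma orbit_add: "cl_add (orbit \<rho> a v) (orbit \<rho> a w) = orbit \<rho> a (v + w)"
proof -
  have "cl_add (orbit \<rho> a v) (orbit \<rho> a w) = {(ract P a g, \<rho> g a v + \<rho> g a w) | g. True}"
    unfolding cl_add_def by (auto simp: orbit_def dest: ract_free)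
  then show ?thesis using \<rho> by (simp add: orbit_def cocycle_def linear_add)
qed

lemma orbit_diff: "cl_diff (orbit \<rho> a v) (orbit \<rho> a w) = orbit \<rho> a (v - w)"
proof -
  have "cl_diff (orbit \<rho> a v) (orbit \<rho> a w) = {(ract P a g, \<rho> g a v - \<rho> g a w) | g. True}"
    unfolding cl_diff_def by (auto simp: orbit_def dest: ract_free)
  then show ?thesis using \<rho> by (simp add: orbit_def cocycle_def linear_diff)
qed

lemma orbit_scale: "cl_scale r (orbit \<rho> a v) = orbit \<rho> a (r *\<^sub>R v)"
proof -
  have "cl_scale r (orbit \<rho> a v) = {(ract P a g, r *\<^sub>R \<rho> g a v) | g. True}"
    unfolding cl_scale_def by (auto simp: orbit_def)
  then show ?thesis using \<rho> by (simp add: orbit_def cocycle_def linear_scale)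
qed

lemma orbit_zero: "cl_zero P (proj P a) = orbit \<rho> a 0"
proof -
  have "cl_zero P (proj P a) = (\<lambda>b. (b, 0)) ` {b. proj P b = proj P a}"
    by (auto simp: cl_zero_def)
  also have "\<dots> = {(ract P a g, 0) | g. True}"
    unfolding fibre_eq by auto
  finally have "cl_zero P (proj P a) = {(ract P a g, 0) | g. True}" .
  then show ?thesis using \<rho> by (simp add: orbit_def cocycle_def linear_0)
qed

end

abbreviation dR :: "'g \<Rightarrow> 'p \<Rightarrow> 'r \<Rightarrow> 'r" where
  "dR g a \<equiv> tmap (Tot P) (Tot P) (\<lambda>b. ract P b g) a"

text \<open>The point is a dummy argument that gives the adjoint representation the shape of a
  cocycle; the inverse turns the left action into a right one.\<close>

abbreviation Adi :: "'g \<Rightarrow> 'p \<Rightarrow> 'w \<Rightarrow> 'w" where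
  "Adi g a \<equiv> Ad MG G (inv\<^bsub>G\<^esub> g)"

section \<open>The tangent and adjoint bundles as instances\<close>

lemma T_class_orbit: "T_class P = orbit dR"
  by (intro ext) (simp add: T_class_def orbit_def)

lemma ad_class_orbit: "ad_class MG G P = orbit Adi"
  by (intro ext) (simp add: ad_class_def orbit_def)

lemma dR_cocycle: "cocycle dR"
  unfolding cocycle_def
proof (intro conjI allI)
  show "linear (dR g a)" for g a by (rule tmap_linear[OF Tot_mfd Tot_mfd ract_smooth UNIV_I])
  show "dR \<one>\<^bsub>G\<^esub> a v = v" for a v by (simp add: tmap_id[OF Tot_mfd])
  show "dR h (ract P a g) (dR g a v) = dR (g \<otimes>\<^bsub>G\<^esub> h) a v" for g h a v
    using tmap_compose[OF Tot_mfd Tot_mfd Tot_mfd ract_smooth ract_smooth UNIV_I UNIV_I, of g h a v] by (simp add: ract_ract)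
qed

lemma conj_one: "g \<otimes>\<^bsub>G\<^esub> \<one>\<^bsub>G\<^esub> \<otimes>\<^bsub>G\<^esub> inv\<^bsub>G\<^esub> g = \<one>\<^bsub>G\<^esub>"
  using grp carrier by (simp add: group.is_monoid monoid.r_one group.r_inv)

lemma Ad_mult: "Ad MG G (g \<otimes>\<^bsub>G\<^esub> h) A = Ad MG G g (Ad MG G h A)"
proof -
  interpret group G by (rule grp)
  have "(g \<otimes>\<^bsub>G\<^esub> h) \<otimes>\<^bsub>G\<^esub> k \<otimes>\<^bsub>G\<^esub> inv\<^bsub>G\<^esub> (g \<otimes>\<^bsub>G\<^esub> h) = g \<otimes>\<^bsub>G\<^esub> (h \<otimes>\<^bsub>G\<^esub> k \<otimes>\<^bsub>G\<^esub> inv\<^bsub>G\<^esub> h) \<otimes>\<^bsub>G\<^esub> inv\<^bsub>G\<^esub> g" for k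
    by (simp add: carrier inv_mult_group m_assoc)
  then show ?thesis
    unfolding Ad_def
    using tmap_compose[OF MG_mfd MG_mfd MG_mfd conj_smooth[of h "inv\<^bsub>G\<^esub> h"] conj_smooth[of g "inv\<^bsub>G\<^esub> g"] UNIV_I UNIV_I, of "\<one>\<^bsub>G\<^esub>" A]
    by (simp add: conj_one)
qed

lemma Adi_cocycle: "cocycle Adi"
proof -
  interpret group G by (rule grp)
  have "linear (Ad MG G g)" for g
    unfolding Ad_def by (rule tmap_linear[OF MG_mfd MG_mfd conj_smooth UNIV_I])
  moreover have "Ad MG G \<one>\<^bsub>G\<^esub> A = A" for A
    unfolding Ad_def by (simp add: carrier tmap_id[OF MG_mfd])
  ultimately show ?thesis
    unfolding cocycle_def by (simp add: carrier inv_mult_group Ad_mult)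
qed

lemmas T_class_simps = orbit_mem_iff[OF dR_cocycle, folded T_class_orbit] orbit_mem_self_iff[OF dR_cocycle, folded T_class_orbit]
lemmas T_class_shift = orbit_shift[OF dR_cocycle, folded T_class_orbit]
lemmas cl_at_T_class = cl_at_orbit[OF dR_cocycle, folded T_class_orbit]
lemmas T_class_rep = orbit_rep[OF dR_cocycle, folded T_class_orbit]
lemmas T_class_add = orbit_add[OF dR_cocycle, folded T_class_orbit]
lemmas T_class_diff = orbit_diff[OF dR_cocycle, folded T_class_orbit]
lemmas T_class_scale = orbit_scale[OF dR_cocycle, folded T_class_orbit]
lemmas cl_at_ad_class = cl_at_orbit[OF Adi_cocycle, folded ad_class_orbit]
lemmas cl_at_ad_class_ract = cl_at_orbit_ract[OF Adi_cocycle, folded ad_class_orbit]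
lemmas ad_class_eq_iff = orbit_eq_iff[OF Adi_cocycle, folded ad_class_orbit]
lemmas ad_class_rep = orbit_rep[OF Adi_cocycle, folded ad_class_orbit]
lemmas ad_class_add = orbit_add[OF Adi_cocycle, folded ad_class_orbit]
lemmas ad_class_scale = orbit_scale[OF Adi_cocycle, folded ad_class_orbit]
lemmas ad_class_zero = orbit_zero[OF Adi_cocycle, folded ad_class_orbit]

lemma T_fibre_iff: "Q \<in> T_fibre P (proj P a) \<longleftrightarrow> (\<exists>w. Q = T_class P a w)"
  unfolding T_fibre_def by auto (metis T_class_rep)

lemma ad_fibre_iff: "Q \<in> ad_fibre MG G P (proj P a) \<longleftrightarrow> (\<exists>A. Q = ad_class MG G P a A)"
  unfolding ad_fibre_def by auto (metis ad_class_rep)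

subsection \<open>Vertical vectors and local sections\<close>

abbreviation d\<pi> :: "'p \<Rightarrow> 'r \<Rightarrow> 'u" where
  "d\<pi> \<equiv> tmap (Tot P) B (proj P)"

abbreviation fund :: "'p \<Rightarrow> 'w \<Rightarrow> 'r" where
  "fund \<equiv> fundamental MG G P"

lemma d\<pi>_linear: "linear (d\<pi> a)"
  by (rule tmap_linear[OF Tot_mfd base proj_smooth UNIV_I])

lemma fund_linear: "linear (fund a)"
  unfolding fundamental_def by (rule tmap_linear[OF MG_mfd Tot_mfd orbit_smooth UNIV_I])

lemma d\<pi>_dR: "d\<pi> (ract P a g) (dR g a w) = d\<pi> a w"
  using tmap_compose[OF Tot_mfd Tot_mfd base ract_smooth proj_smooth UNIV_I UNIV_I, of g a w] by simp

lemma d\<pi>_fund: "d\<pi> a (fund a A) = 0"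
  using tmap_compose[OF MG_mfd Tot_mfd base orbit_smooth proj_smooth UNIV_I UNIV_I, of a "\<one>\<^bsub>G\<^esub>" A]
  by (simp add: fundamental_def tmap_const[OF MG_mfd base])

lemma fund_act: "fund a A = tmap (prod_mfd (Tot P) MG) (Tot P) (\<lambda>(a, g). ract P a g) (a, \<one>\<^bsub>G\<^esub>) (0, A)"
  unfolding fundamental_def using tmap_partial(1)[OF Tot_mfd MG_mfd Tot_mfd act_smooth UNIV_I] by simp

text \<open>Differentiates the identity (a h) g = (a g)(g^-1 h g) with respect to h at the
  unit.\<close>

lemma dR_fund: "dR g a (fund a A) = fund (ract P a g) (Adi g a A)"
proof -
  interpret group G by (rule grp)
  let ?c = "\<lambda>h. inv\<^bsub>G\<^esub> g \<otimes>\<^bsub>G\<^esub> h \<otimes>\<^bsub>G\<^esub> inv\<^bsub>G\<^esub> (inv\<^bsub>G\<^esub> g)"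
  have "g \<otimes>\<^bsub>G\<^esub> ?c h = h \<otimes>\<^bsub>G\<^esub> g" for h
    by (simp add: carrier m_assoc[symmetric])
  then have "ract P (ract P a g) (?c h) = ract P (ract P a h) g" for h
    by (simp only: ract_ract)
  then show ?thesis
    using tmap_compose[OF MG_mfd Tot_mfd Tot_mfd orbit_smooth ract_smooth UNIV_I UNIV_I, of a g "\<one>\<^bsub>G\<^esub>" A]
      tmap_compose[OF MG_mfd MG_mfd Tot_mfd conj_smooth orbit_smooth UNIV_I UNIV_I, of "ract P a g" "inv\<^bsub>G\<^esub> g" "inv\<^bsub>G\<^esub> (inv\<^bsub>G\<^esub> g)" "\<one>\<^bsub>G\<^esub>" A]
    by (simp only: fundamental_def Ad_def conj_one ract_one)
qed

text \<open>Local coordinates adapted to \<open>a\<close>: a section \<open>s\<close> through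
  \<open>a\<close> and a group coordinate \<open>k\<close> measuring the displacement from it,
  normalised to the unit at \<open>a\<close>.\<close>

lemma local_decomposition:
  obtains U s k where "open U" "proj P a \<in> U" "smooth_open B (Tot P) U s" "smooth_open (Tot P) MG (proj P -` U) k"
    "\<And>x. x \<in> U \<Longrightarrow> proj P (s x) = x" "s (proj P a) = a"
    "\<And>b. proj P b \<in> U \<Longrightarrow> ract P (s (proj P b)) (k b) = b" "k a = \<one>\<^bsub>G\<^esub>"
proof -
  interpret group G by (rule grp)
  note BG = prod_mfd_smooth_manifold[OF base MG_mfd]
  obtain U and \<tau> :: "'p \<Rightarrow> 'x \<times> 'g" where \<tau>: "open U" "proj P a \<in> U" "bij_betw \<tau> (proj P -` U) (U \<times> UNIV)"
    "smooth_open (Tot P) (prod_mfd B MG) (proj P -` U) \<tau>"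
    "smooth_open (prod_mfd B MG) (Tot P) (U \<times> UNIV) (inv_into (proj P -` U) \<tau>)"
    "\<And>a. proj P a \<in> U \<Longrightarrow> fst (\<tau> a) = proj P a"
    "\<And>a g. proj P a \<in> U \<Longrightarrow> \<tau> (ract P a g) = (proj P a, snd (\<tau> a) \<otimes>\<^bsub>G\<^esub> g)"
    using trivialization[of "proj P a"] by metis
  have inj: "inj_on \<tau> (proj P -` U)" and im: "\<tau> ` (proj P -` U) = U \<times> UNIV"
    using \<tau>(3) by (auto simp: bij_betw_def)
  \<comment> \<open>The group coordinate of \<open>a\<close> in the trivialisation. The section
    keeps this coordinate constant, and translating by its inverse makes \<open>k a\<close> the
    unit.\<close>
  define g where "g = snd (\<tau> a)"
  define s where "s x = inv_into (proj P -` U) \<tau> (x, g)" for x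
  define k where "k b = inv\<^bsub>G\<^esub> g \<otimes>\<^bsub>G\<^esub> snd (\<tau> b)" for b
  have s: "proj P (s x) \<in> U" "\<tau> (s x) = (x, g)" if "x \<in> U" for x
    using inv_into_into[of "(x, g)" \<tau> "proj P -` U"] f_inv_into_f[of "(x, g)" \<tau> "proj P -` U"] im that
    by (auto simp: s_def)
  have ps: "proj P (s x) = x" if "x \<in> U" for x
    using \<tau>(6)[OF s(1)[OF that]] s(2)[OF that] by simp
  have a: "\<tau> a = (proj P a, g)" using \<tau>(6)[OF \<tau>(2)] by (simp add: g_def prod_eq_iff)
  have sa: "s (proj P a) = a"
    by (rule inj_onD[OF inj]) (use s[OF \<tau>(2)] a \<tau>(2) in simp_all)
  have k: "ract P (s (proj P b)) (k b) = b" if b: "proj P b \<in> U" for b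
  proof -
    have "\<tau> (ract P (s (proj P b)) (k b)) = (proj P b, g \<otimes>\<^bsub>G\<^esub> k b)"
      using \<tau>(7)[of "s (proj P b)"] s[OF b] ps[OF b] by simp
    also have "g \<otimes>\<^bsub>G\<^esub> k b = snd (\<tau> b)" by (simp add: k_def carrier m_assoc[symmetric])
    also have "(proj P b, snd (\<tau> b)) = \<tau> b" using \<tau>(6)[OF b] by (simp add: prod_eq_iff)
    finally show ?thesis by (rule inj_onD[OF inj]) (use ps[OF b] b in simp_all)
  qed
  have ka: "k a = \<one>\<^bsub>G\<^esub>" by (simp add: k_def a carrier)
  have ss: "smooth_open B (Tot P) U s"
    unfolding s_def
    by (rule smooth_open_compose[OF base BG Tot_mfd smooth_open_Pair[OF base MG_mfd base smooth_open_ident[OF base \<tau>(1)]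
            smooth_open_const[OF base \<tau>(1)]] \<tau>(5)]) simp
  have sk: "smooth_open (Tot P) MG (proj P -` U) k"
    unfolding k_def
    by (intro smooth_open_compose[OF Tot_mfd MG_mfd MG_mfd _ lmult_smooth] smooth_open_compose[OF Tot_mfd BG MG_mfd \<tau>(4) tmap_snd(1)[OF base MG_mfd]]) auto
  show ?thesis by (rule that[OF \<tau>(1,2) ss sk ps sa k ka])
qed

text \<open>Differentiates \<open>b = ract P (s (proj P b)) (k b)\<close> at \<open>b = a\<close>;
  the two partial derivatives of the action there are the identity and
  \<open>fund a\<close>.\<close>

lemma local_decomposition_tangent:
  obtains s k where "\<And>v. d\<pi> a (s v) = v" "\<And>w. w = s (d\<pi> a w) + fund a (k w)"
proof -
  obtain U s k where *: "open U" "proj P a \<in> U" "smooth_open B (Tot P) U s" "smooth_open (Tot P) MG (proj P -` U) k"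
    "\<And>x. x \<in> U \<Longrightarrow> proj P (s x) = x" "s (proj P a) = a"
    "\<And>b. proj P b \<in> U \<Longrightarrow> ract P (s (proj P b)) (k b) = b" "k a = \<one>\<^bsub>G\<^esub>"
    using local_decomposition by metis
  let ?V = "proj P -` U" and ?act = "\<lambda>(a, g). ract P a g"
  have V: "open ?V" using smooth_open_preimage[OF proj_smooth *(1)] by simp
  have pV: "smooth_open (Tot P) B ?V (proj P)" by (rule smooth_open_subset[OF proj_smooth V]) auto
  have sp: "smooth_open (Tot P) (Tot P) ?V (\<lambda>b. s (proj P b))"
    by (rule smooth_open_compose[OF Tot_mfd base Tot_mfd pV *(3)]) auto
  have aV: "a \<in> ?V" using *(2) by simp
  have "d\<pi> a (tmap B (Tot P) s (proj P a) v) = v" for v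
  proof -
    have "d\<pi> a (tmap B (Tot P) s (proj P a) v) = tmap B B (\<lambda>x. proj P (s x)) (proj P a) v"
      using tmap_compose[OF base Tot_mfd base *(3) proj_smooth *(2) UNIV_I] by (simp add: *(6))
    also have "\<dots> = tmap B B (\<lambda>x. x) (proj P a) v"
      by (rule fun_cong[OF tmap_cong_open[OF base base smooth_open_id[OF base] UNIV_I *(1,2)]]) (simp add: *(5))
    finally show ?thesis by (simp add: tmap_id[OF base])
  qed
  moreover have "w = tmap B (Tot P) s (proj P a) (d\<pi> a w) + fund a (tmap (Tot P) MG k a w)" for w
  proof -
    have "w = tmap (Tot P) (Tot P) (\<lambda>b. b) a w" by (simp add: tmap_id[OF Tot_mfd])
    also have "\<dots> = tmap (Tot P) (Tot P) (\<lambda>b. ?act (s (proj P b), k b)) a w"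
      by (rule fun_cong[OF tmap_cong_open[OF Tot_mfd Tot_mfd smooth_open_id[OF Tot_mfd] UNIV_I V aV], symmetric]) (simp add: *(7))
    also have "\<dots> = tmap (prod_mfd (Tot P) MG) (Tot P) ?act (a, \<one>\<^bsub>G\<^esub>)
        (tmap (Tot P) (prod_mfd (Tot P) MG) (\<lambda>b. (s (proj P b), k b)) a w)"
      using tmap_compose[OF Tot_mfd Tot_MG_mfd Tot_mfd smooth_open_Pair[OF Tot_mfd MG_mfd Tot_mfd sp *(4)] act_smooth aV UNIV_I] *(6,8) by simp
    also have "tmap (Tot P) (prod_mfd (Tot P) MG) (\<lambda>b. (s (proj P b), k b)) a w
        = (tmap B (Tot P) s (proj P a) (d\<pi> a w), 0) + (0, tmap (Tot P) MG k a w)"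
      using tmap_Pair[OF Tot_mfd MG_mfd Tot_mfd sp *(4) aV] tmap_compose[OF Tot_mfd base Tot_mfd proj_smooth *(3) UNIV_I *(2)] by simp
    also have "tmap (prod_mfd (Tot P) MG) (Tot P) ?act (a, \<one>\<^bsub>G\<^esub>) \<dots>
        = tmap (prod_mfd (Tot P) MG) (Tot P) ?act (a, \<one>\<^bsub>G\<^esub>) (tmap B (Tot P) s (proj P a) (d\<pi> a w), 0)
          + fund a (tmap (Tot P) MG k a w)"
      unfolding fund_act by (rule linear_add[OF tmap_linear[OF Tot_MG_mfd Tot_mfd act_smooth UNIV_I]])
    also have "tmap (prod_mfd (Tot P) MG) (Tot P) ?act (a, \<one>\<^bsub>G\<^esub>) (tmap B (Tot P) s (proj P a) (d\<pi> a w), 0)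
        = tmap B (Tot P) s (proj P a) (d\<pi> a w)"
      using tmap_partial(2)[OF Tot_mfd MG_mfd Tot_mfd act_smooth UNIV_I, of "\<one>\<^bsub>G\<^esub>" a] by (simp add: tmap_id[OF Tot_mfd])
    finally show ?thesis .
  qed
  ultimately show ?thesis by (rule that)
qed

lemma vertical_fund:
  assumes "d\<pi> a w = 0"
  obtains A where "w = fund a A"
proof -
  obtain s k where *: "\<And>v. d\<pi> a (s v) = v" "\<And>w. w = s (d\<pi> a w) + fund a (k w)"
    using local_decomposition_tangent[of a] by metis
  have "d\<pi> a 0 = 0" "fund a (k 0) \<in> range (fund a)"
    using linear_0[OF d\<pi>_linear] by auto
  \<comment> \<open>Here \<open>s\<close> is a bare function with no linearity recorded, so
    \<open>s 0\<close> is computed from the decomposition of the zero vector.\<close>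
  then have "s 0 = - fund a (k 0)" using *(2)[of 0] by (simp add: eq_neg_iff_add_eq_0)
  then have "w = fund a (k w - k 0)" using *(2)[of w] assms by (simp add: linear_diff[OF fund_linear])
  then show ?thesis using that by blast
qed

lemma d\<pi>_surj: obtains w where "d\<pi> a w = v"
  using local_decomposition_tangent[of a] by metis

end

section \<open>Connections on principal bundles\<close>

text \<open>Contains the connection on the underlying bundle alone; equivariance under arrows enters
  in \<open>gconnection\<close>.\<close>

locale pconnection = pbundle MG G B P
  for MG :: "('g::{t2_space, second_countable_topology}, 'w::real_normed_vector) charted"
    and G :: "'g monoid"
    and B :: "('x::{t2_space, second_countable_topology}, 'u::real_normed_vector) charted"
    and P :: "('p::{t2_space, second_countable_topology}, 'r::real_normed_vector, 'g, 'x, 'y) gbundle" +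
  fixes \<D> :: "('p \<times> 'r) set \<Rightarrow> ('p \<times> 'w) set"
  assumes vb: "vb_morphism MG G P \<D>"
    and split: "\<And>x Q. Q \<in> ad_fibre MG G P x \<Longrightarrow> \<D> (jG MG G P Q) = Q"
begin

subsection \<open>The connection form and horizontal lifts\<close>

definition om :: "'p \<Rightarrow> 'r \<Rightarrow> 'w" where
  "om a w = cl_at a (\<D> (T_class P a w))"

lemmas \<D>_fibre = vb[unfolded vb_morphism_def, THEN conjunct1, rule_format]
lemmas \<D>_add = vb[unfolded vb_morphism_def, THEN conjunct2, THEN conjunct1, rule_format]
lemmas \<D>_scale = vb[unfolded vb_morphism_def, THEN conjunct2, THEN conjunct2, THEN conjunct1, rule_format]

lemma T_class_fibre: "T_class P a w \<in> T_fibre P (proj P a)"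
  unfolding T_fibre_def by blast

lemma ad_class_fibre: "ad_class MG G P a A \<in> ad_fibre MG G P (proj P a)"
  unfolding ad_fibre_def by blast

lemma \<D>_T_class: "\<D> (T_class P a w) = ad_class MG G P a (om a w)"
proof -
  have "\<D> (T_class P a w) \<in> ad_fibre MG G P (proj P a)"
    by (rule \<D>_fibre[OF T_class_fibre])
  then obtain A where "\<D> (T_class P a w) = ad_class MG G P a A"
    unfolding ad_fibre_iff by (elim exE)
  then show ?thesis by (simp add: om_def cl_at_ad_class)
qed

lemma om_linear: "linear (om a)"
proof (rule linearI)
  show "om a (v + w) = om a v + om a w" for v w
    using \<D>_add[OF T_class_fibre T_class_fibre, of a v w]
    by (simp add: T_class_add \<D>_T_class ad_class_add ad_class_eq_iff)
  show "om a (r *\<^sub>R v) = r *\<^sub>R om a v" for v r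
    using \<D>_scale[OF T_class_fibre, of r a v]
    by (simp add: T_class_scale \<D>_T_class ad_class_scale ad_class_eq_iff)
qed

lemma jG_ad_class: "jG MG G P (ad_class MG G P a A) = T_class P a (fund a A)"
proof -
  have "jG MG G P (ad_class MG G P a A) = {(ract P a g, fund (ract P a g) (Adi g a A)) | g. True}"
    unfolding jG_def ad_class_def by auto
  then show ?thesis by (simp add: T_class_def dR_fund)
qed

lemma om_fund: "om a (fund a A) = A"
proof -
  have "\<D> (T_class P a (fund a A)) = ad_class MG G P a A"
    using split[OF ad_class_fibre, of a A] by (simp add: jG_ad_class)
  then show ?thesis by (simp add: \<D>_T_class ad_class_eq_iff)
qed

lemma om_dR: "om (ract P a g) (dR g a w) = Adi g a (om a w)"
proof -
  have "om (ract P a g) (dR g a w) = cl_at (ract P a g) (\<D> (T_class P a w))"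
    by (simp add: om_def T_class_shift)
  then show ?thesis by (simp add: \<D>_T_class cl_at_ad_class_ract)
qed

lemma om_smooth: "open U \<Longrightarrow> vector_field_on (Tot P) U W \<Longrightarrow> smooth_fun_on (Tot P) U (\<lambda>a. om a (W a))"
  unfolding om_def
  by (rule vb[unfolded vb_morphism_def, THEN conjunct2, THEN conjunct2, THEN conjunct2, THEN spec[of _ U],
      THEN spec[of _ W], THEN mp]) (rule conjI)

lemma horizontal_vertical_zero:
  assumes "d\<pi> a w = 0" "om a w = 0"
  shows "w = 0"
proof -
  obtain A where "w = fund a A" using vertical_fund[OF assms(1)] .
  then show ?thesis using assms(2) by (simp add: om_fund linear_0[OF fund_linear])
qed

text \<open>Uniqueness comes from \<open>horizontal_vertical_zero\<close>; existence from
  \<open>hl_correct\<close>, applied to any lift of \<open>v\<close>.\<close>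

definition hl :: "'p \<Rightarrow> 'u \<Rightarrow> 'r" where
  "hl a v = (THE w. d\<pi> a w = v \<and> om a w = 0)"

lemma hl_eqI:
  assumes "d\<pi> a w = v" "om a w = 0"
  shows "hl a v = w"
  unfolding hl_def
proof (rule the_equality)
  fix w' assume "d\<pi> a w' = v \<and> om a w' = 0"
  then have "w' - w = 0"
    using assms by (intro horizontal_vertical_zero) (auto simp: linear_diff[OF d\<pi>_linear] linear_diff[OF om_linear])
  then show "w' = w" by simp
qed (use assms in auto)

text \<open>Removing the vertical part from a lift leaves a horizontal one. The formula also reduces
  smoothness of horizontal lifts to that of arbitrary smooth lifts.\<close>

lemma hl_correct: "hl a (d\<pi> a w) = w - fund a (om a w)"
  by (rule hl_eqI)
    (simp_all add: linear_diff[OF d\<pi>_linear] linear_diff[OF om_linear] d\<pi>_fund om_fund)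

lemma d\<pi>_hl [simp]: "d\<pi> a (hl a v) = v" and om_hl [simp]: "om a (hl a v) = 0"
proof -
  obtain w where w: "d\<pi> a w = v" using d\<pi>_surj .
  show "d\<pi> a (hl a v) = v" "om a (hl a v) = 0"
    unfolding w[symmetric] hl_correct
    by (simp_all add: linear_diff[OF d\<pi>_linear] linear_diff[OF om_linear] d\<pi>_fund om_fund)
qed

lemma hl_linear: "linear (hl a)"
  by (rule linearI; rule hl_eqI)
    (simp_all add: linear_add[OF d\<pi>_linear] linear_add[OF om_linear] linear_scale[OF d\<pi>_linear] linear_scale[OF om_linear])

lemma hl_dR: "dR g a (hl a v) = hl (ract P a g) v"
proof (rule hl_eqI[symmetric])
  have "linear (Adi g a)" using Adi_cocycle by (simp add: cocycle_def)
  then show "om (ract P a g) (dR g a (hl a v)) = 0" by (simp add: om_dR linear_0)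
qed (simp add: d\<pi>_dR)

lemma conn_section_eq: "conn_section B P \<D> (proj P a) v = T_class P a (hl a v)"
proof -
  have Tp: "T_proj B P (T_class P a w) = d\<pi> a w" for w
  proof -
    have "(a, w) \<in> T_class P a w" by (simp add: T_class_simps(2))
    moreover have "\<forall>(b, w')\<in>T_class P a w. d\<pi> b w' = d\<pi> a w" by (auto simp: T_class_def d\<pi>_dR)
    ultimately show ?thesis unfolding T_proj_def by (intro the_equality) auto
  qed
  have "\<D> (T_class P a w) = cl_zero P (proj P a) \<longleftrightarrow> om a w = 0" for w
    by (simp add: \<D>_T_class ad_class_zero ad_class_eq_iff)
  then show ?thesis
    unfolding conn_section_def T_fibre_iff
    by (intro the_equality) (auto simp: Tp hl_eqI[OF refl])
qed

lemma inv_field_conn_section: "inv_field P (\<lambda>x. conn_section B P \<D> x (V x)) = (\<lambda>a. hl a (V (proj P a)))"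
  by (simp add: fun_eq_iff inv_field_def conn_section_eq cl_at_T_class)

text \<open>Uses the local product structure: \<Theta> multiplies the section at a base point
  \<open>x\<close> by the group coordinate of \<open>b\<close>. Moving \<open>x\<close> along
  \<open>V\<close> with \<open>b\<close> fixed lifts \<open>V\<close>, because \<Theta> lies over
  \<open>x\<close>, and at \<open>x = proj P b\<close> the point \<Theta> is \<open>b\<close>
  itself.\<close>

lemma local_lift:
  fixes V :: "'x \<Rightarrow> 'u"
  assumes U: "open U" and V: "vector_field_on B U V" and a: "proj P a \<in> U"
  obtains W u where "open W" "a \<in> W" "W \<subseteq> proj P -` U" "vector_field_on (Tot P) W u"
    "\<And>b. b \<in> W \<Longrightarrow> d\<pi> b (u b) = V (proj P b)"
proof -
  obtain U' s k where *: "open U'" "proj P a \<in> U'" "smooth_open B (Tot P) U' s" "smooth_open (Tot P) MG (proj P -` U') k"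
    "\<And>x. x \<in> U' \<Longrightarrow> proj P (s x) = x" "s (proj P a) = a"
    "\<And>b. proj P b \<in> U' \<Longrightarrow> ract P (s (proj P b)) (k b) = b" "k a = \<one>\<^bsub>G\<^esub>"
    using local_decomposition by metis
  note BE = prod_mfd_smooth_manifold[OF base Tot_mfd]
  let ?act = "\<lambda>(a, g). ract P a g"
  let ?W = "proj P -` (U \<inter> U')"
  let ?O = "U' \<times> proj P -` U'"
  define \<Theta> where "\<Theta> z = ?act (s (fst z), k (snd z))" for z
  have W: "open ?W" using smooth_open_preimage[OF proj_smooth open_Int[OF U *(1)]] by simp
  have oU': "open (proj P -` U')" using smooth_open_preimage[OF proj_smooth *(1)] by simp
  have oO: "open ?O" by (rule open_Times[OF *(1) oU'])
  have fO: "smooth_open (prod_mfd B (Tot P)) B ?O fst"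
    by (rule smooth_open_subset[OF tmap_fst(1)[OF base Tot_mfd] oO]) auto
  have sO: "smooth_open (prod_mfd B (Tot P)) (Tot P) ?O snd"
    by (rule smooth_open_subset[OF tmap_snd(1)[OF base Tot_mfd] oO]) auto
  have \<Theta>: "smooth_open (prod_mfd B (Tot P)) (Tot P) ?O \<Theta>"
    unfolding \<Theta>_def
    by (rule smooth_open_compose[OF BE Tot_MG_mfd Tot_mfd smooth_open_Pair[OF Tot_mfd MG_mfd BE
            smooth_open_compose[OF BE base Tot_mfd fO *(3)] smooth_open_compose[OF BE Tot_mfd MG_mfd sO *(4)]] act_smooth]) auto
  have pW: "smooth_open (Tot P) B ?W (proj P)" by (rule smooth_open_subset[OF proj_smooth W]) auto
  have iW: "smooth_open (Tot P) (Tot P) ?W (\<lambda>b. b)" by (rule smooth_open_ident[OF Tot_mfd W])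
  define u where "u b = tmap (prod_mfd B (Tot P)) (Tot P) \<Theta> (proj P b, b) (V (proj P b), 0)" for b
  have \<psi>: "smooth_open (Tot P) (prod_mfd B (Tot P)) ?W (\<lambda>b. (proj P b, b))"
    by (rule smooth_open_Pair[OF base Tot_mfd Tot_mfd pW iW])
  have "smooth_along (Tot P) (prod_mfd B (Tot P)) ?W (\<lambda>b. (proj P b, b)) (\<lambda>b. (V (proj P b), 0))"
    by (rule smooth_along_Pair[OF base Tot_mfd Tot_mfd pW iW smooth_along_field[OF Tot_mfd base V U pW] smooth_along_zero[OF Tot_mfd Tot_mfd iW]]) auto
  then have along: "smooth_along (Tot P) (Tot P) ?W (\<lambda>b. \<Theta> (proj P b, b)) u"
    unfolding u_def by (rule smooth_along_tmap[OF Tot_mfd BE Tot_mfd \<psi> _ \<Theta>]) auto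
  have sm: "smooth_open (Tot P) (Tot P) ?W (\<lambda>b. \<Theta> (proj P b, b))"
    by (rule smooth_open_compose[OF Tot_mfd BE Tot_mfd \<psi> \<Theta>]) auto
  have "smooth_along (Tot P) (Tot P) ?W (\<lambda>b. b) u"
    by (rule smooth_along_cong[OF _ refl smooth_manifold_is_chart[OF Tot_mfd] along smooth_manifold_is_chart[OF Tot_mfd] sm])
      (simp_all add: \<Theta>_def *(7))
  then have vf: "vector_field_on (Tot P) ?W u" by (simp only: smooth_along_ident[OF Tot_mfd W])
  have proj_u: "d\<pi> b (u b) = V (proj P b)" if b: "b \<in> ?W" for b
  proof -
    have mem: "(proj P b, b) \<in> ?O" using b by auto
    have "d\<pi> b (u b) = d\<pi> (\<Theta> (proj P b, b)) (tmap (prod_mfd B (Tot P)) (Tot P) \<Theta> (proj P b, b) (V (proj P b), 0))"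
      using b by (simp add: u_def \<Theta>_def *(7))
    also have "\<dots> = tmap (prod_mfd B (Tot P)) B (\<lambda>z. proj P (\<Theta> z)) (proj P b, b) (V (proj P b), 0)"
      by (rule tmap_compose[OF BE Tot_mfd base \<Theta> proj_smooth mem UNIV_I, symmetric])
    also have "\<dots> = tmap (prod_mfd B (Tot P)) B fst (proj P b, b) (V (proj P b), 0)"
      by (rule fun_cong[OF tmap_cong_open[OF BE base tmap_fst(1)[OF base Tot_mfd] UNIV_I oO mem]])
        (auto simp: \<Theta>_def *(5))
    finally show ?thesis by (simp add: tmap_fst(2)[OF base Tot_mfd])
  qed
  show ?thesis
    by (rule that[OF W _ _ vf proj_u]) (use a *(2) in auto)
qed

text \<open>\<open>fund\<close> is the partial derivative of the smooth action in the group
  direction at the unit, so the field is a pushforward of the pair of zero and \<open>f\<close>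
  along \<open>b \<mapsto> (b, \<one>)\<close>.\<close>

lemma fund_smooth:
  assumes W: "open W" and f: "smooth_fun_on (Tot P) W f"
  shows "vector_field_on (Tot P) W (\<lambda>b. fund b (f b))"
proof -
  have iW: "smooth_open (Tot P) (Tot P) W (\<lambda>b. b)" by (rule smooth_open_ident[OF Tot_mfd W])
  have cW: "smooth_open (Tot P) MG W (\<lambda>b. \<one>\<^bsub>G\<^esub>)" by (rule smooth_open_const[OF Tot_mfd W])
  have "smooth_along (Tot P) (prod_mfd (Tot P) MG) W (\<lambda>b. (b, \<one>\<^bsub>G\<^esub>)) (\<lambda>b. (0, f b))"
    by (rule smooth_along_Pair[OF Tot_mfd MG_mfd Tot_mfd iW cW smooth_along_zero[OF Tot_mfd Tot_mfd iW] smooth_along_const[OF Tot_mfd MG_mfd f W]])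
  from smooth_along_tmap[OF Tot_mfd Tot_MG_mfd Tot_mfd smooth_open_Pair[OF Tot_mfd MG_mfd Tot_mfd iW cW] this act_smooth]
  show ?thesis by (simp add: fund_act smooth_along_ident[OF Tot_mfd W])
qed

lemma vector_field_on_diff:
  assumes M: "smooth_manifold M" and U: "open U" and "vector_field_on M U V" "vector_field_on M U W"
  shows "vector_field_on M U (\<lambda>x. V x - W x)"
  using assms(3,4) smooth_along_diff[OF M M smooth_open_ident[OF M U]] by (simp add: smooth_along_ident[OF M U, symmetric])

lemma hl_smooth:
  assumes U: "open U" and V: "vector_field_on B U V"
  shows "vector_field_on (Tot P) (proj P -` U) (\<lambda>a. hl a (V (proj P a)))"
proof (rule vector_field_on_glue[OF Tot_mfd])
  show "open (proj P -` U)" using smooth_open_preimage[OF proj_smooth U] by simp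
  fix a assume "a \<in> proj P -` U"
  then obtain W u where W: "open W" "a \<in> W" "W \<subseteq> proj P -` U" "vector_field_on (Tot P) W u"
    "\<And>b. b \<in> W \<Longrightarrow> d\<pi> b (u b) = V (proj P b)"
    using local_lift[OF U V, of a] by auto
  have "vector_field_on (Tot P) W (\<lambda>b. u b - fund b (om b (u b)))"
    by (intro vector_field_on_diff Tot_mfd W fund_smooth om_smooth)
  then have "vector_field_on (Tot P) W (\<lambda>a. hl a (V (proj P a)))"
    by (rule vector_field_on_cong[OF Tot_mfd W(1), rotated]) (simp add: W(5)[symmetric] hl_correct)
  then show "\<exists>W. open W \<and> a \<in> W \<and> W \<subseteq> proj P -` U \<and> vector_field_on (Tot P) W (\<lambda>a. hl a (V (proj P a)))"
    using W by blast
qed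

subsection \<open>Curvature\<close>

abbreviation hbr :: "('x \<Rightarrow> 'u) \<Rightarrow> ('x \<Rightarrow> 'u) \<Rightarrow> 'p \<Rightarrow> 'r" where
  "hbr V W \<equiv> lie_bracket (Tot P) (\<lambda>a. hl a (V (proj P a))) (\<lambda>a. hl a (W (proj P a)))"

text \<open>The connection form transplanted to the model space: both the point and the vector are
  given by coordinates in \<open>c\<close>.\<close>

definition om_rep :: "('p, 'r) chart \<Rightarrow> 'r \<Rightarrow> 'r \<Rightarrow> 'w" where
  "om_rep c y e = om (chart_inv c y) (tval (Tot P) c (chart_inv c y) e)"

text \<open>Since \<open>ext_deriv\<close> carries a minus sign, this is d\<omega> on horizontal
  lifts, so it depends on the two vectors alone. In the preferred chart at \<open>a\<close> a
  tangent vector is its own coordinate vector.\<close>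

definition curv :: "'p \<Rightarrow> 'u \<Rightarrow> 'u \<Rightarrow> 'w" where
  "curv a v w = - ext_deriv (om_rep (chart_at (Tot P) a)) (chart_map (chart_at (Tot P) a) a) (hl a v) (hl a w)"

lemma om_rep_apply: "c \<in> atlas (Tot P) \<Longrightarrow> a \<in> chart_dom c \<Longrightarrow> om_rep c (chart_map c a) (tcoord (Tot P) c a w) = om a w"
  by (simp add: om_rep_def chart_inv_map smooth_manifold_is_chart[OF Tot_mfd] tval_tcoord[OF Tot_mfd])

lemma om_rep_linear:
  assumes c: "c \<in> atlas (Tot P)" and y: "y \<in> chart_map c ` chart_dom c"
  shows "linear (om_rep c y)"
proof -
  obtain b where b: "b \<in> chart_dom c" "y = chart_map c b" using y by blast
  have "om_rep c y = om b \<circ> tval (Tot P) c b"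
    using b smooth_manifold_is_chart[OF Tot_mfd c] by (auto simp: om_rep_def chart_inv_map)
  then show ?thesis using linear_compose[OF tval_linear[OF Tot_mfd c b(1)] om_linear] by simp
qed

lemma om_rep_smooth:
  assumes c: "c \<in> atlas (Tot P)"
  shows "Cinf_on (chart_map c ` chart_dom c) (\<lambda>y. om_rep c y e)"
proof -
  note isc = smooth_manifold_is_chart[OF Tot_mfd c]
  have "smooth_fun_on (Tot P) (chart_dom c) (\<lambda>a. om a (tval (Tot P) c a e))"
    by (rule om_smooth[OF chart_open_dom[OF isc] vector_field_on_tval[OF Tot_mfd c]])
  then have "Cinf_on (chart_map c ` (chart_dom c \<inter> chart_dom c)) ((\<lambda>a. om a (tval (Tot P) c a e)) \<circ> chart_inv c)"
    using c unfolding smooth_fun_on_def by blast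
  then show ?thesis by (simp add: om_rep_def[abs_def] comp_def)
qed

text \<open>Cartan's formula with the identity as map: \<omega> vanishes identically on horizontal
  fields, so both derivative terms drop out. The fields may be local because smoothness of the
  curvature is tested on local fields.\<close>

lemma om_bracket_horizontal:
  assumes U: "open U" and V: "vector_field_on B U V" and W: "vector_field_on B U W" and a: "proj P a \<in> U"
  shows "om a (hbr V W a) = - curv a (V (proj P a)) (W (proj P a))"
proof -
  let ?c = "chart_at (Tot P) a"
  let ?U = "proj P -` U"
  note c = chart_at_atlas[OF Tot_mfd, of a] chart_at_dom[OF Tot_mfd, of a]
  note isc = smooth_manifold_is_chart[OF Tot_mfd c(1)]
  have oU: "open ?U" using smooth_open_preimage[OF proj_smooth U] by simp
  have aU: "a \<in> ?U" using a by simp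
  note o = chart_open_image[OF isc oU]
  note fin = smooth_manifold_findim[OF Tot_mfd]
  have im: "chart_map ?c a \<in> chart_map ?c ` (?U \<inter> chart_dom ?c)" using aU c by blast
  let ?X = "\<lambda>V. vf_rep (Tot P) ?c (\<lambda>a. hl a (V (proj P a)))"
  have X: "?X V (chart_map ?c a) = hl a (V (proj P a))" for V
    by (simp add: vf_rep_apply[OF Tot_mfd c] tcoord_chart_at[OF Tot_mfd])
  \<comment> \<open>The trivial derivatives appear because \<open>one_form_bracket\<close> is
    instantiated with the identity for \<psi>.\<close>
  have fdid: "fd (\<lambda>y. y) z = (\<lambda>h. h)" for z :: 'r by simp
  have zero: "fd (\<lambda>z. om_rep ?c z (fd (\<lambda>y. y) z (?X V z))) (chart_map ?c a) h = 0" for V h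
  proof -
    have "fd (\<lambda>z. om_rep ?c z (fd (\<lambda>y. y) z (?X V z))) (chart_map ?c a) = fd (\<lambda>z. 0) (chart_map ?c a)"
      by (rule fd_cong_open(2)[OF _ o im]) (auto simp: vf_rep_apply[OF Tot_mfd c(1)] om_rep_apply[OF c(1)])
    then show ?thesis by simp
  qed
  have "om_rep ?c (chart_map ?c a) (fd (\<lambda>y. y) (chart_map ?c a)
      (fd (?X W) (chart_map ?c a) (?X V (chart_map ?c a)) - fd (?X V) (chart_map ?c a) (?X W (chart_map ?c a))))
    = ext_deriv (om_rep ?c) (chart_map ?c a) (fd (\<lambda>y. y) (chart_map ?c a) (?X V (chart_map ?c a)))
        (fd (\<lambda>y. y) (chart_map ?c a) (?X W (chart_map ?c a)))"
  proof (rule one_form_bracket[OF fin fin o im Cinf_on_id chart_open_image_sub[OF isc chart_open_dom[OF isc] subset_refl]])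
    show "chart_map ?c a \<in> chart_map ?c ` chart_dom ?c" using c by blast
    show "linear (om_rep ?c y)" if "y \<in> chart_map ?c ` chart_dom ?c" for y by (rule om_rep_linear[OF c(1) that])
    show "(\<lambda>y. om_rep ?c y e) differentiable (at (chart_map ?c a))" for e
      by (rule Cinf_on_differentiable[OF om_rep_smooth[OF c(1)]]) (use c in blast)
    show "(?X V has_derivative fd (?X V) (chart_map ?c a)) (at (chart_map ?c a))"
      "(?X W has_derivative fd (?X W) (chart_map ?c a)) (at (chart_map ?c a))"
      by (intro fd_has_derivative vf_rep_differentiable[OF Tot_mfd hl_smooth[OF U] aU c] V W)+
  qed (rule zero)+
  then have "om_rep ?c (chart_map ?c a) (hbr V W a) = - curv a (V (proj P a)) (W (proj P a))"
    unfolding fdid X curv_def lie_bracket_brk brk_def by (simp add: X)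
  then show ?thesis
    using om_rep_apply[OF c, of "hbr V W a"] by (simp add: tcoord_chart_at[OF Tot_mfd])
qed

lemma curv_linear: "linear (\<lambda>v. curv a v w)" "linear (curv a v)" and curv_self: "curv a v v = 0"
proof -
  let ?c = "chart_at (Tot P) a"
  note c = chart_at_atlas[OF Tot_mfd, of a] chart_at_dom[OF Tot_mfd, of a]
  note isc = smooth_manifold_is_chart[OF Tot_mfd c(1)]
  let ?y = "chart_map ?c a" and ?S = "chart_map ?c ` chart_dom ?c"
  have o: "open ?S" by (rule chart_open_image_sub[OF isc chart_open_dom[OF isc] subset_refl])
  have y: "?y \<in> ?S" using c by blast
  have d: "(\<lambda>y. om_rep ?c y e) differentiable (at ?y)" for e
    by (rule Cinf_on_differentiable[OF om_rep_smooth[OF c(1)] y])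
  have l1: "linear (fd (\<lambda>y. om_rep ?c y e) ?y)" for e by (rule linear_frechet_derivative[OF d])
  \<comment> \<open>Linearity in the vector slot is inherited by the derivative in \<open>y\<close>,
    because it holds on a whole neighbourhood of the point.\<close>
  have l2: "linear (\<lambda>e. fd (\<lambda>y. om_rep ?c y e) ?y h)" for h
  proof (rule linearI)
    have add: "((\<lambda>y. om_rep ?c y (e + e')) has_derivative (\<lambda>h. fd (\<lambda>y. om_rep ?c y e) ?y h + fd (\<lambda>y. om_rep ?c y e') ?y h)) (at ?y)" for e e'
      by (rule has_derivative_transform_within_open[OF has_derivative_add[OF fd_has_derivative[OF d] fd_has_derivative[OF d]] o y])
        (simp add: linear_add[OF om_rep_linear[OF c(1)]])
    show "fd (\<lambda>y. om_rep ?c y (e + e')) ?y h = fd (\<lambda>y. om_rep ?c y e) ?y h + fd (\<lambda>y. om_rep ?c y e') ?y h" for e e'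
      by (simp add: fd_eq[OF add])
    have scale: "((\<lambda>y. om_rep ?c y (r *\<^sub>R e)) has_derivative (\<lambda>h. r *\<^sub>R fd (\<lambda>y. om_rep ?c y e) ?y h)) (at ?y)" for e r
      by (rule has_derivative_transform_within_open[OF has_derivative_scaleR_right[OF fd_has_derivative[OF d]] o y])
        (simp add: linear_scale[OF om_rep_linear[OF c(1)]])
    show "fd (\<lambda>y. om_rep ?c y (r *\<^sub>R e)) ?y h = r *\<^sub>R fd (\<lambda>y. om_rep ?c y e) ?y h" for e r
      by (simp add: fd_eq[OF scale])
  qed
  show "linear (\<lambda>v. curv a v w)" "linear (curv a v)"
    unfolding curv_def ext_deriv_def
    by (intro linearI; simp add: linear_add[OF hl_linear] linear_scale[OF hl_linear] linear_add[OF l1] linear_scale[OF l1]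
        linear_add[OF l2] linear_scale[OF l2] algebra_simps)+
  show "curv a v v = 0" by (simp add: curv_def ext_deriv_def)
qed

text \<open>The bracket of horizontal lifts is invariant and lies over the bracket of
  \<open>V\<close> and \<open>W\<close>, so its difference from the horizontal lift of that bracket
  is vertical and determined by \<omega>.\<close>

lemma curvature_fields_eq:
  assumes V: "vector_field B V" and W: "vector_field B W"
  shows "curvature_fields MG G B P \<D> V W (proj P a) = ad_class MG G P a (curv a (V (proj P a)) (W (proj P a)))"
proof -
  let ?V = "\<lambda>a. hl a (V (proj P a))" and ?W = "\<lambda>a. hl a (W (proj P a))"
  have hV: "vector_field (Tot P) ?V" and hW: "vector_field (Tot P) ?W"
    using hl_smooth[OF open_UNIV V] hl_smooth[OF open_UNIV W] by simp_all
  have R: "dR g b (hbr V W b) = hbr V W (ract P b g)" for g b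
    by (rule lie_bracket_related[OF Tot_mfd Tot_mfd ract_smooth hV hW hV hW]) (simp_all add: hl_dR)
  have br: "section_bracket P (\<lambda>x. conn_section B P \<D> x (V x)) (\<lambda>x. conn_section B P \<D> x (W x)) (proj P a)
      = T_class P a (hbr V W a)"
  proof -
    have "{(b, hbr V W b) | b. proj P b = proj P a} = (\<lambda>b. (b, hbr V W b)) ` {b. proj P b = proj P a}"
      by auto
    also have "\<dots> = {(ract P a g, hbr V W (ract P a g)) | g. True}"
      unfolding fibre_eq by auto
    finally have "{(b, hbr V W b) | b. proj P b = proj P a} = {(ract P a g, hbr V W (ract P a g)) | g. True}" .
    then show ?thesis
      unfolding section_bracket_def inv_field_conn_section by (simp add: T_class_def R)
  qed
  have proj: "d\<pi> a (hbr V W a) = lie_bracket B V W (proj P a)"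
    by (rule lie_bracket_related[OF Tot_mfd base proj_smooth hV hW V W]) simp_all
  have om: "om a (hbr V W a) = - curv a (V (proj P a)) (W (proj P a))"
    by (rule om_bracket_horizontal[OF open_UNIV V W UNIV_I])
  have "hl a (lie_bracket B V W (proj P a)) = hbr V W a + fund a (curv a (V (proj P a)) (W (proj P a)))"
    using hl_correct[of a "hbr V W a"] unfolding proj om by (simp add: linear_neg[OF fund_linear])
  then have diff: "cl_diff (conn_section B P \<D> (proj P a) (lie_bracket B V W (proj P a))) (T_class P a (hbr V W a))
      = jG MG G P (ad_class MG G P a (curv a (V (proj P a)) (W (proj P a))))"
    by (simp add: conn_section_eq T_class_diff jG_ad_class)
  \<comment> \<open>Uniqueness of the class holds because \<D> is a left inverse of
    \<open>jG\<close> on the adjoint bundle.\<close>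
  show ?thesis
    unfolding curvature_fields_def br diff
    by (rule the_equality) (auto simp: ad_fibre_iff jG_ad_class cl_at_T_class ad_class_eq_iff dest!: arg_cong[of _ _ \<D>] simp: \<D>_T_class om_fund)
qed

lemma curvature_eq: "curvature MG G B P \<D> (proj P a) v w = ad_class MG G P a (curv a v w)"
proof -
  obtain V where V: "vector_field B V" "V (proj P a) = v" using vector_field_extension[OF base] by metis
  obtain W where W: "vector_field B W" "W (proj P a) = w" using vector_field_extension[OF base] by metis
  show ?thesis
    unfolding curvature_def
  proof (rule the_equality)
    fix Q assume "\<forall>V W. vector_field B V \<and> vector_field B W \<and> V (proj P a) = v \<and> W (proj P a) = w
      \<longrightarrow> curvature_fields MG G B P \<D> V W (proj P a) = Q"
    then show "Q = ad_class MG G P a (curv a v w)"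
      using V W curvature_fields_eq[OF V(1) W(1), of a] by blast
  qed (auto simp: curvature_fields_eq)
qed

text \<open>The algebraic conditions come from bilinearity of \<open>curv\<close>; smoothness comes
  from rewriting its values as \<omega> applied to a bracket of smooth horizontal fields.\<close>

lemma curvature_ad_two_form: "ad_two_form MG G B P (curvature MG G B P \<D>)"
proof -
  let ?K = "curvature MG G B P \<D>"
  have at: "\<exists>a. x = proj P a" for x using fibre_nonempty[of x] by metis
  have K: "?K x v w \<in> ad_fibre MG G P x" "?K x (v + v') w = cl_add (?K x v w) (?K x v' w)"
    "?K x (r *\<^sub>R v) w = cl_scale r (?K x v w)" "?K x v (w + w') = cl_add (?K x v w) (?K x v w')"
    "?K x v (r *\<^sub>R w) = cl_scale r (?K x v w)" "?K x v v = cl_zero P x" for x v v' w w' r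
    using at[of x]
    by (auto simp: curvature_eq ad_fibre_iff ad_class_add ad_class_scale ad_class_zero ad_class_eq_iff curv_self
        linear_add[OF curv_linear(1)] linear_add[OF curv_linear(2)] linear_scale[OF curv_linear(1)] linear_scale[OF curv_linear(2)])
  have sm: "smooth_fun_on (Tot P) (proj P -` U) (\<lambda>a. cl_at a (?K (proj P a) (V (proj P a)) (W (proj P a))))"
    if U: "open U" and V: "vector_field_on B U V" and W: "vector_field_on B U W" for U V W
  proof -
    have oU: "open (proj P -` U)" using smooth_open_preimage[OF proj_smooth U] by simp
    have neg: "om a (- w) = - om a w" for a w by (rule linear_neg[OF om_linear])
    have "vector_field_on (Tot P) (proj P -` U) (hbr V W)"
      by (rule lie_bracket_vector_field[OF Tot_mfd oU hl_smooth[OF U V] hl_smooth[OF U W]])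
    then have hsm: "smooth_fun_on (Tot P) (proj P -` U) (\<lambda>a. om a (hbr V W a))"
      by (rule om_smooth[OF oU])
    show ?thesis
      unfolding smooth_fun_on_def
    proof
      fix c assume c: "c \<in> atlas (Tot P)"
      note isc = smooth_manifold_is_chart[OF Tot_mfd c]
      note o = chart_open_image[OF isc oU]
      have "Cinf_on (chart_map c ` (proj P -` U \<inter> chart_dom c)) ((\<lambda>a. om a (hbr V W a)) \<circ> chart_inv c)"
        using hsm c unfolding smooth_fun_on_def by blast
      from Cinf_on_minus[OF o this]
      show "Cinf_on (chart_map c ` (proj P -` U \<inter> chart_dom c))
          ((\<lambda>a. cl_at a (?K (proj P a) (V (proj P a)) (W (proj P a)))) \<circ> chart_inv c)"
        by (rule Cinf_on_cong[OF o, rotated])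
          (auto simp: chart_inv_map[OF isc] curvature_eq cl_at_ad_class om_bracket_horizontal[OF U V W])
    qed
  qed
  show ?thesis
    unfolding ad_two_form_def by (intro conjI allI impI; (rule K | (elim conjE, rule sm; assumption)))
qed

end

section \<open>Invariance of the curvature under the groupoid\<close>

lemma vector_field_on_linear_combination:
  assumes M: "smooth_manifold M" and U: "open U" and V: "\<And>i. i \<in> I \<Longrightarrow> vector_field_on M U (V i)"
  shows "vector_field_on M U (\<lambda>x. \<Sum>i\<in>I. k i *\<^sub>R V i x)"
  unfolding vector_field_on_def
proof
  fix c assume c: "c \<in> atlas M"
  note o = chart_open_image[OF smooth_manifold_is_chart[OF M c] U]
  have "Cinf_on (chart_map c ` (U \<inter> chart_dom c)) (\<lambda>y. \<Sum>i\<in>I. k i *\<^sub>R vf_rep M c (V i) y)"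
    by (intro Cinf_on_sum[OF o] Cinf_on_linear_compose[OF o bounded_linear_scaleR_right] vector_field_onD[OF V c])
  then show "Cinf_on (chart_map c ` (U \<inter> chart_dom c)) (vf_rep M c (\<lambda>x. \<Sum>i\<in>I. k i *\<^sub>R V i x))"
    by (rule Cinf_on_cong[OF o, rotated])
      (auto simp: vf_rep_apply[OF M c] linear_sum[OF tcoord_linear[OF M c]] linear_scale[OF tcoord_linear[OF M c]])
qed

text \<open>A combination of a local frame with constant coefficients, cut off by a bump function.
  Scaling keeps the values in the subspaces, and off \<open>U\<close> the field is zero.\<close>

lemma subbundle_field:
  assumes M: "smooth_manifold M" and H: "subbundle M H" and h: "h \<in> H x"
  obtains V where "vector_field M V" "V x = h" "\<And>z. V z \<in> H z"
proof -
  have sub: "subspace (H z)" for z using H by (simp add: subbundle_def)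
  obtain U and k :: nat and V where U: "open U" "x \<in> U" "\<forall>i<k. vector_field_on M U (V i)"
    "\<forall>z\<in>U. inj_on (\<lambda>i. V i z) {..<k} \<and> independent ((\<lambda>i. V i z) ` {..<k}) \<and> span ((\<lambda>i. V i z) ` {..<k}) = H z"
    using H unfolding subbundle_def by blast
  have "h \<in> span ((\<lambda>i. V i x) ` {..<k})" using U h by blast
  then obtain u where "h = (\<Sum>v\<in>(\<lambda>i. V i x) ` {..<k}. u v *\<^sub>R v)" by (auto simp: span_finite)
  then have hu: "h = (\<Sum>i<k. u (V i x) *\<^sub>R V i x)" using U by (simp add: sum.reindex)
  define W where "W z = (\<Sum>i<k. u (V i x) *\<^sub>R V i z)" for z
  have W: "vector_field_on M U W"
    unfolding W_def by (rule vector_field_on_linear_combination[OF M U(1)]) (use U(3) in simp)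
  have WH: "W z \<in> H z" if "z \<in> U" for z
  proof -
    have "V i z \<in> H z" if "i < k" for i
      using U(4) \<open>z \<in> U\<close> span_base[of "V i z" "(\<lambda>i. V i z) ` {..<k}"] that by auto
    then show ?thesis unfolding W_def by (intro subspace_sum[OF sub] subspace_scale[OF sub]) auto
  qed
  obtain f where f: "f x = 1" "vector_field M (\<lambda>z. f z *\<^sub>R W z)" "\<And>z. z \<notin> U \<Longrightarrow> f z = 0"
    using vector_field_bump[OF M U(1) W U(2)] by metis
  have fH: "f z *\<^sub>R W z \<in> H z" for z
    by (cases "z \<in> U") (use WH f(3) in \<open>auto intro: subspace_scale[OF sub] simp: subspace_0[OF sub]\<close>)
  have fx: "f x *\<^sub>R W x = h" by (simp add: f(1) W_def hu)
  show ?thesis by (rule that[OF f(2) fx fH])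
qed

locale gconnection = pconnection MG G "Obj X" P \<D>
  for MG :: "('g::{t2_space, second_countable_topology}, 'w::real_normed_vector) charted"
    and G :: "'g monoid"
    and X :: "('x::{t2_space, second_countable_topology}, 'u::real_normed_vector,
               'y::{t2_space, second_countable_topology}, 'v::real_normed_vector) groupoid"
    and P :: "('p::{t2_space, second_countable_topology}, 'r::real_normed_vector, 'g, 'x, 'y) gbundle"
    and \<D> :: "('p \<times> 'r) set \<Rightarrow> ('p \<times> 'w) set" +
  fixes H :: "'y \<Rightarrow> 'v set"
  assumes gpd: "lie_groupoid X" and integrable: "integrable_connection X H"
    and gpb: "principal_gpd_bundle MG G X P" and gconn: "bundle_connection MG G X H P \<D>"
begin

abbreviation YE :: "('y \<times> 'p, 'v \<times> 'r) charted" where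
  "YE \<equiv> prod_mfd (Arr X) (Tot P)"

abbreviation lac :: "'y \<times> 'p \<Rightarrow> 'p" where
  "lac \<equiv> \<lambda>(\<gamma>, a). lact P \<gamma> a"

section \<open>Source projections and horizontal vectors on the arrows\<close>

lemma Arr_mfd: "smooth_manifold (Arr X)"
  using gpd by (simp add: lie_groupoid_def)

lemma Arr_Tot_mfd: "smooth_manifold YE"
  by (rule prod_mfd_smooth_manifold[OF Arr_mfd Tot_mfd])

lemma src_smooth: "smooth_open (Arr X) (Obj X) UNIV (src X)"
  and tgt_smooth: "smooth_open (Arr X) (Obj X) UNIV (tgt X)"
  using gpd by (auto intro!: smooth_map_on_open Arr_mfd base simp: lie_groupoid_def submersion_def)

lemma d_src_surj: "surj (d_src X \<gamma>)"
  using gpd by (simp add: lie_groupoid_def submersion_def)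

lemma d_src_linear: "linear (d_src X \<gamma>)" and d_tgt_linear: "linear (d_tgt X \<gamma>)"
  by (rule tmap_linear[OF Arr_mfd base src_smooth UNIV_I] tmap_linear[OF Arr_mfd base tgt_smooth UNIV_I])+

lemma H_subbundle: "subbundle (Arr X) H"
  using integrable by (simp add: integrable_connection_def groupoid_connection_def)

lemma hor_unique: "\<exists>!h. h \<in> H \<gamma> \<and> d_src X \<gamma> (v - h) = 0"
  using integrable by (simp add: integrable_connection_def groupoid_connection_def)

lemma hor_comp_mem: "hor_comp X H \<gamma> v \<in> H \<gamma>"
  unfolding hor_comp_def using theI'[OF hor_unique[of \<gamma> v]] by blast

text \<open>The horizontal component depends only on the source projection of the vector; hence the
  arbitrary choice in \<open>lift_transport\<close> has no effect.\<close>

lemma hor_comp_eqI: "h \<in> H \<gamma> \<Longrightarrow> d_src X \<gamma> h = d_src X \<gamma> v \<Longrightarrow> hor_comp X H \<gamma> v = h"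
  unfolding hor_comp_def by (rule the1_equality[OF hor_unique]) (simp add: linear_diff[OF d_src_linear])

lemma hor_lift_exists: obtains h where "h \<in> H \<gamma>" "d_src X \<gamma> h = u"
proof -
  obtain v where v: "d_src X \<gamma> v = u" using d_src_surj[of \<gamma>] by (metis surjD)
  have "d_src X \<gamma> (v - hor_comp X H \<gamma> v) = 0"
    unfolding hor_comp_def using theI'[OF hor_unique[of \<gamma> v]] by blast
  then have "d_src X \<gamma> (hor_comp X H \<gamma> v) = u" using v by (simp add: linear_diff[OF d_src_linear])
  then show ?thesis using that hor_comp_mem by blast
qed

section \<open>The action near a point of the fibre product\<close>

lemma act_domI: "src X \<gamma> = proj P a \<Longrightarrow> (\<gamma>, a) \<in> act_dom X P"
  by (simp add: act_dom_def)

lemma proj_lact: "src X \<gamma> = proj P a \<Longrightarrow> proj P (lact P \<gamma> a) = tgt X \<gamma>"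
  and ract_lact: "src X \<gamma> = proj P a \<Longrightarrow> ract P (lact P \<gamma> a) g = lact P \<gamma> (ract P a g)"
  using gpb act_domI unfolding principal_gpd_bundle_def by blast+

text \<open>Supplies an extension of the action to an open set of the product, to which the calculus
  on manifolds applies; it is tied to the action on the fibre product only.\<close>

lemma local_action:
  assumes "src X \<gamma> = proj P a"
  obtains U F where "(\<gamma>, a) \<in> U" "smooth_open YE (Tot P) U F"
    "\<And>\<gamma>' a'. (\<gamma>', a') \<in> U \<Longrightarrow> src X \<gamma>' = proj P a' \<Longrightarrow> F (\<gamma>', a') = lact P \<gamma>' a'"
proof -
  have sm: "smooth_map_on YE (Tot P) (act_dom X P) lac"
    using gpb unfolding principal_gpd_bundle_def by (elim conjE)
  from sm[unfolded smooth_map_on_def, rule_format, OF act_domI[OF assms]]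
  obtain U F where U: "(\<gamma>, a) \<in> U" "smooth_open YE (Tot P) U F" "\<forall>y\<in>act_dom X P \<inter> U. F y = lac y"
    by blast
  show ?thesis
    by (rule that[OF U(1,2)]) (use U(3) act_domI in auto)
qed

text \<open>\<open>fibre_product_derivative_unique\<close> in charts of the groupoid and the bundle.
  The two functions are compared only at points of the fibre product, and the derivatives may be
  taken within different sets.\<close>

lemma tangent_unique:
  assumes src: "src X \<gamma> = proj P a" and hw: "d_src X \<gamma> h = d\<pi> a w" and U: "open U" "(\<gamma>, a) \<in> U"
    and g: "(g has_derivative D) (at (chart_map (chart_at (Arr X) \<gamma>) \<gamma>, chart_map (chart_at (Tot P) a) a) within C)"
    and g': "(g' has_derivative D') (at (chart_map (chart_at (Arr X) \<gamma>) \<gamma>, chart_map (chart_at (Tot P) a) a) within C')"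
    and agree: "\<And>\<gamma>' a'. (\<gamma>', a') \<in> U \<Longrightarrow> src X \<gamma>' = proj P a' \<Longrightarrow>
        \<gamma>' \<in> chart_dom (chart_at (Arr X) \<gamma>) \<Longrightarrow> a' \<in> chart_dom (chart_at (Tot P) a) \<Longrightarrow>
        (chart_map (chart_at (Arr X) \<gamma>) \<gamma>', chart_map (chart_at (Tot P) a) a') \<in> C \<inter> C' \<and>
        g (chart_map (chart_at (Arr X) \<gamma>) \<gamma>', chart_map (chart_at (Tot P) a) a')
        = g' (chart_map (chart_at (Arr X) \<gamma>) \<gamma>', chart_map (chart_at (Tot P) a) a')"
  shows "D (h, w) = D' (h, w)"
proof -
  let ?c = "chart_at (Arr X) \<gamma>" and ?d = "chart_at (Tot P) a" and ?e = "chart_at (Obj X) (proj P a)"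
  note c = chart_at_atlas[OF Arr_mfd, of \<gamma>] chart_at_dom[OF Arr_mfd, of \<gamma>]
  note d = chart_at_atlas[OF Tot_mfd, of a] chart_at_dom[OF Tot_mfd, of a]
  note e = chart_at_atlas[OF base, of "proj P a"] chart_at_dom[OF base, of "proj P a"]
  note isc = smooth_manifold_is_chart[OF Arr_mfd c(1)] smooth_manifold_is_chart[OF Tot_mfd d(1)] smooth_manifold_is_chart[OF base e(1)]
  let ?S = "chart_map ?c ` (UNIV \<inter> chart_dom ?c \<inter> src X -` chart_dom ?e)"
  have oS: "open ?S" by (rule lrep_domain_open[OF src_smooth isc(1,3)])
  let ?W = "U \<inter> ((UNIV \<inter> src X -` chart_dom ?e \<inter> chart_dom ?c) \<times> (UNIV \<inter> proj P -` chart_dom ?e \<inter> chart_dom ?d))"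
  have "open ?W"
    by (intro open_Int[OF U(1)] open_Times open_Int[OF smooth_open_preimage[OF src_smooth chart_open_dom[OF isc(3)]] chart_open_dom[OF isc(1)]]
        open_Int[OF smooth_open_preimage[OF proj_smooth chart_open_dom[OF isc(3)]] chart_open_dom[OF isc(2)]])
  then have oW: "open (chart_map (prod_chart ?c ?d) ` ?W)"
    by (rule chart_open_image_sub[OF prod_chart_is_chart[OF isc(1,2)]]) auto
  have tc: "fd (lrep ?c ?e (src X)) (chart_map ?c \<gamma>) h = fd (lrep ?d ?e (proj P)) (chart_map ?d a) w"
    using hw unfolding tmap_eq_fd[OF Arr_mfd] tmap_eq_fd[OF Tot_mfd] src .
  have surj: "surj (fd (lrep ?c ?e (src X)) (chart_map ?c \<gamma>))"
    using d_src_surj[of \<gamma>] unfolding tmap_eq_fd[OF Arr_mfd] src .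
  show ?thesis
  proof (rule fibre_product_derivative_unique[OF smooth_manifold_findim[OF base] oS _ smooth_open_lrep[OF src_smooth c(1) e(1)] surj _ _ tc oW _ g g'])
    show "chart_map ?c \<gamma> \<in> ?S" using c e src by simp
    show "lrep ?d ?e (proj P) differentiable (at (chart_map ?d a))"
      by (rule lrep_differentiable[OF proj_smooth d(1) e(1) UNIV_I d(2) e(2)])
    show "lrep ?d ?e (proj P) (chart_map ?d a) = lrep ?c ?e (src X) (chart_map ?c \<gamma>)"
      using c d src by (simp add: chart_inv_map isc)
    have "(\<gamma>, a) \<in> ?W" using U c d e src by auto
    then show "(chart_map ?c \<gamma>, chart_map ?d a) \<in> chart_map (prod_chart ?c ?d) ` ?W"
      by (metis (no_types, lifting) image_eqI prod_chart_map)
    fix z y assume zy: "(z, y) \<in> chart_map (prod_chart ?c ?d) ` ?W" "lrep ?c ?e (src X) z = lrep ?d ?e (proj P) y"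
    then obtain \<gamma>' a' where *: "(\<gamma>', a') \<in> ?W" "z = chart_map ?c \<gamma>'" "y = chart_map ?d a'" by auto
    then have mem: "(\<gamma>', a') \<in> U" "\<gamma>' \<in> chart_dom ?c" "a' \<in> chart_dom ?d" "src X \<gamma>' \<in> chart_dom ?e" "proj P a' \<in> chart_dom ?e"
      by auto
    \<comment> \<open>Injectivity of the base chart turns the equation between coordinates back into
      membership in the fibre product.\<close>
    have "chart_map ?e (src X \<gamma>') = chart_map ?e (proj P a')"
      using zy(2) mem by (simp add: * chart_inv_map isc)
    then have "src X \<gamma>' = proj P a'"
      using chart_inv_map[OF isc(3) mem(4)] chart_inv_map[OF isc(3) mem(5)] by metis
    then show "(z, y) \<in> C \<and> (z, y) \<in> C' \<and> g (z, y) = g' (z, y)"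
      using agree[OF mem(1) _ mem(2,3)] by (auto simp: *)
  qed
qed

lemma tmap_fibre_product_cong:
  fixes N :: "('n::{t2_space, second_countable_topology}, 'o::real_normed_vector) charted"
  assumes N: "smooth_manifold N" and src: "src X \<gamma> = proj P a" and hw: "d_src X \<gamma> h = d\<pi> a w"
    and F: "smooth_open YE N U F" and F': "smooth_open YE N U' F'" and mem: "(\<gamma>, a) \<in> U" "(\<gamma>, a) \<in> U'"
    and agree: "\<And>\<gamma>' a'. (\<gamma>', a') \<in> U \<Longrightarrow> (\<gamma>', a') \<in> U' \<Longrightarrow> src X \<gamma>' = proj P a' \<Longrightarrow> F (\<gamma>', a') = F' (\<gamma>', a')"
  shows "tmap YE N F (\<gamma>, a) (h, w) = tmap YE N F' (\<gamma>, a) (h, w)"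
proof -
  let ?c = "chart_at (Arr X) \<gamma>" and ?d = "chart_at (Tot P) a" and ?e = "chart_at N (F (\<gamma>, a))"
  note c = chart_at_atlas[OF Arr_mfd, of \<gamma>] chart_at_dom[OF Arr_mfd, of \<gamma>]
  note d = chart_at_atlas[OF Tot_mfd, of a] chart_at_dom[OF Tot_mfd, of a]
  note e = chart_at_atlas[OF N, of "F (\<gamma>, a)"] chart_at_dom[OF N, of "F (\<gamma>, a)"]
  note isc = smooth_manifold_is_chart[OF Arr_mfd c(1)] smooth_manifold_is_chart[OF Tot_mfd d(1)]
  let ?p = "prod_chart ?c ?d"
  have p: "?p \<in> atlas YE" "(\<gamma>, a) \<in> chart_dom ?p" using c d by (auto intro: prod_chart_atlas)
  have eq: "F' (\<gamma>, a) = F (\<gamma>, a)" using agree[OF mem src] by simp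
  have oU: "open (U \<inter> U')" using smooth_open_open[OF F] smooth_open_open[OF F'] by auto
  have D: "(lrep ?p ?e F has_derivative tmap YE N F (\<gamma>, a)) (at (chart_map ?c \<gamma>, chart_map ?d a) within UNIV)"
    unfolding tmap_eq_fd[OF Arr_Tot_mfd]
    using fd_has_derivative[OF lrep_differentiable[OF F p(1) e(1) mem(1) p(2) e(2)]] by simp
  have D': "(lrep ?p ?e F' has_derivative tmap YE N F' (\<gamma>, a)) (at (chart_map ?c \<gamma>, chart_map ?d a) within UNIV)"
    unfolding tmap_eq_fd[OF Arr_Tot_mfd]
    using fd_has_derivative[OF lrep_differentiable[OF F' p(1) e(1) mem(2) p(2)]] e(2) by (simp add: eq)
  show ?thesis
    by (rule tangent_unique[OF src hw oU _ D D']) (use mem agree in \<open>auto simp: prod_chart_inv[OF isc]\<close>)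
qed

text \<open>Replaces the derivative within the fibre product, and the chosen \<open>v\<close>, by
  the ordinary differential of any local extension of the action.\<close>

lemma lift_transport_eq:
  assumes src: "src X \<gamma> = proj P a" and h: "h \<in> H \<gamma>" and hw: "d_src X \<gamma> h = d\<pi> a w"
    and F: "smooth_open YE (Tot P) U F" and mem: "(\<gamma>, a) \<in> U"
    and agree: "\<And>\<gamma>' a'. (\<gamma>', a') \<in> U \<Longrightarrow> src X \<gamma>' = proj P a' \<Longrightarrow> F (\<gamma>', a') = lact P \<gamma>' a'"
  shows "lift_transport X H P \<gamma> a w = tmap YE (Tot P) F (\<gamma>, a) (h, w)"
proof -
  let ?c = "chart_at (Arr X) \<gamma>" and ?d = "chart_at (Tot P) a" and ?e = "chart_at (Tot P) (lact P \<gamma> a)"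
  note c = chart_at_atlas[OF Arr_mfd, of \<gamma>] chart_at_dom[OF Arr_mfd, of \<gamma>]
  note d = chart_at_atlas[OF Tot_mfd, of a] chart_at_dom[OF Tot_mfd, of a]
  note e = chart_at_atlas[OF Tot_mfd, of "lact P \<gamma> a"] chart_at_dom[OF Tot_mfd, of "lact P \<gamma> a"]
  note isc = smooth_manifold_is_chart[OF Arr_mfd c(1)] smooth_manifold_is_chart[OF Tot_mfd d(1)]
  let ?p = "prod_chart ?c ?d"
  let ?pt = "(chart_map ?c \<gamma>, chart_map ?d a)"
  let ?C = "chart_map ?p ` (act_dom X P \<inter> chart_dom ?p)"
  have p: "?p \<in> atlas YE" "(\<gamma>, a) \<in> chart_dom ?p" using c d by (auto intro: prod_chart_atlas)
  have Fa: "F (\<gamma>, a) = lact P \<gamma> a" using agree[OF mem src] .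
  have "\<exists>v. d_src X \<gamma> v = d\<pi> a w" using hw by blast
  then have "d_src X \<gamma> (SOME v. d_src X \<gamma> v = d\<pi> a w) = d\<pi> a w" by (rule someI_ex)
  then have hor: "hor_comp X H \<gamma> (SOME v. d_src X \<gamma> v = d\<pi> a w) = h"
    using h hw by (intro hor_comp_eqI) simp_all
  have D: "(lrep ?p ?e F has_derivative tmap YE (Tot P) F (\<gamma>, a)) (at ?pt)"
    unfolding tmap_eq_fd[OF Arr_Tot_mfd] Fa
    using fd_has_derivative[OF lrep_differentiable[OF F p(1) e(1) mem p(2)]] e(2) by (simp add: Fa)
  have oU: "open (chart_map ?p ` (U \<inter> chart_dom ?p))"
    by (rule chart_open_image[OF prod_chart_is_chart[OF isc] smooth_open_open[OF F]])
  have "(\<gamma>, a) \<in> U \<inter> chart_dom ?p" using mem p by blast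
  then have "?pt \<in> chart_map ?p ` (U \<inter> chart_dom ?p)" by (metis (no_types, lifting) image_eqI prod_chart_map)
  then obtain \<epsilon> where \<epsilon>: "\<epsilon> > 0" "ball ?pt \<epsilon> \<subseteq> chart_map ?p ` (U \<inter> chart_dom ?p)"
    using oU openE by blast
  have ptC: "?pt \<in> ?C"
  proof -
    have "(\<gamma>, a) \<in> act_dom X P \<inter> chart_dom ?p" using p act_domI[OF src] by blast
    then show ?thesis by (metis (no_types, lifting) image_eqI prod_chart_map)
  qed
  have "(lrep ?p ?e lac has_derivative tmap YE (Tot P) F (\<gamma>, a)) (at ?pt within ?C)"
  proof (rule has_derivative_transform_within[OF has_derivative_at_withinI[OF D] \<epsilon>(1) ptC])
    fix q assume q: "q \<in> ?C" "dist q ?pt < \<epsilon>"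
    then have "q \<in> chart_map ?p ` (U \<inter> chart_dom ?p)" using \<epsilon>(2) by (auto simp: dist_commute)
    then obtain \<gamma>1 a1 where 1: "(\<gamma>1, a1) \<in> U" "\<gamma>1 \<in> chart_dom ?c" "a1 \<in> chart_dom ?d" "q = (chart_map ?c \<gamma>1, chart_map ?d a1)" by auto
    obtain \<gamma>2 a2 where 2: "(\<gamma>2, a2) \<in> act_dom X P" "\<gamma>2 \<in> chart_dom ?c" "a2 \<in> chart_dom ?d" "q = (chart_map ?c \<gamma>2, chart_map ?d a2)"
      using q(1) by auto
    \<comment> \<open>Injectivity of the product chart: the preimage known to lie in
      \<open>U\<close> and the one known to lie in the fibre product are the same pair.\<close>
    have "(\<gamma>1, a1) = (\<gamma>2, a2)"
      using prod_chart_inv[OF isc 1(2,3)] prod_chart_inv[OF isc 2(2,3)] 1(4) 2(4) by metis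
    then have "src X \<gamma>1 = proj P a1" using 2(1) by (simp add: act_dom_def)
    then show "lrep ?p ?e F q = lrep ?p ?e lac q"
      using agree[OF 1(1)] by (simp add: 1(4) prod_chart_inv[OF isc 1(2,3)])
  qed
  \<comment> \<open>The derivative of \<open>F\<close> witnesses differentiability within
    \<open>?C\<close>. The derivative selected by \<open>frechet_derivative\<close> may be a
    different map; agreement is claimed only on the tangent vector \<open>(h, w)\<close>.\<close>
  then have "(lrep ?p ?e lac has_derivative frechet_derivative (lrep ?p ?e lac) (at ?pt within ?C)) (at ?pt within ?C)"
    using differentiableI frechet_derivative_works by blast
  then have "frechet_derivative (lrep ?p ?e lac) (at ?pt within ?C) (h, w) = tmap YE (Tot P) F (\<gamma>, a) (h, w)"
  proof (rule tangent_unique[OF src hw smooth_open_open[OF F] mem _ D])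
    fix \<gamma>' a' assume *: "(\<gamma>', a') \<in> U" "src X \<gamma>' = proj P a'" "\<gamma>' \<in> chart_dom ?c" "a' \<in> chart_dom ?d"
    have "(\<gamma>', a') \<in> act_dom X P \<inter> chart_dom ?p" using * act_domI by simp
    then have "(chart_map ?c \<gamma>', chart_map ?d a') \<in> ?C" by (metis (no_types, lifting) image_eqI prod_chart_map)
    then show "(chart_map ?c \<gamma>', chart_map ?d a') \<in> ?C \<inter> UNIV \<and>
        lrep ?p ?e lac (chart_map ?c \<gamma>', chart_map ?d a') = lrep ?p ?e F (chart_map ?c \<gamma>', chart_map ?d a')"
      using * agree by (simp add: prod_chart_inv[OF isc])
  qed
  moreover have "tmap_within YE (Tot P) (act_dom X P) lac (\<gamma>, a)
      = frechet_derivative (lrep ?p ?e lac) (at ?pt within ?C)"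
    by (simp add: tmap_within_def Let_def)
  ultimately show ?thesis
    unfolding lift_transport_def Let_def hor by simp
qed

end

section \<open>Equivariance of the lifted transport and of the connection form\<close>

context gconnection
begin

text \<open>Differentiates \<pi>(\<gamma> a) = t(\<gamma>), which holds on the fibre product, in the
  tangent direction \<open>(h, w)\<close>.\<close>

lemma d\<pi>_lift_transport:
  assumes src: "src X \<gamma> = proj P a" and h: "h \<in> H \<gamma>" and hw: "d_src X \<gamma> h = d\<pi> a w"
  shows "d\<pi> (lact P \<gamma> a) (lift_transport X H P \<gamma> a w) = d_tgt X \<gamma> h"
proof -
  obtain U F where F: "(\<gamma>, a) \<in> U" "smooth_open YE (Tot P) U F"
    "\<And>\<gamma>' a'. (\<gamma>', a') \<in> U \<Longrightarrow> src X \<gamma>' = proj P a' \<Longrightarrow> F (\<gamma>', a') = lact P \<gamma>' a'"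
    using local_action[OF src] by metis
  note U = smooth_open_open[OF F(2)]
  have fst: "smooth_open YE (Arr X) U fst" by (rule smooth_open_subset[OF tmap_fst(1)[OF Arr_mfd Tot_mfd] U]) auto
  have pF: "smooth_open YE (Obj X) U (\<lambda>z. proj P (F z))"
    by (rule smooth_open_compose[OF Arr_Tot_mfd Tot_mfd base F(2) proj_smooth UNIV_I])
  have tF: "smooth_open YE (Obj X) U (\<lambda>z. tgt X (fst z))"
    by (rule smooth_open_compose[OF Arr_Tot_mfd Arr_mfd base fst tgt_smooth UNIV_I])
  have lt: "lift_transport X H P \<gamma> a w = tmap YE (Tot P) F (\<gamma>, a) (h, w)"
    by (rule lift_transport_eq[OF src h hw F(2,1,3)])
  have "d\<pi> (lact P \<gamma> a) (lift_transport X H P \<gamma> a w) = tmap YE (Obj X) (\<lambda>z. proj P (F z)) (\<gamma>, a) (h, w)"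
    unfolding lt F(3)[OF F(1) src, symmetric]
    by (rule tmap_compose[OF Arr_Tot_mfd Tot_mfd base F(2) proj_smooth F(1) UNIV_I, symmetric])
  also have "\<dots> = tmap YE (Obj X) (\<lambda>z. tgt X (fst z)) (\<gamma>, a) (h, w)"
    by (rule tmap_fibre_product_cong[OF base src hw pF tF F(1) F(1)]) (simp add: F(3) proj_lact)
  also have "\<dots> = d_tgt X \<gamma> h"
    using tmap_compose[OF Arr_Tot_mfd Arr_mfd base fst tgt_smooth F(1) UNIV_I, of "(h, w)"] by (simp add: tmap_fst(2)[OF Arr_mfd Tot_mfd])
  finally show ?thesis .
qed

text \<open>Differentiates the commutation of the two actions, \<gamma>(a g) = (\<gamma> a) g, along
  the fibre product.\<close>

lemma lift_transport_dR:
  assumes src: "src X \<gamma> = proj P a"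
  shows "lift_transport X H P \<gamma> (ract P a g) (dR g a w) = dR g (lact P \<gamma> a) (lift_transport X H P \<gamma> a w)"
proof -
  have src': "src X \<gamma> = proj P (ract P a g)" using src by simp
  obtain h where h: "h \<in> H \<gamma>" "d_src X \<gamma> h = d\<pi> a w" using hor_lift_exists by metis
  have h': "d_src X \<gamma> h = d\<pi> (ract P a g) (dR g a w)" using h(2) by (simp add: d\<pi>_dR)
  obtain U F where F: "(\<gamma>, a) \<in> U" "smooth_open YE (Tot P) U F"
    "\<And>\<gamma>' a'. (\<gamma>', a') \<in> U \<Longrightarrow> src X \<gamma>' = proj P a' \<Longrightarrow> F (\<gamma>', a') = lact P \<gamma>' a'"
    using local_action[OF src] by metis
  obtain U' F' where F': "(\<gamma>, ract P a g) \<in> U'" "smooth_open YE (Tot P) U' F'"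
    "\<And>\<gamma>' a'. (\<gamma>', a') \<in> U' \<Longrightarrow> src X \<gamma>' = proj P a' \<Longrightarrow> F' (\<gamma>', a') = lact P \<gamma>' a'"
    using local_action[OF src'] by metis
  have lt: "lift_transport X H P \<gamma> a w = tmap YE (Tot P) F (\<gamma>, a) (h, w)"
    by (rule lift_transport_eq[OF src h F(2,1,3)])
  \<comment> \<open>Right translation by \<open>g\<close> on the ambient product; it moves the base
    point of the first extension to that of the second.\<close>
  define \<rho> where "\<rho> z = (fst z, ract P (snd z) g)" for z :: "'y \<times> 'p"
  have \<rho>: "smooth_open YE YE UNIV \<rho>"
    unfolding \<rho>_def
    by (rule smooth_open_Pair[OF Arr_mfd Tot_mfd Arr_Tot_mfd tmap_fst(1)[OF Arr_mfd Tot_mfd] smooth_open_compose[OF Arr_Tot_mfd Tot_mfd Tot_mfd tmap_snd(1)[OF Arr_mfd Tot_mfd] ract_smooth UNIV_I]])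
  have t\<rho>: "tmap YE YE \<rho> (\<gamma>, a) (h, w) = (h, dR g a w)"
    unfolding \<rho>_def
    using tmap_Pair[OF Arr_mfd Tot_mfd Arr_Tot_mfd tmap_fst(1)[OF Arr_mfd Tot_mfd] smooth_open_compose[OF Arr_Tot_mfd Tot_mfd Tot_mfd tmap_snd(1)[OF Arr_mfd Tot_mfd] ract_smooth UNIV_I] UNIV_I]
      tmap_compose[OF Arr_Tot_mfd Tot_mfd Tot_mfd tmap_snd(1)[OF Arr_mfd Tot_mfd] ract_smooth UNIV_I UNIV_I, of g "(\<gamma>, a)" "(h, w)"]
    by (simp add: tmap_fst(2)[OF Arr_mfd Tot_mfd] tmap_snd(2)[OF Arr_mfd Tot_mfd])
  have oV: "open (UNIV \<inter> \<rho> -` U')" by (rule smooth_open_preimage[OF \<rho> smooth_open_open[OF F'(2)]])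
  have \<rho>V: "smooth_open YE YE (\<rho> -` U') \<rho>" by (rule smooth_open_subset[OF \<rho>]) (use oV in simp_all)
  have F\<rho>: "smooth_open YE (Tot P) (\<rho> -` U') (\<lambda>z. F' (\<rho> z))"
    by (rule smooth_open_compose[OF Arr_Tot_mfd Arr_Tot_mfd Tot_mfd \<rho>V F'(2)]) simp
  have RF: "smooth_open YE (Tot P) U (\<lambda>z. ract P (F z) g)"
    by (rule smooth_open_compose[OF Arr_Tot_mfd Tot_mfd Tot_mfd F(2) ract_smooth UNIV_I])
  have \<rho>a: "\<rho> (\<gamma>, a) = (\<gamma>, ract P a g)" by (simp add: \<rho>_def)
  have "lift_transport X H P \<gamma> (ract P a g) (dR g a w) = tmap YE (Tot P) F' (\<rho> (\<gamma>, a)) (tmap YE YE \<rho> (\<gamma>, a) (h, w))"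
    unfolding t\<rho> \<rho>a by (rule lift_transport_eq[OF src' h(1) h' F'(2,1,3)])
  also have "\<dots> = tmap YE (Tot P) (\<lambda>z. F' (\<rho> z)) (\<gamma>, a) (h, w)"
    by (rule tmap_compose[OF Arr_Tot_mfd Arr_Tot_mfd Tot_mfd \<rho> F'(2), symmetric]) (simp_all add: \<rho>a F'(1))
  also have "\<dots> = tmap YE (Tot P) (\<lambda>z. ract P (F z) g) (\<gamma>, a) (h, w)"
    by (rule tmap_fibre_product_cong[OF Tot_mfd src h(2) F\<rho> RF _ F(1)])
      (simp_all add: \<rho>_def F'(1) F'(3) F(3) ract_lact)
  also have "\<dots> = dR g (F (\<gamma>, a)) (tmap YE (Tot P) F (\<gamma>, a) (h, w))"
    by (rule tmap_compose[OF Arr_Tot_mfd Tot_mfd Tot_mfd F(2) ract_smooth F(1) UNIV_I])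
  also have "\<dots> = dR g (lact P \<gamma> a) (lift_transport X H P \<gamma> a w)"
    unfolding lt F(3)[OF F(1) src] ..
  finally show ?thesis .
qed

lemma ad_act_ad_class:
  assumes "src X \<gamma> = proj P a"
  shows "ad_act P \<gamma> (ad_class MG G P a A) = ad_class MG G P (lact P \<gamma> a) A"
  unfolding ad_act_def ad_class_def ract_lact[OF assms] by auto

lemma T_act_T_class:
  assumes "src X \<gamma> = proj P a"
  shows "T_act X H P \<gamma> (T_class P a w) = T_class P (lact P \<gamma> a) (lift_transport X H P \<gamma> a w)"
  unfolding T_act_def T_class_def ract_lact[OF assms] lift_transport_dR[OF assms, symmetric] by auto

text \<open>Equivariance of \<D> read over the point \<gamma> a: the action on the adjoint bundle
  leaves the Lie algebra component unchanged.\<close>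

lemma om_lift_transport:
  assumes src: "src X \<gamma> = proj P a"
  shows "om (lact P \<gamma> a) (lift_transport X H P \<gamma> a w) = om a w"
proof -
  have "\<forall>\<gamma>. \<forall>Q\<in>T_fibre P (src X \<gamma>). \<D> (T_act X H P \<gamma> Q) = ad_act P \<gamma> (\<D> Q)"
    using gconn unfolding bundle_connection_def by (elim conjE)
  from this[rule_format, of "T_class P a w" \<gamma>]
  have "\<D> (T_act X H P \<gamma> (T_class P a w)) = ad_act P \<gamma> (\<D> (T_class P a w))"
    using T_class_fibre[of a w] src by simp
  then show ?thesis
    by (simp add: T_act_T_class[OF src] \<D>_T_class ad_act_ad_class[OF src] ad_class_eq_iff)
qed

lemma lift_transport_hl:
  assumes src: "src X \<gamma> = proj P a" and h: "h \<in> H \<gamma>"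
  shows "lift_transport X H P \<gamma> a (hl a (d_src X \<gamma> h)) = hl (lact P \<gamma> a) (d_tgt X \<gamma> h)"
  by (rule hl_eqI[symmetric]) (simp_all add: d\<pi>_lift_transport[OF src h] om_lift_transport[OF src])

text \<open>The fields \<open>W P1\<close>, \<open>W P2\<close> below pair horizontal fields on the arrows with the horizontal lifts
  of their source projections. They are tangent to the fibre product, and so is their bracket
  \<open>Z\<close>, whose arrow component lies in \<open>H\<close> by integrability. \<open>key1\<close> and \<open>key2\<close> are Cartan's formula for
  the pullbacks of the connection form along the action and along the second projection.\<close>

lemma curv_invariant:
  assumes src: "src X \<gamma> = proj P a" and h1: "h1 \<in> H \<gamma>" and h2: "h2 \<in> H \<gamma>"
  shows "curv (lact P \<gamma> a) (d_tgt X \<gamma> h1) (d_tgt X \<gamma> h2) = curv a (d_src X \<gamma> h1) (d_src X \<gamma> h2)"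
proof -
  obtain P1 where P1: "vector_field (Arr X) P1" "P1 \<gamma> = h1" "\<And>\<gamma>. P1 \<gamma> \<in> H \<gamma>"
    using subbundle_field[OF Arr_mfd H_subbundle h1] by metis
  obtain P2 where P2: "vector_field (Arr X) P2" "P2 \<gamma> = h2" "\<And>\<gamma>. P2 \<gamma> \<in> H \<gamma>"
    using subbundle_field[OF Arr_mfd H_subbundle h2] by metis
  obtain U F where F: "(\<gamma>, a) \<in> U" "smooth_open YE (Tot P) U F"
    "\<And>\<gamma>' a'. (\<gamma>', a') \<in> U \<Longrightarrow> src X \<gamma>' = proj P a' \<Longrightarrow> F (\<gamma>', a') = lact P \<gamma>' a'"
    using local_action[OF src] by metis
  define c where "c = chart_at (Arr X) \<gamma>"
  define d where "d = chart_at (Tot P) a"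
  define e where "e = chart_at (Obj X) (proj P a)"
  define f where "f = chart_at (Tot P) (lact P \<gamma> a)"
  define p where "p = prod_chart c d"
  have Fa: "F (\<gamma>, a) = lact P \<gamma> a" using F(3)[OF F(1) src] .
  have c: "c \<in> atlas (Arr X)" "\<gamma> \<in> chart_dom c" unfolding c_def by (rule chart_at_atlas[OF Arr_mfd], rule chart_at_dom[OF Arr_mfd])
  have d: "d \<in> atlas (Tot P)" "a \<in> chart_dom d" unfolding d_def by (rule chart_at_atlas[OF Tot_mfd], rule chart_at_dom[OF Tot_mfd])
  have e: "e \<in> atlas (Obj X)" "proj P a \<in> chart_dom e" unfolding e_def by (rule chart_at_atlas[OF base], rule chart_at_dom[OF base])
  have f: "f \<in> atlas (Tot P)" "lact P \<gamma> a \<in> chart_dom f" unfolding f_def by (rule chart_at_atlas[OF Tot_mfd], rule chart_at_dom[OF Tot_mfd])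
  note isc = smooth_manifold_is_chart[OF Arr_mfd c(1)] smooth_manifold_is_chart[OF Tot_mfd d(1)]
    smooth_manifold_is_chart[OF base e(1)] smooth_manifold_is_chart[OF Tot_mfd f(1)]
  have p: "p \<in> atlas YE" "is_chart p"
    unfolding p_def by (rule prod_chart_atlas[OF c(1) d(1)], rule prod_chart_is_chart[OF isc(1,2)])
  note finYE = smooth_manifold_findim[OF Arr_Tot_mfd] and finE = smooth_manifold_findim[OF Tot_mfd]
    and finB = smooth_manifold_findim[OF base] and finY = smooth_manifold_findim[OF Arr_mfd]
  define sr where "sr = lrep c e (src X)"
  define pr where "pr = lrep d e (proj P)"
  define Fr where "Fr = lrep p f F"
  define Wc where "Wc = chart_dom c \<inter> src X -` chart_dom e"
  define Wd where "Wd = chart_dom d \<inter> proj P -` chart_dom e"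
  \<comment> \<open>An open neighbourhood in the product, not contained in the fibre product, on
    which \<open>sr\<close>, \<open>pr\<close> and \<open>Fr\<close> are all defined.\<close>
  define V where "V = U \<inter> F -` chart_dom f \<inter> (Wc \<times> Wd)"
  have oWc: "open Wc" using open_Int[OF chart_open_dom[OF isc(1)] smooth_open_preimage[OF src_smooth chart_open_dom[OF isc(3)]]]
    by (simp add: Wc_def)
  have oWd: "open Wd" using open_Int[OF chart_open_dom[OF isc(2)] smooth_open_preimage[OF proj_smooth chart_open_dom[OF isc(3)]]]
    by (simp add: Wd_def)
  have oV: "open V"
    unfolding V_def by (intro open_Int smooth_open_preimage[OF F(2)] chart_open_dom isc open_Times oWc oWd)
  have V_mem: "(\<gamma>, a) \<in> V" using F(1) c d e f src by (simp add: V_def Wc_def Wd_def Fa)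
  define S where "S = chart_map p ` V"
  have oS: "open S"
    unfolding S_def by (rule chart_open_image_sub[OF p(2) oV]) (auto simp: p_def V_def Wc_def Wd_def)
  define z0 where "z0 = chart_map c \<gamma>"
  define y0 where "y0 = chart_map d a"
  have pS: "(z0, y0) \<in> S"
    unfolding S_def z0_def y0_def using V_mem by (intro image_eqI[of _ _ "(\<gamma>, a)"]) (simp_all add: p_def)
  have S_E: "\<exists>\<gamma>' a'. q = (chart_map c \<gamma>', chart_map d a') \<and> (\<gamma>', a') \<in> V" if "q \<in> S" for q
  proof -
    obtain v where "v \<in> V" "q = chart_map p v" using \<open>q \<in> S\<close> unfolding S_def by blast
    then show ?thesis by (intro exI[of _ "fst v"] exI[of _ "snd v"]) (cases v, simp add: p_def)
  qed
  have V_E: "\<gamma>' \<in> chart_dom c" "src X \<gamma>' \<in> chart_dom e" "a' \<in> chart_dom d" "proj P a' \<in> chart_dom e"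
    "(\<gamma>', a') \<in> U" "F (\<gamma>', a') \<in> chart_dom f" if "(\<gamma>', a') \<in> V" for \<gamma>' a'
    using that by (auto simp: V_def Wc_def Wd_def)
  have oSc: "open (chart_map c ` Wc)" by (rule chart_open_image_sub[OF isc(1) oWc]) (auto simp: Wc_def)
  have oSd: "open (chart_map d ` Wd)" by (rule chart_open_image_sub[OF isc(2) oWd]) (auto simp: Wd_def)
  have S_fst: "fst q \<in> chart_map c ` Wc" and S_snd: "snd q \<in> chart_map d ` Wd" if "q \<in> S" for q
    using that by (auto simp: S_def p_def V_def)
  have z0S: "z0 \<in> chart_map c ` Wc" and y0S: "y0 \<in> chart_map d ` Wd" using S_fst[OF pS] S_snd[OF pS] by simp_all
  have srC: "Cinf_on (chart_map c ` Wc) sr"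
    unfolding sr_def by (rule Cinf_on_subset[OF smooth_open_lrep[OF src_smooth c(1) e(1)]]) (auto simp: Wc_def)
  have prC: "Cinf_on (chart_map d ` Wd) pr"
    unfolding pr_def by (rule Cinf_on_subset[OF smooth_open_lrep[OF proj_smooth d(1) e(1)]]) (auto simp: Wd_def)
  have FrC: "Cinf_on S Fr"
    unfolding Fr_def S_def by (rule Cinf_on_subset[OF smooth_open_lrep[OF F(2) p(1) f(1)]])
      (auto simp: V_def p_def Wc_def Wd_def)
  \<comment> \<open>The horizontal lift, in the chart \<open>d\<close>, of the base field with
    constant coordinates \<open>v\<close> in the chart \<open>e\<close>.\<close>
  define L where "L y v = vf_rep (Tot P) d (\<lambda>a. hl a (tval (Obj X) e (proj P a) v)) y" for y v
  have L_apply: "L (chart_map d a') v = tcoord (Tot P) d a' (hl a' (tval (Obj X) e (proj P a') v))" if "a' \<in> chart_dom d" for a' v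
    unfolding L_def by (rule vf_rep_apply[OF Tot_mfd d(1) that])
  have L_smooth: "Cinf_on (chart_map d ` Wd) (\<lambda>y. L y v)" for v
    unfolding L_def
    by (rule Cinf_on_subset[OF vector_field_onD[OF hl_smooth[OF chart_open_dom[OF isc(3)] vector_field_on_tval[OF base e(1)]] d(1)]])
      (auto simp: Wd_def)
  have L_linear: "linear (L y)" if y: "y \<in> chart_map d ` Wd" for y
  proof -
    obtain a' where a': "a' \<in> chart_dom d" "proj P a' \<in> chart_dom e" "y = chart_map d a'"
      using y by (auto simp: Wd_def)
    have "L y = tcoord (Tot P) d a' \<circ> hl a' \<circ> tval (Obj X) e (proj P a')"
      using a' by (auto simp: L_apply)
    then show ?thesis
      using linear_compose[OF tval_linear[OF base e(1) a'(2)] linear_compose[OF hl_linear tcoord_linear[OF Tot_mfd d(1) a'(1)]]]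
      by (simp add: comp_assoc)
  qed
  define Pr where "Pr Q = vf_rep (Arr X) c Q" for Q
  \<comment> \<open>The source projection of \<open>Q\<close> sits at the source of the arrow, the
    lift at the projection of the bundle point. Off the fibre product these base points differ, and
    their tangent spaces are matched by coordinates in \<open>e\<close>; this extends the field to
    an open set.\<close>
  define A where "A Q q = L (snd q) (fd sr (fst q) (Pr Q (fst q)))" for Q q
  define W where "W Q q = (Pr Q (fst q), A Q q)" for Q q
  have Pr_apply: "Pr Q (chart_map c \<gamma>') = tcoord (Arr X) c \<gamma>' (Q \<gamma>')" if "\<gamma>' \<in> chart_dom c" for Q \<gamma>'
    unfolding Pr_def by (rule vf_rep_apply[OF Arr_mfd c(1) that])
  have sr_Pr: "fd sr (chart_map c \<gamma>') (Pr Q (chart_map c \<gamma>')) = tcoord (Obj X) e (src X \<gamma>') (d_src X \<gamma>' (Q \<gamma>'))"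
    if "\<gamma>' \<in> chart_dom c" "src X \<gamma>' \<in> chart_dom e" for Q \<gamma>'
    unfolding Pr_apply[OF that(1)] sr_def by (rule tmap_chart[OF Arr_mfd base src_smooth UNIV_I c(1) that(1) e(1) that(2)])
  \<comment> \<open>Both identities hold on all of \<open>S\<close>, so they may later be
    differentiated in every direction.\<close>
  have pr_A: "fd pr (snd q) (A Q q) = fd sr (fst q) (Pr Q (fst q))" and om_A: "om_rep d (snd q) (A Q q) = 0" if q: "q \<in> S" for Q q
  proof -
    obtain \<gamma>' a' where *: "q = (chart_map c \<gamma>', chart_map d a')" "(\<gamma>', a') \<in> V" using S_E[OF q] by blast
    note v = V_E[OF *(2)]
    show "fd pr (snd q) (A Q q) = fd sr (fst q) (Pr Q (fst q))"
      unfolding *(1) A_def fst_conv snd_conv sr_Pr[OF v(1,2)] L_apply[OF v(3)] pr_def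
        tmap_chart[OF Tot_mfd base proj_smooth UNIV_I d(1) v(3) e(1) v(4)] d\<pi>_hl
      by (rule tcoord_tval[OF base e(1) v(4)])
    show "om_rep d (snd q) (A Q q) = 0"
      unfolding *(1) A_def snd_conv L_apply[OF v(3)] om_rep_apply[OF d(1) v(3)] by simp
  qed
  \<comment> \<open>On the fibre product the base points coincide and the matching of coordinates is
    the identity, so \<open>A Q\<close> is the true horizontal lift of the source
    projection.\<close>
  have A_src: "A Q (chart_map c \<gamma>', chart_map d a') = tcoord (Tot P) d a' (hl a' (d_src X \<gamma>' (Q \<gamma>')))"
    if "(\<gamma>', a') \<in> V" "src X \<gamma>' = proj P a'" for Q \<gamma>' a'
  proof -
    note v = V_E[OF that(1)]
    show ?thesis
      unfolding A_def fst_conv snd_conv sr_Pr[OF v(1,2)] L_apply[OF v(3)]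
      by (simp add: that(2) tval_tcoord[OF base e(1) v(4)])
  qed
  \<comment> \<open>\<open>F\<close> agrees with the action on the fibre product only, hence the
    restriction to its points and to vectors tangent to it.\<close>
  have tm: "fd Fr (chart_map c \<gamma>', chart_map d a') (tcoord (Arr X) c \<gamma>' h, tcoord (Tot P) d a' w)
      = tcoord (Tot P) f (lact P \<gamma>' a') (lift_transport X H P \<gamma>' a' w)"
    if v: "(\<gamma>', a') \<in> V" and s: "src X \<gamma>' = proj P a'" and h: "h \<in> H \<gamma>'" "d_src X \<gamma>' h = d\<pi> a' w" for \<gamma>' a' h w
  proof -
    note v = V_E[OF v]
    have "fd Fr (chart_map p (\<gamma>', a')) (tcoord YE p (\<gamma>', a') (h, w)) = tcoord (Tot P) f (F (\<gamma>', a')) (tmap YE (Tot P) F (\<gamma>', a') (h, w))"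
      unfolding Fr_def by (rule tmap_chart[OF Arr_Tot_mfd Tot_mfd F(2) v(5) p(1) _ f(1) v(6)]) (use v in \<open>simp add: p_def\<close>)
    moreover have "tmap YE (Tot P) F (\<gamma>', a') (h, w) = lift_transport X H P \<gamma>' a' w"
      by (rule lift_transport_eq[OF s h F(2) v(5) F(3), symmetric])
    ultimately show ?thesis
      using F(3)[OF v(5) s] by (simp add: p_def tcoord_prod[OF Arr_mfd Tot_mfd c(1) v(1) d(1) v(3)])
  qed
  \<comment> \<open>The pullback of the connection form along the extended action, evaluated on
    \<open>W Q\<close>. By equivariance it vanishes on the fibre product; elsewhere it need
    not.\<close>
  define fld where "fld Q q = om_rep f (Fr q) (fd Fr q (W Q q))" for Q q
  have fld0: "fld Q (chart_map c \<gamma>', chart_map d a') = 0"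
    if v: "(\<gamma>', a') \<in> V" and s: "src X \<gamma>' = proj P a'" and Q: "\<And>\<gamma>. Q \<gamma> \<in> H \<gamma>" for Q \<gamma>' a'
  proof -
    note ve = V_E[OF v]
    have "fd Fr (chart_map c \<gamma>', chart_map d a') (W Q (chart_map c \<gamma>', chart_map d a'))
        = tcoord (Tot P) f (lact P \<gamma>' a') (lift_transport X H P \<gamma>' a' (hl a' (d_src X \<gamma>' (Q \<gamma>'))))"
      unfolding W_def fst_conv Pr_apply[OF ve(1)] A_src[OF v s] by (rule tm[OF v s Q]) simp
    moreover have "Fr (chart_map c \<gamma>', chart_map d a') = chart_map f (lact P \<gamma>' a')"
      using F(3)[OF ve(5) s] by (simp add: Fr_def p_def prod_chart_inv[OF isc(1,2) ve(1,3)])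
    ultimately show ?thesis
      using ve(6) F(3)[OF ve(5) s] by (simp add: fld_def om_rep_apply[OF f(1)] om_lift_transport[OF s])
  qed
  have Fr0: "Fr (z0, y0) = chart_map f (lact P \<gamma> a)"
    by (simp add: Fr_def p_def z0_def y0_def prod_chart_inv[OF isc(1,2) c(2) d(2)] Fa)
  have W0: "W Q (z0, y0) = (Q \<gamma>, hl a (d_src X \<gamma> (Q \<gamma>)))" for Q
    unfolding W_def z0_def y0_def fst_conv Pr_apply[OF c(2)] A_src[OF V_mem src]
    by (simp add: c_def d_def tcoord_chart_at[OF Arr_mfd] tcoord_chart_at[OF Tot_mfd])
  have tm0: "fd Fr (z0, y0) (h, w) = lift_transport X H P \<gamma> a w" if "h \<in> H \<gamma>" "d_src X \<gamma> h = d\<pi> a w" for h w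
    using tm[OF V_mem src that] unfolding z0_def y0_def
    by (simp add: c_def d_def f_def tcoord_chart_at[OF Arr_mfd] tcoord_chart_at[OF Tot_mfd])
  have dPr: "(Pr Q has_derivative fd (Pr Q) z0) (at z0)" if "vector_field (Arr X) Q" for Q
    unfolding Pr_def z0_def by (rule fd_has_derivative[OF vf_rep_differentiable[OF Arr_mfd that UNIV_I c]])
  \<comment> \<open>Differentiability is assembled from three levels: the field on the arrows, its
    source projection, and the lift \<open>L\<close>, which is linear in the projected
    vector.\<close>
  have dW: "\<exists>W'. (W Q has_derivative W') (at (z0, y0))" if Q: "vector_field (Arr X) Q" for Q
  proof -
    have f1: "(fst has_derivative fst) (at (z0, y0))" and s1: "(snd has_derivative snd) (at (z0, y0))"
      by (rule bounded_linear_imp_has_derivative, rule bounded_linear_fst)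
        (rule bounded_linear_imp_has_derivative, rule bounded_linear_snd)
    have dPf: "((\<lambda>q. Pr Q (fst q)) has_derivative (\<lambda>h. fd (Pr Q) z0 (fst h))) (at (z0, y0))"
      using has_derivative_compose[OF f1, of "Pr Q"] dPr[OF Q] by simp
    have "((\<lambda>q. fd sr q (Pr Q q)) has_derivative (\<lambda>h. fd (\<lambda>z. fd sr z (Pr Q z0)) z0 h + fd sr z0 (fd (Pr Q) z0 h))) (at z0)"
      by (rule has_derivative_fd_apply[OF finY oSc z0S srC dPr[OF Q]])
    then have dB: "((\<lambda>q. fd sr (fst q) (Pr Q (fst q))) has_derivative
        (\<lambda>h. fd (\<lambda>z. fd sr z (Pr Q z0)) z0 (fst h) + fd sr z0 (fd (Pr Q) z0 (fst h)))) (at (z0, y0))"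
      using has_derivative_compose[OF f1, of "\<lambda>q. fd sr q (Pr Q q)"] by simp
    have dL: "(\<lambda>q. L (snd q) v) differentiable (at (z0, y0))" for v
      using fd_compose(2)[OF differentiableI[OF s1], of "\<lambda>y. L y v"] Cinf_on_differentiable[OF L_smooth y0S] by simp
    have lin: "linear (L (snd q))" if "q \<in> S" for q by (rule L_linear[OF S_snd[OF that]])
    show ?thesis
      unfolding W_def[abs_def] A_def[abs_def]
      using has_derivative_Pair[OF dPf has_derivative_linear_field[where A="\<lambda>q. L (snd q)", OF finB oS pS lin dL dB]]
      by blast
  qed
  obtain W1 where W1: "(W P1 has_derivative W1) (at (z0, y0))" using dW[OF P1(1)] by blast
  obtain W2 where W2: "(W P2 has_derivative W2) (at (z0, y0))" using dW[OF P2(1)] by blast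
  \<comment> \<open>The bracket of \<open>W P1\<close> and \<open>W P2\<close> at the base point, in
    coordinates.\<close>
  define Z where "Z = W2 (W P1 (z0, y0)) - W1 (W P2 (z0, y0))"
  have oTf: "open (chart_map f ` chart_dom f)" by (rule chart_open_image_sub[OF isc(4) chart_open_dom[OF isc(4)] subset_refl])
  have oTd: "open (chart_map d ` chart_dom d)" by (rule chart_open_image_sub[OF isc(2) chart_open_dom[OF isc(2)] subset_refl])
  have Tf: "Fr (z0, y0) \<in> chart_map f ` chart_dom f" using f(2) by (simp add: Fr0)
  have Td: "snd (z0, y0) \<in> chart_map d ` chart_dom d" using d(2) by (simp add: y0_def)
  have om_df: "(\<lambda>y. om_rep f y v) differentiable (at (Fr (z0, y0)))" for v
    by (rule Cinf_on_differentiable[OF om_rep_smooth[OF f(1)] Tf])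
  have om_dd: "(\<lambda>y. om_rep d y v) differentiable (at (snd (z0, y0)))" for v
    by (rule Cinf_on_differentiable[OF om_rep_smooth[OF d(1)] Td])
  \<comment> \<open>\<open>W Q'\<close> is tangent to the fibre product at the base point, so
    comparing \<open>fld Q\<close> with the zero function there by \<open>tangent_unique\<close>
    gives the vanishing derivative that Cartan's formula requires.\<close>
  have fld_zero: "fd (fld Q) (z0, y0) (W Q' (z0, y0)) = 0"
    if Q: "(W Q has_derivative W') (at (z0, y0))" "\<And>\<gamma>. Q \<gamma> \<in> H \<gamma>" for Q W' Q'
  proof -
    have D: "(fld Q has_derivative fd (fld Q) (z0, y0)) (at (z0, y0) within UNIV)"
      unfolding fld_def[abs_def]
      using fd_has_derivative[OF differentiableI[OF has_derivative_one_form[OF finYE finE oS pS FrC oTf Tf om_rep_linear[OF f(1)] om_df Q(1)]]]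
      by simp
    have D0: "((\<lambda>q. 0) has_derivative (\<lambda>h. 0)) (at (z0, y0) within UNIV)" by simp
    show ?thesis
      unfolding W0 using D D0 unfolding z0_def y0_def c_def d_def
      by (rule tangent_unique[OF src _ oV V_mem, rotated 1]) (simp_all add: fld0[unfolded c_def d_def] Q(2))
  qed
  have key1: "om_rep f (Fr (z0, y0)) (fd Fr (z0, y0) Z)
      = ext_deriv (om_rep f) (Fr (z0, y0)) (fd Fr (z0, y0) (W P1 (z0, y0))) (fd Fr (z0, y0) (W P2 (z0, y0)))"
    unfolding Z_def
    by (rule one_form_bracket[OF finYE finE oS pS FrC oTf Tf om_rep_linear[OF f(1)] om_df W1 W2])
      (use fld_zero[OF W1 P1(3)] fld_zero[OF W2 P2(3)] in \<open>simp_all add: fld_def[abs_def]\<close>)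
  have fd_snd: "fd snd q = (snd :: 'v \<times> 'r \<Rightarrow> 'r)" and fd_fst: "fd fst q = (fst :: 'v \<times> 'r \<Rightarrow> 'v)" for q :: "'v \<times> 'r"
    by (rule fd_eq, rule bounded_linear_imp_has_derivative, rule bounded_linear_snd)
      (rule fd_eq, rule bounded_linear_imp_has_derivative, rule bounded_linear_fst)
  \<comment> \<open>Along the second projection the form vanishes on \<open>W Q\<close> throughout
    the open set \<open>S\<close>, so no tangency argument is involved.\<close>
  have snd_zero: "fd (\<lambda>q. om_rep d (snd q) (fd snd q (W Q q))) (z0, y0) v = 0" for Q v
  proof -
    have "fd (\<lambda>q. om_rep d (snd q) (fd snd q (W Q q))) (z0, y0) = fd (\<lambda>q. 0) (z0, y0)"
      by (rule fd_cong_open(2)[OF _ oS pS]) (simp_all add: fd_snd W_def om_A)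
    then show ?thesis by simp
  qed
  have key2: "om_rep d (snd (z0, y0)) (fd snd (z0, y0) Z)
      = ext_deriv (om_rep d) (snd (z0, y0)) (fd snd (z0, y0) (W P1 (z0, y0))) (fd snd (z0, y0) (W P2 (z0, y0)))"
    unfolding Z_def
    by (rule one_form_bracket[OF finYE finE oS pS Cinf_on_bounded_linear[OF bounded_linear_snd] oTd Td om_rep_linear[OF d(1)] om_dd W1 W2])
      (simp_all add: snd_zero)
  \<comment> \<open>\<open>W P1\<close> and \<open>W P2\<close> are related to \<open>P1\<close> and
    \<open>P2\<close> by the first projection, and brackets of related fields are related.\<close>
  have Z1: "fst Z = lie_bracket (Arr X) P1 P2 \<gamma>"
  proof -
    have "fd fst (z0, y0) Z = fd (Pr P2) z0 (Pr P1 (fst (z0, y0))) - fd (Pr P1) z0 (Pr P2 (fst (z0, y0)))"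
      unfolding Z_def
      by (rule bracket_pushforward[OF finYE oS pS Cinf_on_bounded_linear[OF bounded_linear_fst] W1 W2])
        (simp_all add: dPr P1(1) P2(1) fd_fst W_def)
    then show ?thesis
      by (simp add: fd_fst lie_bracket_brk brk_def Pr_def z0_def c_def)
  qed
  have "fst Z \<in> H \<gamma>"
    unfolding Z1 using integrable P1 P2 by (simp add: integrable_connection_def)
  moreover have "d_src X \<gamma> (fst Z) = d\<pi> a (snd Z)"
  proof -
    \<comment> \<open>The defining function of the fibre product. By \<open>pr_A\<close> its
      derivative along each field vanishes on all of \<open>S\<close>; the fields are related to
      zero fields, and so is their bracket \<open>Z\<close>.\<close>
    define \<Psi> where "\<Psi> q = sr (fst q) - pr (snd q)" for q
    have C: "Cinf_on S \<Psi>"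
      unfolding \<Psi>_def
      by (intro Cinf_on_diff oS Cinf_on_compose[OF finY oS oSc Cinf_on_fst[OF oS Cinf_on_id] S_fst srC]
          Cinf_on_compose[OF finE oS oSd Cinf_on_snd[OF oS Cinf_on_id] S_snd prC])
    have fd\<Psi>: "fd \<Psi> q v = fd sr (fst q) (fst v) - fd pr (snd q) (snd v)" if q: "q \<in> S" for q v
    proof -
      have "((\<lambda>q. sr (fst q)) has_derivative (\<lambda>h. fd sr (fst q) (fst h))) (at q)"
        by (rule has_derivative_compose[OF bounded_linear_imp_has_derivative[OF bounded_linear_fst]
              fd_has_derivative[OF Cinf_on_differentiable[OF srC S_fst[OF q]]]])
      moreover have "((\<lambda>q. pr (snd q)) has_derivative (\<lambda>h. fd pr (snd q) (snd h))) (at q)"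
        by (rule has_derivative_compose[OF bounded_linear_imp_has_derivative[OF bounded_linear_snd]
              fd_has_derivative[OF Cinf_on_differentiable[OF prC S_snd[OF q]]]])
      ultimately have "(\<Psi> has_derivative (\<lambda>h. fd sr (fst q) (fst h) - fd pr (snd q) (snd h))) (at q)"
        unfolding \<Psi>_def by (rule has_derivative_diff)
      then show ?thesis by (simp add: fd_eq)
    qed
    have "fd \<Psi> (z0, y0) Z = 0 - 0"
      unfolding Z_def
      by (rule bracket_pushforward[where ?V2.0="\<lambda>_. 0" and ?V2'="\<lambda>_. 0" and ?W2.0="\<lambda>_. 0" and ?W2'="\<lambda>_. 0",
            OF finYE oS pS C W1 W2])
        (simp_all add: fd\<Psi> W_def pr_A)
    then have "fd sr z0 (fst Z) = fd pr y0 (snd Z)" using fd\<Psi>[OF pS, of Z] by simp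
    then show ?thesis
      by (simp add: tmap_eq_fd[OF Arr_mfd] tmap_eq_fd[OF Tot_mfd] sr_def pr_def z0_def y0_def c_def d_def e_def src)
  qed
  \<comment> \<open>With a horizontal arrow component and tangency both established, the derivative
    of the extension on \<open>Z\<close> is the lifted transport of its bundle component.\<close>
  ultimately have lt: "fd Fr (z0, y0) Z = lift_transport X H P \<gamma> a (snd Z)"
    using tm0[of "fst Z" "snd Z"] by simp
  have om_f: "om_rep f (chart_map f (lact P \<gamma> a)) v = om (lact P \<gamma> a) v" for v
    using om_rep_apply[OF f, of v] by (simp add: f_def tcoord_chart_at[OF Tot_mfd])
  have om_d: "om_rep d y0 v = om a v" for v
    using om_rep_apply[OF d, of v] by (simp add: d_def y0_def tcoord_chart_at[OF Tot_mfd])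
  have FW: "fd Fr (z0, y0) (W Q (z0, y0)) = hl (lact P \<gamma> a) (d_tgt X \<gamma> (Q \<gamma>))" if "Q \<gamma> \<in> H \<gamma>" for Q
    unfolding W0 lift_transport_hl[OF src that, symmetric] by (rule tm0[OF that]) simp
  \<comment> \<open>Cartan's formula along the action computes \<omega> of the transported vector
    and along the second projection \<omega> of the original one; equivariance of \<omega> equates
    the two.\<close>
  have "- curv (lact P \<gamma> a) (d_tgt X \<gamma> h1) (d_tgt X \<gamma> h2) = om (lact P \<gamma> a) (lift_transport X H P \<gamma> a (snd Z))"
    using key1 unfolding lt FW[of P1, OF P1(3)] FW[of P2, OF P2(3)] unfolding Fr0 om_f
    by (simp add: curv_def f_def P1(2) P2(2))
  also have "\<dots> = om a (snd Z)" by (rule om_lift_transport[OF src])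
  also have "\<dots> = - curv a (d_src X \<gamma> h1) (d_src X \<gamma> h2)"
    using key2 by (simp add: fd_snd om_d W0 P1(2) P2(2) curv_def d_def[symmetric] y0_def[symmetric])
  finally show ?thesis by simp
qed

text \<open>Any point \<open>a\<close> over the source of the arrow trivialises both fibres
  compatibly, through \<open>a\<close> and its image under the arrow; the condition becomes
  \<open>curv_invariant\<close> for horizontal components.\<close>

lemma curvature_groupoid_two_form: "groupoid_two_form MG G X H P (curvature MG G (Obj X) P \<D>)"
  unfolding groupoid_two_form_def
proof (intro conjI allI)
  show "ad_two_form MG G (Obj X) P (curvature MG G (Obj X) P \<D>)" by (rule curvature_ad_two_form)
  fix \<gamma> v w
  obtain a where a: "proj P a = src X \<gamma>" by (rule fibre_nonempty)
  note src = a[symmetric]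
  show "ad_act P \<gamma> (hor_form2 X H (pullback2 (Arr X) (Obj X) (src X) (curvature MG G (Obj X) P \<D>)) \<gamma> v w)
      = hor_form2 X H (pullback2 (Arr X) (Obj X) (tgt X) (curvature MG G (Obj X) P \<D>)) \<gamma> v w"
    unfolding hor_form2_def pullback2_def proj_lact[OF src, symmetric] src curvature_eq ad_act_ad_class[OF src]
    by (simp add: curv_invariant[OF src hor_comp_mem hor_comp_mem] src[symmetric])
qed

end

theorem lemma4p5p3:
  fixes MG :: "('g::{t2_space, second_countable_topology}, 'w::real_normed_vector) charted"
    and G :: "'g monoid"
    and X :: "('x::{t2_space, second_countable_topology}, 'u::real_normed_vector,
               'y::{t2_space, second_countable_topology}, 'v::real_normed_vector) groupoid"
    and H :: "'y \<Rightarrow> 'v set"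
    and P :: "('p::{t2_space, second_countable_topology}, 'r::real_normed_vector,
               'g, 'x, 'y) gbundle"
    and \<D> :: "('p \<times> 'r) set \<Rightarrow> ('p \<times> 'w) set"
  assumes "lie_group MG G"
    and "lie_groupoid X"
    and "integrable_connection X H"
    and "principal_gpd_bundle MG G X P"
    and "bundle_connection MG G X H P \<D>"
  shows "groupoid_two_form MG G X H P (curvature MG G (Obj X) P \<D>)"
proof -
  interpret gconnection MG G X P \<D> H
  proof
    show "lie_group MG G" by fact
    show "smooth_manifold (Obj X)" using assms(2) by (simp add: lie_groupoid_def)
    show "principal_bundle MG G (Obj X) P" using assms(4) by (simp add: principal_gpd_bundle_def)
    show "vb_morphism MG G P \<D>" using assms(5) by (simp add: bundle_connection_def)
    show "\<D> (jG MG G P Q) = Q" if "Q \<in> ad_fibre MG G P x" for x Q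
      using assms(5) that unfolding bundle_connection_def by blast
  qed fact+
  show ?thesis by (rule curvature_groupoid_two_form)
qed

end
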